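(* Let $H$ be a subgroup of a finite group $G$. Let $\Gamma_H(G)=\coprod_{i=1}^{[G:H]}\coprod_{j=1}^{c_i}\Gamma_{i,j}$ be the decomposition of $\Gamma_H(G)$ into connected components, where the objects in $\Gamma_{i,j}$ have cardinality $i\cdot|H|$ for all $j=1,2,\dots,c_i$. Fix an object $A_{i,j}$ of $\Gamma_{i,j}$ for all $i$ and $j$ and set $K_{i,j}:=K_{A_{i,j}}$. Then the representations $\mathsf{Ind}_{A_{i,j}}W$, as $i,j$ vary and $W$ runs over all the inequivalent irreducible representations of $K_{i,j}$, are all the inequivalent irreducible $H$-global $G$-partial representations, up to isomorphism.
   Context: All groups are finite and all vector spaces are finite-dimensional over $\mathbb{C}$. A $G$-partial representation $(V,\pi)$ is a map $\pi\colon G\to\operatorname{End}(V)$ such that for all $g,h\in G$: $\pi(1_G)=\mathrm{Id}_V$; $\pi(g^{-1})\pi(gh)=\pi(g^{-1})\pi(g)\pi(h)$; $\pi(gh)\pi(h^{-1})=\pi(g)\pi(h)\pi(h^{-1})$. It is $H$-global if the restriction of $\pi$ to $H$ is a (usual) representation of $H$. Morphisms are linear maps commuting with the maps $\pi(g)$; irreducible means nonzero with no proper nonzero subspace stable under all $\pi(g)$. $\mathcal{P}_H(G/H):=\{A\subseteq G\mid H\subseteq A\text{ and }A\text{ is a union of left cosets of }H\}$. $\Gamma_H(G):=\{(A,g)\in\mathcal{P}_H(G/H)\times G\mid g^{-1}\in A\}$ is the groupoid with operation $(A,g)\cdot(B,h):=(B,gh)$ if $A=hB$, and undefined otherwise;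 its objects are the elements of $\mathcal{P}_H(G/H)$, with source $s(A,g)=A$ and range $r(A,g)=gA$. All objects of a connected component have the same cardinality as subsets of $G$. The groupoid algebra $\mathbb{C}\Gamma_H(G)$ has basis $\Gamma_H(G)$, with undefined products set to $0$. A $\mathbb{C}\Gamma_H(G)$-module $V$ is regarded as an $H$-global $G$-partial representation by letting $\pi(g)$ be the action of $\mu_p(g):=\sum_{A\in\mathcal{P}_H(G/H),\,A\ni g^{-1}}(A,g)$. For $A\in\mathcal{P}_H(G/H)$ set $K_A:=\{g\in G\mid gA=A\}$. Then $(A,1_G)\,\mathbb{C}\Gamma_H(G)\,(A,1_G)=\mathrm{span}_{\mathbb{C}}\{(A,g)\mid gA=A\}\cong\mathbb{C}[K_A]$. For a representation $W$ of $K_A$, $$\mathsf{Ind}_AW:=\mathbb{C}\Gamma_H(G)(A,1_G)\otimes_{\mathbb{C}[K_A]}W,$$ where $\mathbb{C}\Gamma_H(G)(A,1_G)=\mathrm{span}_{\mathbb{C}}\{(A,x)\mid x\in A^{-1}\}$. Explicitly, $\pi(g)((A,x)\otimes w)=(A,gx)\otimes w$ if $gx\in A^{-1}$ and $0$ otherwise. *)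

theory Defs
  imports
    Complex_Main
    "HOL-Library.Poly_Mapping"
    "HOL-Algebra.AbelCoset"
    "HOL-Algebra.Left_Coset"
    "Jordan_Normal_Form.VS_Connect"
begin

section \<open>Representations and partial representations\<close>

text \<open>
  Complex vector spaces are \<^locale>\<open>vectorspace\<close>s over \<open>class_ring :: complex ring\<close>. They carry
  their own carrier set, so that spaces living in different types can be compared. The fields
  \<open>mult\<close> and \<open>one\<close> of a \<^typ>\<open>(complex, 'v) module\<close> play no role when it is used as a vector
  space; they are used when it is an algebra.
\<close>

abbreviation complex_field :: "complex ring" where
  "complex_field \<equiv> class_ring"

definition fd_vector_space :: "(complex, 'v) module \<Rightarrow> bool" where
  "fd_vector_space V \<longleftrightarrow> vectorspace complex_field V \<and> vectorspace.fin_dim complex_field V"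

definition group_rep ::
  "('g, 'b) monoid_scheme \<Rightarrow> (complex, 'v) module \<Rightarrow> ('g \<Rightarrow> 'v \<Rightarrow> 'v) \<Rightarrow> bool" where
  "group_rep K V \<rho> \<longleftrightarrow>
     fd_vector_space V \<and>
     (\<forall>k\<in>carrier K. \<rho> k \<in> LinearCombinations.module_hom complex_field V V) \<and>
     (\<forall>v\<in>carrier V. \<rho> \<one>\<^bsub>K\<^esub> v = v) \<and>
     (\<forall>k\<in>carrier K. \<forall>l\<in>carrier K. \<forall>v\<in>carrier V. \<rho> (k \<otimes>\<^bsub>K\<^esub> l) v = \<rho> k (\<rho> l v))"

definition partial_rep ::
  "('g, 'b) monoid_scheme \<Rightarrow> (complex, 'v) module \<Rightarrow> ('g \<Rightarrow> 'v \<Rightarrow> 'v) \<Rightarrow> bool" where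
  "partial_rep G V \<pi> \<longleftrightarrow>
     fd_vector_space V \<and>
     (\<forall>g\<in>carrier G. \<pi> g \<in> LinearCombinations.module_hom complex_field V V) \<and>
     (\<forall>v\<in>carrier V. \<pi> \<one>\<^bsub>G\<^esub> v = v) \<and>
     (\<forall>g\<in>carrier G. \<forall>h\<in>carrier G. \<forall>v\<in>carrier V.
        \<pi> (inv\<^bsub>G\<^esub> g) (\<pi> (g \<otimes>\<^bsub>G\<^esub> h) v) = \<pi> (inv\<^bsub>G\<^esub> g) (\<pi> g (\<pi> h v))) \<and>
     (\<forall>g\<in>carrier G. \<forall>h\<in>carrier G. \<forall>v\<in>carrier V.
        \<pi> (g \<otimes>\<^bsub>G\<^esub> h) (\<pi> (inv\<^bsub>G\<^esub> h) v) = \<pi> g (\<pi> h (\<pi> (inv\<^bsub>G\<^esub> h) v)))"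

definition global_partial_rep ::
  "('g, 'b) monoid_scheme \<Rightarrow> 'g set \<Rightarrow> (complex, 'v) module \<Rightarrow> ('g \<Rightarrow> 'v \<Rightarrow> 'v) \<Rightarrow> bool" where
  "global_partial_rep G H V \<pi> \<longleftrightarrow> partial_rep G V \<pi> \<and> group_rep (G\<lparr>carrier := H\<rparr>) V \<pi>"

text \<open>Irreducibility and isomorphism only refer to the operators indexed by the carrier, and are
  shared by representations and partial representations.\<close>

definition irreducible_action ::
  "('g, 'b) monoid_scheme \<Rightarrow> (complex, 'v) module \<Rightarrow> ('g \<Rightarrow> 'v \<Rightarrow> 'v) \<Rightarrow> bool" where
  "irreducible_action G V \<pi> \<longleftrightarrow>
     carrier V \<noteq> {\<zero>\<^bsub>V\<^esub>} \<and>
     (\<forall>U. VectorSpace.subspace complex_field U V \<and> (\<forall>g\<in>carrier G. \<forall>u\<in>U. \<pi> g u \<in> U) \<longrightarrow>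
        U = {\<zero>\<^bsub>V\<^esub>} \<or> U = carrier V)"

definition isomorphic_actions ::
  "('g, 'b) monoid_scheme \<Rightarrow> (complex, 'v) module \<Rightarrow> ('g \<Rightarrow> 'v \<Rightarrow> 'v) \<Rightarrow>
     (complex, 'w) module \<Rightarrow> ('g \<Rightarrow> 'w \<Rightarrow> 'w) \<Rightarrow> bool" where
  "isomorphic_actions G V \<pi> W \<sigma> \<longleftrightarrow>
     (\<exists>T\<in>LinearCombinations.module_hom complex_field V W. bij_betw T (carrier V) (carrier W) \<and>
        (\<forall>g\<in>carrier G. \<forall>v\<in>carrier V. T (\<pi> g v) = \<sigma> g (T v)))"

definition irreducible_rep ::
  "('g, 'b) monoid_scheme \<Rightarrow> (complex, 'v) module \<Rightarrow> ('g \<Rightarrow> 'v \<Rightarrow> 'v) \<Rightarrow> bool" where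
  "irreducible_rep K V \<rho> \<longleftrightarrow> group_rep K V \<rho> \<and> irreducible_action K V \<rho>"

definition irreducible_global_partial_rep ::
  "('g, 'b) monoid_scheme \<Rightarrow> 'g set \<Rightarrow> (complex, 'v) module \<Rightarrow> ('g \<Rightarrow> 'v \<Rightarrow> 'v) \<Rightarrow> bool" where
  "irreducible_global_partial_rep G H V \<pi> \<longleftrightarrow>
     global_partial_rep G H V \<pi> \<and> irreducible_action G V \<pi>"


section \<open>The groupoid of a subgroup\<close>

definition coset_unions :: "('g, 'b) monoid_scheme \<Rightarrow> 'g set \<Rightarrow> 'g set set" where
  "coset_unions G H = {A. H \<subseteq> A \<and> (\<exists>S. S \<subseteq> lcosets\<^bsub>G\<^esub> H \<and> A = \<Union>S)}"

definition coset_groupoid :: "('g, 'b) monoid_scheme \<Rightarrow> 'g set \<Rightarrow> ('g set \<times> 'g) set" where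
  "coset_groupoid G H = {(A, g). A \<in> coset_unions G H \<and> g \<in> carrier G \<and> inv\<^bsub>G\<^esub> g \<in> A}"

fun gpd_mult ::
  "('g, 'b) monoid_scheme \<Rightarrow> 'g set \<times> 'g \<Rightarrow> 'g set \<times> 'g \<Rightarrow> ('g set \<times> 'g) option" where
  "gpd_mult G (A, g) (B, h) = (if A = h <#\<^bsub>G\<^esub> B then Some (B, g \<otimes>\<^bsub>G\<^esub> h) else None)"

fun gpd_source :: "'g set \<times> 'g \<Rightarrow> 'g set" where
  "gpd_source (A, g) = A"

fun gpd_range :: "('g, 'b) monoid_scheme \<Rightarrow> 'g set \<times> 'g \<Rightarrow> 'g set" where
  "gpd_range G (A, g) = g <#\<^bsub>G\<^esub> A"

definition gpd_connected :: "('g, 'b) monoid_scheme \<Rightarrow> 'g set \<Rightarrow> ('g set \<times> 'g set) set" where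
  "gpd_connected G H =
     {(gpd_source \<gamma>, gpd_range G \<gamma>) | \<gamma>. \<gamma> \<in> coset_groupoid G H}"

text \<open>A connected component is the full subgroupoid on a class of mutually connected objects,
  given by its set of arrows.\<close>

definition gpd_components :: "('g, 'b) monoid_scheme \<Rightarrow> 'g set \<Rightarrow> ('g set \<times> 'g) set set" where
  "gpd_components G H =
     {{\<gamma> \<in> coset_groupoid G H. gpd_source \<gamma> \<in> C \<and> gpd_range G \<gamma> \<in> C} | C.
        C \<in> coset_unions G H // gpd_connected G H}"

definition component_indices ::
  "('g, 'b) monoid_scheme \<Rightarrow> 'g set \<Rightarrow> (nat \<Rightarrow> nat) \<Rightarrow> (nat \<times> nat) set" where
  "component_indices G H c = (SIGMA i:{1..card (lcosets\<^bsub>G\<^esub> H)}. {1..c i})"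

definition stabilizer_set :: "('g, 'b) monoid_scheme \<Rightarrow> 'g set \<Rightarrow> 'g set" where
  "stabilizer_set G A = {g \<in> carrier G. g <#\<^bsub>G\<^esub> A = A}"

definition stabilizer_group :: "('g, 'b) monoid_scheme \<Rightarrow> 'g set \<Rightarrow> ('g, 'b) monoid_scheme" where
  "stabilizer_group G A = G\<lparr>carrier := stabilizer_set G A\<rparr>"


section \<open>Algebras with a given basis\<close>

definition scale_pm :: "complex \<Rightarrow> ('x \<Rightarrow>\<^sub>0 complex) \<Rightarrow> ('x \<Rightarrow>\<^sub>0 complex)" where
  "scale_pm c f = Poly_Mapping.map (\<lambda>z. c * z) f"

definition basis_elt :: "'x \<Rightarrow> ('x \<Rightarrow>\<^sub>0 complex)" where
  "basis_elt x = Poly_Mapping.single x 1"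

definition lin_ext :: "('x \<Rightarrow> ('y \<Rightarrow>\<^sub>0 complex)) \<Rightarrow> ('x \<Rightarrow>\<^sub>0 complex) \<Rightarrow> ('y \<Rightarrow>\<^sub>0 complex)" where
  "lin_ext \<phi> f = (\<Sum>x\<in>Poly_Mapping.keys f. scale_pm (Poly_Mapping.lookup f x) (\<phi> x))"

text \<open>The space with basis \<open>S\<close> and the bilinear multiplication extending the partial operation
  \<open>m\<close> on basis elements, where undefined products are 0. The argument \<open>u\<close> is the unit.\<close>

definition basis_algebra ::
  "'x set \<Rightarrow> ('x \<Rightarrow> 'x \<Rightarrow> 'x option) \<Rightarrow> ('x \<Rightarrow>\<^sub>0 complex) \<Rightarrow> (complex, 'x \<Rightarrow>\<^sub>0 complex) module" where
  "basis_algebra S m u =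
     \<lparr> carrier = {f. Poly_Mapping.keys f \<subseteq> S},
       mult = (\<lambda>f g. lin_ext (\<lambda>x. lin_ext (\<lambda>y.
                 case m x y of None \<Rightarrow> 0 | Some z \<Rightarrow> basis_elt z) g) f),
       one = u, zero = 0, add = (+), smult = scale_pm \<rparr>"

definition free_space :: "'x set \<Rightarrow> (complex, 'x \<Rightarrow>\<^sub>0 complex) module" where
  "free_space S = basis_algebra S (\<lambda>_ _. None) 0"

definition group_algebra :: "('g, 'b) monoid_scheme \<Rightarrow> (complex, 'g \<Rightarrow>\<^sub>0 complex) module" where
  "group_algebra K =
     basis_algebra (carrier K) (\<lambda>x y. Some (x \<otimes>\<^bsub>K\<^esub> y)) (basis_elt \<one>\<^bsub>K\<^esub>)"

definition groupoid_algebra ::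
  "('g, 'b) monoid_scheme \<Rightarrow> 'g set \<Rightarrow> (complex, ('g set \<times> 'g) \<Rightarrow>\<^sub>0 complex) module" where
  "groupoid_algebra G H =
     basis_algebra (coset_groupoid G H) (gpd_mult G)
       (\<Sum>A\<in>coset_unions G H. basis_elt (A, \<one>\<^bsub>G\<^esub>))"

definition mu_p ::
  "('g, 'b) monoid_scheme \<Rightarrow> 'g set \<Rightarrow> 'g \<Rightarrow> (('g set \<times> 'g) \<Rightarrow>\<^sub>0 complex)" where
  "mu_p G H g = (\<Sum>A\<in>{A \<in> coset_unions G H. inv\<^bsub>G\<^esub> g \<in> A}. basis_elt (A, g))"


section \<open>Tensor products over an algebra\<close>

definition quotient_space :: "(complex, 'v) module \<Rightarrow> 'v set \<Rightarrow> (complex, 'v set) module" where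
  "quotient_space V N =
     \<lparr> carrier = a_rcosets\<^bsub>V\<^esub> N, mult = (\<lambda>_ _. N), one = N, zero = N,
       add = set_add V, smult = (\<lambda>c X. \<Union>x\<in>X. N +>\<^bsub>V\<^esub> (c \<odot>\<^bsub>V\<^esub> x)) \<rparr>"

text \<open>For an algebra \<open>R\<close>, a right module \<open>M\<close> with action \<open>ra\<close> and a left module \<open>N\<close> with action
  \<open>la\<close>, the space \<open>M \<otimes>\<^sub>R N\<close> is the free vector space on \<open>M \<times> N\<close> modulo bilinearity and
  \<open>(m r) \<otimes> n = m \<otimes> (r n)\<close>.\<close>

definition tensor_relations ::
  "(complex, 'r) module \<Rightarrow> (complex, 'm) module \<Rightarrow> ('m \<Rightarrow> 'r \<Rightarrow> 'm) \<Rightarrow>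
     (complex, 'n) module \<Rightarrow> ('r \<Rightarrow> 'n \<Rightarrow> 'n) \<Rightarrow> ('m \<times> 'n \<Rightarrow>\<^sub>0 complex) set" where
  "tensor_relations R M ra N la =
     {basis_elt (m \<oplus>\<^bsub>M\<^esub> m', n) - basis_elt (m, n) - basis_elt (m', n) | m m' n.
        m \<in> carrier M \<and> m' \<in> carrier M \<and> n \<in> carrier N} \<union>
     {basis_elt (m, n \<oplus>\<^bsub>N\<^esub> n') - basis_elt (m, n) - basis_elt (m, n') | m n n'.
        m \<in> carrier M \<and> n \<in> carrier N \<and> n' \<in> carrier N} \<union>
     {basis_elt (c \<odot>\<^bsub>M\<^esub> m, n) - scale_pm c (basis_elt (m, n)) | c m n.
        m \<in> carrier M \<and> n \<in> carrier N} \<union>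
     {basis_elt (m, c \<odot>\<^bsub>N\<^esub> n) - scale_pm c (basis_elt (m, n)) | c m n.
        m \<in> carrier M \<and> n \<in> carrier N} \<union>
     {basis_elt (ra m r, n) - basis_elt (m, la r n) | m r n.
        m \<in> carrier M \<and> r \<in> carrier R \<and> n \<in> carrier N}"

definition tensor_kernel ::
  "(complex, 'r) module \<Rightarrow> (complex, 'm) module \<Rightarrow> ('m \<Rightarrow> 'r \<Rightarrow> 'm) \<Rightarrow>
     (complex, 'n) module \<Rightarrow> ('r \<Rightarrow> 'n \<Rightarrow> 'n) \<Rightarrow> ('m \<times> 'n \<Rightarrow>\<^sub>0 complex) set" where
  "tensor_kernel R M ra N la =
     LinearCombinations.module.span complex_field (free_space (carrier M \<times> carrier N))
       (tensor_relations R M ra N la)"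

definition tensor_space ::
  "(complex, 'r) module \<Rightarrow> (complex, 'm) module \<Rightarrow> ('m \<Rightarrow> 'r \<Rightarrow> 'm) \<Rightarrow>
     (complex, 'n) module \<Rightarrow> ('r \<Rightarrow> 'n \<Rightarrow> 'n) \<Rightarrow> (complex, ('m \<times> 'n \<Rightarrow>\<^sub>0 complex) set) module" where
  "tensor_space R M ra N la =
     quotient_space (free_space (carrier M \<times> carrier N)) (tensor_kernel R M ra N la)"

text \<open>The map \<open>\<phi> \<otimes> id\<close> induced by an endomorphism \<open>\<phi>\<close> of the right module \<open>M\<close>.\<close>

definition tensor_map_left ::
  "(complex, 'r) module \<Rightarrow> (complex, 'm) module \<Rightarrow> ('m \<Rightarrow> 'r \<Rightarrow> 'm) \<Rightarrow>
     (complex, 'n) module \<Rightarrow> ('r \<Rightarrow> 'n \<Rightarrow> 'n) \<Rightarrow> ('m \<Rightarrow> 'm) \<Rightarrow>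
     ('m \<times> 'n \<Rightarrow>\<^sub>0 complex) set \<Rightarrow> ('m \<times> 'n \<Rightarrow>\<^sub>0 complex) set" where
  "tensor_map_left R M ra N la \<phi> X =
     (\<Union>f\<in>X. tensor_kernel R M ra N la +>\<^bsub>free_space (carrier M \<times> carrier N)\<^esub>
        lin_ext (\<lambda>(m, n). basis_elt (\<phi> m, n)) f)"


section \<open>Induced partial representations\<close>

definition left_ideal_at ::
  "('g, 'b) monoid_scheme \<Rightarrow> 'g set \<Rightarrow> 'g set \<Rightarrow>
     (complex, ('g set \<times> 'g) \<Rightarrow>\<^sub>0 complex) module" where
  "left_ideal_at G H A =
     (groupoid_algebra G H)\<lparr>carrier :=
        {f \<otimes>\<^bsub>groupoid_algebra G H\<^esub> basis_elt (A, \<one>\<^bsub>G\<^esub>) | f. f \<in> carrier (groupoid_algebra G H)}\<rparr>"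

text \<open>The right action of the group algebra of the stabilizer of \<open>A\<close> on the left ideal, through
  its identification \<open>k \<mapsto> (A, k)\<close> with the corner of the groupoid algebra at \<open>A\<close>.\<close>

definition corner_embed :: "'g set \<Rightarrow> ('g \<Rightarrow>\<^sub>0 complex) \<Rightarrow> (('g set \<times> 'g) \<Rightarrow>\<^sub>0 complex)" where
  "corner_embed A = lin_ext (\<lambda>k. basis_elt (A, k))"

definition right_corner_action ::
  "('g, 'b) monoid_scheme \<Rightarrow> 'g set \<Rightarrow> 'g set \<Rightarrow>
     (('g set \<times> 'g) \<Rightarrow>\<^sub>0 complex) \<Rightarrow> ('g \<Rightarrow>\<^sub>0 complex) \<Rightarrow> (('g set \<times> 'g) \<Rightarrow>\<^sub>0 complex)" where
  "right_corner_action G H A f a = f \<otimes>\<^bsub>groupoid_algebra G H\<^esub> corner_embed A a"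

definition group_algebra_action ::
  "(complex, 'w) module \<Rightarrow> ('g \<Rightarrow> 'w \<Rightarrow> 'w) \<Rightarrow> ('g \<Rightarrow>\<^sub>0 complex) \<Rightarrow> 'w \<Rightarrow> 'w" where
  "group_algebra_action W \<rho> a w =
     (\<Oplus>\<^bsub>W\<^esub>k\<in>Poly_Mapping.keys a. Poly_Mapping.lookup a k \<odot>\<^bsub>W\<^esub> \<rho> k w)"

definition Ind_space ::
  "('g, 'b) monoid_scheme \<Rightarrow> 'g set \<Rightarrow> 'g set \<Rightarrow> (complex, 'w) module \<Rightarrow> ('g \<Rightarrow> 'w \<Rightarrow> 'w) \<Rightarrow>
     (complex, ((('g set \<times> 'g) \<Rightarrow>\<^sub>0 complex) \<times> 'w \<Rightarrow>\<^sub>0 complex) set) module" where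
  "Ind_space G H A W \<rho> =
     tensor_space (group_algebra (stabilizer_group G A))
       (left_ideal_at G H A) (right_corner_action G H A) W (group_algebra_action W \<rho>)"

definition Ind_module_action ::
  "('g, 'b) monoid_scheme \<Rightarrow> 'g set \<Rightarrow> 'g set \<Rightarrow> (complex, 'w) module \<Rightarrow> ('g \<Rightarrow> 'w \<Rightarrow> 'w) \<Rightarrow>
     (('g set \<times> 'g) \<Rightarrow>\<^sub>0 complex) \<Rightarrow>
     ((('g set \<times> 'g) \<Rightarrow>\<^sub>0 complex) \<times> 'w \<Rightarrow>\<^sub>0 complex) set \<Rightarrow>
     ((('g set \<times> 'g) \<Rightarrow>\<^sub>0 complex) \<times> 'w \<Rightarrow>\<^sub>0 complex) set" where
  "Ind_module_action G H A W \<rho> a =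
     tensor_map_left (group_algebra (stabilizer_group G A))
       (left_ideal_at G H A) (right_corner_action G H A) W (group_algebra_action W \<rho>)
       (\<lambda>f. a \<otimes>\<^bsub>groupoid_algebra G H\<^esub> f)"

definition Ind_action ::
  "('g, 'b) monoid_scheme \<Rightarrow> 'g set \<Rightarrow> 'g set \<Rightarrow> (complex, 'w) module \<Rightarrow> ('g \<Rightarrow> 'w \<Rightarrow> 'w) \<Rightarrow> 'g \<Rightarrow>
     ((('g set \<times> 'g) \<Rightarrow>\<^sub>0 complex) \<times> 'w \<Rightarrow>\<^sub>0 complex) set \<Rightarrow>
     ((('g set \<times> 'g) \<Rightarrow>\<^sub>0 complex) \<times> 'w \<Rightarrow>\<^sub>0 complex) set" where
  "Ind_action G H A W \<rho> g = Ind_module_action G H A W \<rho> (mu_p G H g)"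

end

theory Submission
  imports Defs
begin

text \<open>
  The induced representation \<open>Ind\<^sub>A W\<close> is identified with the space of \<open>K\<^sub>A\<close>-equivariant
  functions \<open>A\<^sup>-\<^sup>1 \<rightarrow> W\<close>, on which \<open>G\<close> acts by partial translation. In any partial representation
  the operators \<open>\<pi> g \<circ> \<pi> g\<^sup>-\<^sup>1\<close> are commuting idempotents; on the function model, the functions
  fixed by those with \<open>g \<in> A\<close> are exactly the ones supported on \<open>K\<^sub>A\<close>, a copy of \<open>W\<close>. This recovers
  \<open>W\<close> from \<open>Ind\<^sub>A W\<close>, gives irreducibility, and separates distinct components by comparing
  cardinalities. Conversely, for an irreducible \<open>V\<close> one takes \<open>A\<close> of maximal cardinality such that
  the common fixed space \<open>W\<close> of the idempotents with \<open>g \<in> A\<close> is nonzero; projecting \<open>\<pi> x\<^sup>-\<^sup>1 v\<close>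
  to \<open>W\<close> for each \<open>x \<in> A\<^sup>-\<^sup>1\<close> is an isomorphism of \<open>V\<close> with the function model.
\<close>

section \<open>Vector spaces with operators\<close>

text \<open>What makes W visible inside Ind_A W is the support condition behind the idempotents. In
  the function model, the idempotent at g multiplies a function by the indicator of those y with g
  in y A, so being fixed for all g in a set B means being supported where B lies in y A. For B = A
  finiteness forces y A = A, that is y in K_A; for two different objects it gives inclusions between
  translates, hence a comparison of sizes. Size is also what selects A for an arbitrary irreducible
  V. In groupoid terms the fixed space for A is the sum of the pieces (B,1)V over all B containing
  A; maximality leaves only the piece of A, so the product of the idempotents over A plays the part
  of (A,1) without any groupoid action being constructed on V. The tensor product is a set of cosets
  of a free space, where even the vector space axioms are not given in advance. It is compared with
  the model through a linear map \<Phi> whose kernel is shown to be exactly the span of the tensor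
  relations, and every property is pulled back along the induced bijection.\<close>

lemma subspaceI:
  assumes "vectorspace complex_field V" "U \<subseteq> carrier V" "\<zero>\<^bsub>V\<^esub> \<in> U"
    "\<And>u v. u \<in> U \<Longrightarrow> v \<in> U \<Longrightarrow> u \<oplus>\<^bsub>V\<^esub> v \<in> U" "\<And>c u. u \<in> U \<Longrightarrow> c \<odot>\<^bsub>V\<^esub> u \<in> U"
  shows "VectorSpace.subspace complex_field U V"
  using assms by (simp add: VectorSpace.subspace_def submodule_def vectorspace_def)

lemma subspaceD:
  assumes "VectorSpace.subspace complex_field U V"
  shows "U \<subseteq> carrier V" "\<zero>\<^bsub>V\<^esub> \<in> U"
    "\<And>u v. u \<in> U \<Longrightarrow> v \<in> U \<Longrightarrow> u \<oplus>\<^bsub>V\<^esub> v \<in> U" "\<And>c u. u \<in> U \<Longrightarrow> c \<odot>\<^bsub>V\<^esub> u \<in> U"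
  using assms by (auto simp add: VectorSpace.subspace_def submodule_def)

lemma module_homI:
  assumes "\<And>v. v \<in> carrier V \<Longrightarrow> f v \<in> carrier W"
    "\<And>u v. u \<in> carrier V \<Longrightarrow> v \<in> carrier V \<Longrightarrow> f (u \<oplus>\<^bsub>V\<^esub> v) = f u \<oplus>\<^bsub>W\<^esub> f v"
    "\<And>c v. v \<in> carrier V \<Longrightarrow> f (c \<odot>\<^bsub>V\<^esub> v) = c \<odot>\<^bsub>W\<^esub> f v"
  shows "f \<in> LinearCombinations.module_hom complex_field V W"
  using assms by (simp add: LinearCombinations.module_hom_def)

lemma module_homD:
  assumes "f \<in> LinearCombinations.module_hom complex_field V W"
  shows "\<And>v. v \<in> carrier V \<Longrightarrow> f v \<in> carrier W"
    "\<And>u v. u \<in> carrier V \<Longrightarrow> v \<in> carrier V \<Longrightarrow> f (u \<oplus>\<^bsub>V\<^esub> v) = f u \<oplus>\<^bsub>W\<^esub> f v"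
    "\<And>c v. v \<in> carrier V \<Longrightarrow> f (c \<odot>\<^bsub>V\<^esub> v) = c \<odot>\<^bsub>W\<^esub> f v"
  using assms by (auto simp add: LinearCombinations.module_hom_def)

lemma module_hom_comp:
  assumes "f \<in> LinearCombinations.module_hom complex_field U V"
    "h \<in> LinearCombinations.module_hom complex_field V W"
  shows "(\<lambda>x. h (f x)) \<in> LinearCombinations.module_hom complex_field U W"
  using module_homD[OF assms(1)] module_homD[OF assms(2)] by (intro module_homI) auto

lemma linear_mapI:
  assumes "vectorspace complex_field V" "vectorspace complex_field W"
    "f \<in> LinearCombinations.module_hom complex_field V W"
  shows "linear_map complex_field V W f"
  using assms
  by (simp add: linear_map_def mod_hom_def mod_hom_axioms_def vectorspace_def)

lemma module_hom_zero:
  assumes "vectorspace complex_field V" "vectorspace complex_field W"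
    "f \<in> LinearCombinations.module_hom complex_field V W"
  shows "f \<zero>\<^bsub>V\<^esub> = \<zero>\<^bsub>W\<^esub>"
proof -
  interpret linear_map complex_field V W f using assms by (rule linear_mapI)
  show ?thesis by simp
qed

lemma module_hom_inv_into:
  assumes V: "vectorspace complex_field V"
    and f: "f \<in> LinearCombinations.module_hom complex_field V W"
    and bij: "bij_betw f (carrier V) (carrier W)"
  shows "inv_into (carrier V) f \<in> LinearCombinations.module_hom complex_field W V"
proof -
  interpret V: vectorspace complex_field V by fact
  let ?g = "inv_into (carrier V) f"
  note fD = module_homD[OF f]
  have g: "?g w \<in> carrier V" "f (?g w) = w" if "w \<in> carrier W" for w
    using that bij by (auto simp: bij_betw_def f_inv_into_f inv_into_into)
  have gf: "?g (f v) = v" if "v \<in> carrier V" for v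
    using that bij by (auto simp: bij_betw_def)
  show ?thesis
  proof (rule module_homI)
    fix u v assume uv: "u \<in> carrier W" "v \<in> carrier W"
    have "?g (u \<oplus>\<^bsub>W\<^esub> v) = ?g (f (?g u \<oplus>\<^bsub>V\<^esub> ?g v))" using uv g fD by simp
    then show "?g (u \<oplus>\<^bsub>W\<^esub> v) = ?g u \<oplus>\<^bsub>V\<^esub> ?g v" using uv g gf by simp
  next
    fix c v assume v: "v \<in> carrier W"
    have "?g (c \<odot>\<^bsub>W\<^esub> v) = ?g (f (c \<odot>\<^bsub>V\<^esub> ?g v))" using v g fD by simp
    then show "?g (c \<odot>\<^bsub>W\<^esub> v) = c \<odot>\<^bsub>V\<^esub> ?g v" using v g gf by simp
  qed (use g in auto)
qed

text \<open>Finite dimension is always obtained as that of an image, by rank-nullity: for the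
  inverse of a transport map, and for the projection of V onto a fixed space.\<close>

lemma fd_vector_space_image:
  assumes V: "fd_vector_space V" and W: "vectorspace complex_field W"
    and f: "f \<in> LinearCombinations.module_hom complex_field V W"
    and surj: "f ` carrier V = carrier W"
  shows "fd_vector_space W"
proof -
  interpret linear_map complex_field V W f
    using V W f by (intro linear_mapI) (auto simp: fd_vector_space_def)
  show ?thesis
    using rank_nullity_main(2) V W surj by (auto simp: fd_vector_space_def)
qed

lemma isomorphic_actions_sym:
  assumes "vectorspace complex_field V"
    and \<pi>: "\<And>g v. g \<in> carrier G \<Longrightarrow> v \<in> carrier V \<Longrightarrow> \<pi> g v \<in> carrier V"
    and iso: "isomorphic_actions G V \<pi> W \<sigma>"
  shows "isomorphic_actions G W \<sigma> V \<pi>"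
proof -
  obtain T where T: "T \<in> LinearCombinations.module_hom complex_field V W"
    "bij_betw T (carrier V) (carrier W)"
    "\<And>g v. g \<in> carrier G \<Longrightarrow> v \<in> carrier V \<Longrightarrow> T (\<pi> g v) = \<sigma> g (T v)"
    using iso by (auto simp: isomorphic_actions_def)
  let ?S = "inv_into (carrier V) T"
  have S: "?S w \<in> carrier V" "T (?S w) = w" if "w \<in> carrier W" for w
    using that T(2) by (auto simp: bij_betw_def f_inv_into_f inv_into_into)
  have ST: "?S (T v) = v" if "v \<in> carrier V" for v
    using that T(2) by (auto simp: bij_betw_def)
  have "?S (\<sigma> g w) = \<pi> g (?S w)" if "g \<in> carrier G" "w \<in> carrier W" for g w
    using T(3)[of g "?S w"] S[of w] ST[of "\<pi> g (?S w)"] \<pi> that by simp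
  then show ?thesis
    using module_hom_inv_into[OF assms(1) T(1,2)] bij_betw_inv_into[OF T(2)]
    by (auto simp: isomorphic_actions_def)
qed

lemma isomorphic_actions_trans:
  assumes "isomorphic_actions G U \<pi> V \<sigma>" "isomorphic_actions G V \<sigma> W \<tau>"
  shows "isomorphic_actions G U \<pi> W \<tau>"
proof -
  obtain T where T: "T \<in> LinearCombinations.module_hom complex_field U V"
    "bij_betw T (carrier U) (carrier V)"
    "\<And>g v. g \<in> carrier G \<Longrightarrow> v \<in> carrier U \<Longrightarrow> T (\<pi> g v) = \<sigma> g (T v)"
    using assms(1) by (auto simp: isomorphic_actions_def)
  obtain S where S: "S \<in> LinearCombinations.module_hom complex_field V W"
    "bij_betw S (carrier V) (carrier W)"
    "\<And>g v. g \<in> carrier G \<Longrightarrow> v \<in> carrier V \<Longrightarrow> S (\<sigma> g v) = \<tau> g (S v)"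
    using assms(2) by (auto simp: isomorphic_actions_def)
  show ?thesis
    unfolding isomorphic_actions_def
    using module_hom_comp[OF T(1) S(1)] bij_betw_trans[OF T(2) S(2)] T(3) S(3)
      module_homD(1)[OF T(1)]
    by (intro bexI[of _ "\<lambda>x. S (T x)"]) (auto simp: comp_def)
qed

text \<open>Here \<open>V'\<close> is a bare structure, not yet known to be a vector space.\<close>

locale transport =
  fixes V' :: "(complex, 'v) module" and V :: "(complex, 'u) module" and T :: "'v \<Rightarrow> 'u"
  assumes fd: "fd_vector_space V"
    and bij: "bij_betw T (carrier V') (carrier V)"
    and zero: "\<zero>\<^bsub>V'\<^esub> \<in> carrier V'" "T \<zero>\<^bsub>V'\<^esub> = \<zero>\<^bsub>V\<^esub>"
    and add: "\<And>x y. x \<in> carrier V' \<Longrightarrow> y \<in> carrier V' \<Longrightarrow> x \<oplus>\<^bsub>V'\<^esub> y \<in> carrier V'"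
      "\<And>x y. x \<in> carrier V' \<Longrightarrow> y \<in> carrier V' \<Longrightarrow> T (x \<oplus>\<^bsub>V'\<^esub> y) = T x \<oplus>\<^bsub>V\<^esub> T y"
    and smult: "\<And>c x. x \<in> carrier V' \<Longrightarrow> c \<odot>\<^bsub>V'\<^esub> x \<in> carrier V'"
      "\<And>c x. x \<in> carrier V' \<Longrightarrow> T (c \<odot>\<^bsub>V'\<^esub> x) = c \<odot>\<^bsub>V\<^esub> T x"
begin

sublocale V: vectorspace complex_field V
  using fd by (simp add: fd_vector_space_def)

lemma T_closed: "x \<in> carrier V' \<Longrightarrow> T x \<in> carrier V"
  using bij by (auto simp: bij_betw_def)

lemma T_eq_iff: "x \<in> carrier V' \<Longrightarrow> y \<in> carrier V' \<Longrightarrow> x = y \<longleftrightarrow> T x = T y"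
  using bij by (auto simp: bij_betw_def inj_on_def)

lemma T_surj: "v \<in> carrier V \<Longrightarrow> \<exists>x\<in>carrier V'. T x = v"
  using bij unfolding bij_betw_def by (metis imageE)

lemma T_hom: "T \<in> LinearCombinations.module_hom complex_field V' V"
  by (intro module_homI T_closed add smult)

text \<open>Injectivity of T turns each equational axiom of V' into the corresponding axiom of V,
  and surjectivity supplies the negatives.\<close>

lemma vectorspace: "vectorspace complex_field V'"
proof -
  note simps = T_eq_iff zero add smult T_closed
  have "\<exists>y\<in>carrier V'. x \<oplus>\<^bsub>V'\<^esub> y = \<zero>\<^bsub>V'\<^esub>" if x: "x \<in> carrier V'" for x
  proof -
    obtain y where "y \<in> carrier V'" "T y = \<ominus>\<^bsub>V\<^esub> T x"
      using T_surj[of "\<ominus>\<^bsub>V\<^esub> T x"] T_closed[OF x] by auto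
    then show ?thesis
      using x by (intro bexI[of _ y]) (simp_all add: simps V.r_neg)
  qed
  moreover have "x \<oplus>\<^bsub>V'\<^esub> y = y \<oplus>\<^bsub>V'\<^esub> x" if "x \<in> carrier V'" "y \<in> carrier V'" for x y
    using that V.M.a_comm[OF T_closed T_closed] by (simp add: simps)
  moreover have "x \<oplus>\<^bsub>V'\<^esub> y \<oplus>\<^bsub>V'\<^esub> z = x \<oplus>\<^bsub>V'\<^esub> (y \<oplus>\<^bsub>V'\<^esub> z)"
    if "x \<in> carrier V'" "y \<in> carrier V'" "z \<in> carrier V'" for x y z
    using that V.M.a_assoc[OF T_closed T_closed T_closed] by (simp add: simps)
  moreover have "x \<oplus>\<^bsub>V'\<^esub> \<zero>\<^bsub>V'\<^esub> = x" if "x \<in> carrier V'" for x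
    using that by (simp add: simps)
  moreover have "(a * b) \<odot>\<^bsub>V'\<^esub> x = a \<odot>\<^bsub>V'\<^esub> (b \<odot>\<^bsub>V'\<^esub> x)" if "x \<in> carrier V'" for a b x
    using that V.smult_assoc1[of a b "T x"] by (simp add: simps)
  moreover have "1 \<odot>\<^bsub>V'\<^esub> x = x" if "x \<in> carrier V'" for x
    using that V.smult_one[of "T x"] by (simp add: simps)
  moreover have "(a + b) \<odot>\<^bsub>V'\<^esub> x = a \<odot>\<^bsub>V'\<^esub> x \<oplus>\<^bsub>V'\<^esub> b \<odot>\<^bsub>V'\<^esub> x" if "x \<in> carrier V'" for a b x
    using that V.smult_l_distr[of a b "T x"] by (simp add: simps)
  moreover have "a \<odot>\<^bsub>V'\<^esub> (x \<oplus>\<^bsub>V'\<^esub> y) = a \<odot>\<^bsub>V'\<^esub> x \<oplus>\<^bsub>V'\<^esub> a \<odot>\<^bsub>V'\<^esub> y"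
    if "x \<in> carrier V'" "y \<in> carrier V'" for a x y
    using that V.smult_r_distr[of a "T x" "T y"] by (simp add: simps)
  ultimately show ?thesis
    by (intro vs_criteria class_field) (simp_all add: zero add smult)
qed

lemma fd_vector_space: "fd_vector_space V'"
proof (rule fd_vector_space_image[OF fd vectorspace])
  show "inv_into (carrier V') T \<in> LinearCombinations.module_hom complex_field V V'"
    by (rule module_hom_inv_into[OF vectorspace T_hom bij])
  show "inv_into (carrier V') T ` carrier V = carrier V'"
    by (rule bij_betw_imp_surj_on[OF bij_betw_inv_into[OF bij]])
qed

context
  fixes G :: "('g, 'b) monoid_scheme" and \<pi>' :: "'g \<Rightarrow> 'v \<Rightarrow> 'v" and \<pi> :: "'g \<Rightarrow> 'u \<Rightarrow> 'u"
  assumes \<pi>': "\<And>g x. g \<in> carrier G \<Longrightarrow> x \<in> carrier V' \<Longrightarrow> \<pi>' g x \<in> carrier V'"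
    "\<And>g x. g \<in> carrier G \<Longrightarrow> x \<in> carrier V' \<Longrightarrow> T (\<pi>' g x) = \<pi> g (T x)"
begin

lemma module_hom_transport:
  assumes g: "g \<in> carrier G"
    and hom: "\<pi> g \<in> LinearCombinations.module_hom complex_field V V"
  shows "\<pi>' g \<in> LinearCombinations.module_hom complex_field V' V'"
  using module_homD[OF hom] g
  by (intro module_homI) (auto simp: T_eq_iff add smult \<pi>' T_closed)

lemma isomorphic: "isomorphic_actions G V' \<pi>' V \<pi>"
  using T_hom bij \<pi>' by (auto simp: isomorphic_actions_def)

text \<open>The axioms are equations between elements of the carrier, so \<open>T_eq_iff\<close>
  reduces each of them to the same equation for \<pi>.\<close>

lemma global_partial_rep_transport:
  assumes "Group.group G" "H \<subseteq> carrier G" and gp: "global_partial_rep G H V \<pi>"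
  shows "global_partial_rep G H V' \<pi>'"
proof -
  interpret G: Group.group G by fact
  note H = subsetD[OF assms(2)]
  show ?thesis
    using gp module_hom_transport
    unfolding global_partial_rep_def partial_rep_def group_rep_def
    by (simp add: fd_vector_space T_eq_iff \<pi>' T_closed H)
qed

text \<open>A stable subspace U of V' is tested through its image under T, which is a stable
  subspace of V.\<close>

lemma irreducible_action_transport:
  assumes irr: "irreducible_action G V \<pi>"
  shows "irreducible_action G V' \<pi>'"
  unfolding irreducible_action_def
proof (intro conjI allI impI)
  have "carrier V \<noteq> {\<zero>\<^bsub>V\<^esub>}" using irr by (simp add: irreducible_action_def)
  then show "carrier V' \<noteq> {\<zero>\<^bsub>V'\<^esub>}" 
    using T_surj zero(2) T_closed V.M.zero_closed by (metis empty_iff insertI1 singletonD subsetI subset_singletonD)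
next
  fix U assume U: "VectorSpace.subspace complex_field U V' \<and> (\<forall>g\<in>carrier G. \<forall>u\<in>U. \<pi>' g u \<in> U)"
  note UD = subspaceD[OF conjunct1[OF U]]
  note UV = subsetD[OF UD(1)]
  have "VectorSpace.subspace complex_field (T ` U) V"
  proof (rule subspaceI)
    show "vectorspace complex_field V" by unfold_locales
    show "T ` U \<subseteq> carrier V" using UD(1) T_closed by auto
    show "\<zero>\<^bsub>V\<^esub> \<in> T ` U" using UD(2) zero by force
    show "u \<oplus>\<^bsub>V\<^esub> v \<in> T ` U" if uv: "u \<in> T ` U" "v \<in> T ` U" for u v
    proof -
      obtain x y where "u = T x" "v = T y" "x \<in> U" "y \<in> U" using uv by blast
      then show ?thesis using add(2)[OF UV UV, of x y] UD(3)[of x y] by (metis imageI)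
    qed
    show "c \<odot>\<^bsub>V\<^esub> u \<in> T ` U" if u: "u \<in> T ` U" for c u
    proof -
      obtain x where "u = T x" "x \<in> U" using u by blast
      then show ?thesis using smult(2)[OF UV, of x c] UD(4)[of x c] by (metis imageI)
    qed
  qed
  moreover have "\<forall>g\<in>carrier G. \<forall>u\<in>T ` U. \<pi> g u \<in> T ` U"
  proof (intro ballI)
    fix g u assume g: "g \<in> carrier G" and "u \<in> T ` U"
    then obtain x where x: "u = T x" "x \<in> U" by blast
    then show "\<pi> g u \<in> T ` U"
      using \<pi>'(2)[OF g UV[OF x(2)]] U g by (metis imageI)
  qed
  ultimately consider "T ` U = {\<zero>\<^bsub>V\<^esub>}" | "T ` U = carrier V"
    using irr by (auto simp: irreducible_action_def)
  then show "U = {\<zero>\<^bsub>V'\<^esub>} \<or> U = carrier V'"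
  proof cases
    case 1
    then have "u = \<zero>\<^bsub>V'\<^esub>" if "u \<in> U" for u
      using that T_eq_iff[OF UV[OF that] zero(1)] zero(2) by (metis imageI singletonD)
    then show ?thesis using UD(2) by blast
  next
    case 2
    then have "v \<in> U" if "v \<in> carrier V'" for v
      using T_closed[OF that] T_eq_iff[OF that UV] by (metis image_iff)
    then show ?thesis using UD(1) by blast
  qed
qed

end

end

section \<open>Unions of cosets\<close>

context Group.group begin

lemma mem_l_coset_iff:
  assumes "A \<subseteq> carrier G" "g \<in> carrier G"
  shows "y \<in> g <# A \<longleftrightarrow> y \<in> carrier G \<and> inv g \<otimes> y \<in> A"
proof
  assume "y \<in> g <# A"
  then obtain a where a: "a \<in> A" "y = g \<otimes> a" by (auto simp: l_coset_def)
  then have "inv g \<otimes> y = a" using assms by (simp add: subset_iff flip: m_assoc)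
  then show "y \<in> carrier G \<and> inv g \<otimes> y \<in> A" using a assms by auto
next
  assume y: "y \<in> carrier G \<and> inv g \<otimes> y \<in> A"
  then have "y = g \<otimes> (inv g \<otimes> y)" using assms by (simp flip: m_assoc)
  then show "y \<in> g <# A" using y by (auto simp: l_coset_def)
qed

text \<open>Each coset x H absorbs H on the right, and conversely a set absorbing H is the union of
  the cosets a H of its own elements a. With this form no family of cosets has to be
  exhibited.\<close>

lemma coset_unions_iff:
  assumes H: "subgroup H G"
  shows "A \<in> coset_unions G H \<longleftrightarrow> H \<subseteq> A \<and> A \<subseteq> carrier G \<and> (\<forall>a\<in>A. \<forall>h\<in>H. a \<otimes> h \<in> A)"
proof
  note HG = subgroup.subset[OF H]
  assume "A \<in> coset_unions G H"
  then obtain S where S: "H \<subseteq> A" "S \<subseteq> lcosets H" "A = \<Union>S" by (auto simp: coset_unions_def)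
  have coset: "\<exists>x\<in>carrier G. X = x <# H" if "X \<in> S" for X
    using S(2) that by (auto simp: LCOSETS_def)
  have "A \<subseteq> carrier G"
    using coset l_coset_subset_G[OF HG] S(3) by blast
  moreover have "a \<otimes> h \<in> A" if "a \<in> A" and h: "h \<in> H" for a h
  proof -
    obtain X x where X: "X \<in> S" "a \<in> X" "x \<in> carrier G" "X = x <# H"
      using \<open>a \<in> A\<close> S(3) coset by blast
    then obtain h' where "h' \<in> H" "a = x \<otimes> h'" by (auto simp: l_coset_def)
    then have "a \<otimes> h = x \<otimes> (h' \<otimes> h)" "h' \<otimes> h \<in> H"
      using X h HG H by (auto simp: m_assoc subset_iff subgroup.m_closed)
    then have "a \<otimes> h \<in> X" using X(4) by (auto simp: l_coset_def)
    then show ?thesis using X S(3) by blast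
  qed
  ultimately show "H \<subseteq> A \<and> A \<subseteq> carrier G \<and> (\<forall>a\<in>A. \<forall>h\<in>H. a \<otimes> h \<in> A)"
    using S(1) by blast
next
  assume A: "H \<subseteq> A \<and> A \<subseteq> carrier G \<and> (\<forall>a\<in>A. \<forall>h\<in>H. a \<otimes> h \<in> A)"
  let ?S = "(\<lambda>a. a <# H) ` A"
  have "\<Union>?S \<subseteq> A" using A by (auto simp: l_coset_def)
  moreover have "A \<subseteq> \<Union>?S" using lcos_self[OF _ H] A by blast
  moreover have "?S \<subseteq> lcosets H" using A by (auto simp: LCOSETS_def)
  ultimately show "A \<in> coset_unions G H" using A unfolding coset_unions_def by blast
qed

lemma coset_unionsD:
  assumes "subgroup H G" "A \<in> coset_unions G H"
  shows "H \<subseteq> A" "A \<subseteq> carrier G" "\<one> \<in> A" "\<And>a h. a \<in> A \<Longrightarrow> h \<in> H \<Longrightarrow> a \<otimes> h \<in> A"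
  using assms coset_unions_iff[OF assms(1)] subgroup.one_closed[OF assms(1)] by auto

text \<open>The arrow condition on g is exactly what keeps H inside the translate: h lies in g A iff
  g^-1 h lies in A, and A absorbs H on the right. A translate by an arbitrary g would only be a
  union of cosets.\<close>

lemma l_coset_in_coset_unions:
  assumes H: "subgroup H G" and A: "A \<in> coset_unions G H" and g: "g \<in> carrier G" "inv g \<in> A"
  shows "g <# A \<in> coset_unions G H"
proof -
  note AD = coset_unionsD[OF H A] and HG = subgroup.subset[OF H]
  have "h \<in> g <# A" if "h \<in> H" for h
    using AD(4)[OF g(2) that] that HG g by (auto simp: mem_l_coset_iff[OF AD(2)])
  moreover have "a \<otimes> h \<in> g <# A" if "a \<in> g <# A" "h \<in> H" for a h
    using AD(4)[of "inv g \<otimes> a" h] that HG g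
    by (auto simp: mem_l_coset_iff[OF AD(2)] m_assoc)
  ultimately show ?thesis
    using l_coset_subset_G[OF AD(2) g(1)] by (auto simp: coset_unions_iff[OF H])
qed

lemma l_coset_inv_cancel:
  assumes "A \<subseteq> carrier G" "g \<in> carrier G"
  shows "inv g <# (g <# A) = A"
  using assms by (simp add: lcos_m_assoc lcos_mult_one)

lemma gpd_connected_iff:
  "(A, B) \<in> gpd_connected G H \<longleftrightarrow>
    A \<in> coset_unions G H \<and> (\<exists>g\<in>carrier G. inv g \<in> A \<and> B = g <# A)"
proof
  assume "(A, B) \<in> gpd_connected G H"
  then obtain \<gamma> where \<gamma>: "\<gamma> \<in> coset_groupoid G H" "A = gpd_source \<gamma>" "B = gpd_range G \<gamma>"
    unfolding gpd_connected_def by blast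
  then show "A \<in> coset_unions G H \<and> (\<exists>g\<in>carrier G. inv g \<in> A \<and> B = g <# A)"
    by (cases \<gamma>) (auto simp: coset_groupoid_def)
next
  assume "A \<in> coset_unions G H \<and> (\<exists>g\<in>carrier G. inv g \<in> A \<and> B = g <# A)"
  then obtain g where "(A, g) \<in> coset_groupoid G H" "B = gpd_range G (A, g)"
    by (auto simp: coset_groupoid_def)
  then show "(A, B) \<in> gpd_connected G H"
    unfolding gpd_connected_def by (metis (mono_tags, lifting) gpd_source.simps mem_Collect_eq)
qed

text \<open>Units, inverses and products of arrows give reflexivity, symmetry and transitivity; the
  witnesses are \<one>, \<open>inv g\<close> and \<open>h \<otimes> g\<close>.\<close>

lemma equiv_gpd_connected:
  assumes H: "subgroup H G"
  shows "equiv (coset_unions G H) (gpd_connected G H)"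
proof (rule equivI)
  show "gpd_connected G H \<subseteq> coset_unions G H \<times> coset_unions G H"
    using l_coset_in_coset_unions[OF H] by (auto simp: gpd_connected_iff)
  show "refl_on (coset_unions G H) (gpd_connected G H)"
  proof (rule refl_onI)
    fix A assume A: "A \<in> coset_unions G H"
    then show "(A, A) \<in> gpd_connected G H"
      using coset_unionsD[OF H A] lcos_mult_one[of A]
      by (auto simp: gpd_connected_iff intro!: bexI[of _ \<one>])
  qed
  show "sym (gpd_connected G H)"
  proof (rule symI)
    fix A B assume "(A, B) \<in> gpd_connected G H"
    then obtain g where g: "A \<in> coset_unions G H" "g \<in> carrier G" "inv g \<in> A" "B = g <# A"
      by (auto simp: gpd_connected_iff)
    note AD = coset_unionsD[OF H g(1)]
    \<comment> \<open>Since \<one> lies in A, g lies in g A = B, which is the arrow condition for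
      \<open>inv g\<close> at B.\<close>
    have "g \<in> B" using g AD by (simp add: mem_l_coset_iff)
    then show "(B, A) \<in> gpd_connected G H"
      using g AD l_coset_in_coset_unions[OF H g(1,2,3)] l_coset_inv_cancel[OF AD(2) g(2)]
      by (auto simp: gpd_connected_iff intro!: bexI[of _ "inv g"])
  qed
  show "trans (gpd_connected G H)"
  proof (rule transI)
    fix A B C assume "(A, B) \<in> gpd_connected G H" "(B, C) \<in> gpd_connected G H"
    then obtain g h where g: "A \<in> coset_unions G H" "g \<in> carrier G" "inv g \<in> A" "B = g <# A"
      and h: "h \<in> carrier G" "inv h \<in> B" "C = h <# B"
      by (auto simp: gpd_connected_iff)
    note AD = coset_unionsD[OF H g(1)]
    have "inv (h \<otimes> g) \<in> A"
      using h g AD by (simp add: mem_l_coset_iff inv_mult_group)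
    then show "(A, C) \<in> gpd_connected G H"
      using g h AD by (auto simp: gpd_connected_iff lcos_m_assoc intro!: bexI[of _ "h \<otimes> g"])
  qed
qed

section \<open>The chosen objects as representatives of the connected components\<close>

context
  fixes H :: "'a set" and c :: "nat \<Rightarrow> nat" and \<Gamma> :: "nat \<Rightarrow> nat \<Rightarrow> ('a set \<times> 'a) set"
    and A :: "nat \<Rightarrow> nat \<Rightarrow> 'a set"
  assumes H: "subgroup H G"
    and decomposition: "bij_betw (\<lambda>(i, j). \<Gamma> i j) (component_indices G H c) (gpd_components G H)"
    and objects: "\<And>i j. (i, j) \<in> component_indices G H c \<Longrightarrow> A i j \<in> gpd_source ` \<Gamma> i j"
begin

text \<open>Some arrow of \<Gamma> i j starts at A i j, so the class of objects defining the
  component is that of A i j. Expressing \<Gamma> i j through this class alone lets connected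
  objects be compared by injectivity of the indexing.\<close>

lemma component_eq:
  assumes ij: "(i, j) \<in> component_indices G H c"
  shows "A i j \<in> coset_unions G H"
    "\<Gamma> i j = {\<gamma> \<in> coset_groupoid G H. gpd_source \<gamma> \<in> gpd_connected G H `` {A i j} \<and>
      gpd_range G \<gamma> \<in> gpd_connected G H `` {A i j}}"
proof -
  have "\<Gamma> i j \<in> gpd_components G H"
    using bij_betw_imp_surj_on[OF decomposition] ij by force
  then obtain C where C: "C \<in> coset_unions G H // gpd_connected G H"
    "\<Gamma> i j = {\<gamma> \<in> coset_groupoid G H. gpd_source \<gamma> \<in> C \<and> gpd_range G \<gamma> \<in> C}"
    by (auto simp: gpd_components_def)
  have AC: "A i j \<in> C" using objects[OF ij] C(2) by auto
  obtain B where B: "B \<in> coset_unions G H" "C = gpd_connected G H `` {B}"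
    using C(1) by (rule quotientE)
  have "(B, A i j) \<in> gpd_connected G H" using AC B(2) by simp
  then have "A i j \<in> coset_unions G H \<and> C = gpd_connected G H `` {A i j}"
    using B(2) equiv_class_eq_iff[OF equiv_gpd_connected[OF H]] by simp
  then show "A i j \<in> coset_unions G H" and "\<Gamma> i j = {\<gamma> \<in> coset_groupoid G H.
      gpd_source \<gamma> \<in> gpd_connected G H `` {A i j} \<and> gpd_range G \<gamma> \<in> gpd_connected G H `` {A i j}}"
    using C(2) by simp_all
qed

lemma component_unique:
  assumes ij: "(i, j) \<in> component_indices G H c" and ij': "(i', j') \<in> component_indices G H c"
    and conn: "(A i j, A i' j') \<in> gpd_connected G H"
  shows "(i, j) = (i', j')"
proof -
  have "gpd_connected G H `` {A i j} = gpd_connected G H `` {A i' j'}"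
    using conn equiv_gpd_connected[OF H] by (simp add: equiv_class_eq_iff)
  then have "\<Gamma> i j = \<Gamma> i' j'" using component_eq(2)[OF ij] component_eq(2)[OF ij'] by simp
  then show ?thesis
    using inj_onD[OF bij_betw_imp_inj_on[OF decomposition] _ ij ij'] by simp
qed

text \<open>The component built from the class of B is some \<Gamma> i j by surjectivity of the
  indexing, and its chosen object belongs to the class of B.\<close>

lemma component_exists:
  assumes B: "B \<in> coset_unions G H"
  shows "\<exists>(i, j)\<in>component_indices G H c. (B, A i j) \<in> gpd_connected G H"
proof -
  define C where "C = gpd_connected G H `` {B}"
  define \<Delta> where "\<Delta> = {\<gamma> \<in> coset_groupoid G H. gpd_source \<gamma> \<in> C \<and> gpd_range G \<gamma> \<in> C}"
  have "\<Delta> \<in> gpd_components G H"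
    using quotientI[OF B] unfolding gpd_components_def \<Delta>_def C_def by blast
  then have "\<Delta> \<in> (\<lambda>(i, j). \<Gamma> i j) ` component_indices G H c"
    using bij_betw_imp_surj_on[OF decomposition] by simp
  then obtain ij where "ij \<in> component_indices G H c" "\<Delta> = (\<lambda>(i, j). \<Gamma> i j) ij"
    by (rule imageE)
  then obtain i j where ij: "(i, j) \<in> component_indices G H c" "\<Gamma> i j = \<Delta>"
    by (cases ij) simp
  then have "A i j \<in> C" using objects[OF ij(1)] by (auto simp: \<Delta>_def)
  then show ?thesis using ij(1) by (auto simp: C_def)
qed

end

end

section \<open>The idempotents of a partial representation\<close>

text \<open>For a module over the groupoid algebra this is the sum of the pieces (B,1)V over the
  objects B containing A, because the product of \<open>mu_p\<close> at g and at g^-1 is the sum of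
  all (B,1) with g in B.\<close>

definition fix_space ::
  "('g, 'b) monoid_scheme \<Rightarrow> (complex, 'v) module \<Rightarrow> ('g \<Rightarrow> 'v \<Rightarrow> 'v) \<Rightarrow> 'g set \<Rightarrow> 'v set" where
  "fix_space G V \<pi> A = {v \<in> carrier V. \<forall>g\<in>A. \<pi> g (\<pi> (inv\<^bsub>G\<^esub> g) v) = v}"

locale partial_representation = Group.group G
  for G :: "('g, 'b) monoid_scheme" (structure) +
  fixes V :: "(complex, 'v) module" and \<pi> :: "'g \<Rightarrow> 'v \<Rightarrow> 'v"
  assumes partial_rep: "partial_rep G V \<pi>"
begin

lemma fd_vector_space: "fd_vector_space V" and vectorspace: "vectorspace complex_field V"
  using partial_rep by (auto simp: partial_rep_def fd_vector_space_def)

lemma hom: "g \<in> carrier G \<Longrightarrow> \<pi> g \<in> LinearCombinations.module_hom complex_field V V"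
  using partial_rep by (simp add: partial_rep_def)

lemma closed: "g \<in> carrier G \<Longrightarrow> v \<in> carrier V \<Longrightarrow> \<pi> g v \<in> carrier V"
  by (rule module_homD(1)[OF hom])

lemma hom_zero: "g \<in> carrier G \<Longrightarrow> \<pi> g \<zero>\<^bsub>V\<^esub> = \<zero>\<^bsub>V\<^esub>"
  by (rule module_hom_zero[OF vectorspace vectorspace hom])

lemma one: "v \<in> carrier V \<Longrightarrow> \<pi> \<one> v = v"
  using partial_rep by (simp add: partial_rep_def)

lemma left: "g \<in> carrier G \<Longrightarrow> h \<in> carrier G \<Longrightarrow> v \<in> carrier V \<Longrightarrow>
    \<pi> (inv g) (\<pi> (g \<otimes> h) v) = \<pi> (inv g) (\<pi> g (\<pi> h v))"
  using partial_rep by (simp add: partial_rep_def)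

lemma right: "g \<in> carrier G \<Longrightarrow> h \<in> carrier G \<Longrightarrow> v \<in> carrier V \<Longrightarrow>
    \<pi> (g \<otimes> h) (\<pi> (inv h) v) = \<pi> g (\<pi> h (\<pi> (inv h) v))"
  using partial_rep by (simp add: partial_rep_def)

definition eps :: "'g \<Rightarrow> 'v \<Rightarrow> 'v" where
  "eps g v = \<pi> g (\<pi> (inv g) v)"

lemma eps_closed: "g \<in> carrier G \<Longrightarrow> v \<in> carrier V \<Longrightarrow> eps g v \<in> carrier V"
  by (simp add: eps_def closed)

lemma eps_hom: "g \<in> carrier G \<Longrightarrow> eps g \<in> LinearCombinations.module_hom complex_field V V"
  unfolding eps_def by (rule module_hom_comp[OF hom hom]) auto

text \<open>The second multiplicativity axiom at the pair g, \<open>inv g\<close>, whose product is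
  \<one>. So the range of \<pi> g lies in the range of \<open>eps g\<close>.\<close>

lemma eps_absorb: "g \<in> carrier G \<Longrightarrow> v \<in> carrier V \<Longrightarrow> eps g (\<pi> g v) = \<pi> g v"
  using right[of g "inv g" v] by (simp add: eps_def one closed)

lemma eps_idem: "g \<in> carrier G \<Longrightarrow> v \<in> carrier V \<Longrightarrow> eps g (eps g v) = eps g v"
  using eps_absorb[of g "\<pi> (inv g) v"] closed by (simp add: eps_def)

text \<open>The first axiom composed with \<pi> g, after which \<open>eps_absorb\<close> removes the
  idempotent on the right-hand side. It measures the failure of multiplicativity: the composite of
  \<pi> g and \<pi> h is \<pi> (g h) cut down by \<open>eps g\<close>.\<close>

lemma eps_mult:
  "g \<in> carrier G \<Longrightarrow> h \<in> carrier G \<Longrightarrow> v \<in> carrier V \<Longrightarrow> eps g (\<pi> (g \<otimes> h) v) = \<pi> g (\<pi> h v)"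
  using left[of g h v] eps_absorb[of g "\<pi> h v"] by (simp add: eps_def closed)

text \<open>The second axiom merges \<pi> g and \<pi> h in front of \<pi> (h^-1),
  \<open>eps_absorb\<close> inserts \<open>eps (g \<otimes> h)\<close>, and the first axiom merges
  the rest into \<pi> at g h h^-1 = g. This covariance is behind both the commutation of the
  idempotents and the motion of fixed spaces.\<close>

lemma hom_eps:
  assumes g: "g \<in> carrier G" and h: "h \<in> carrier G" and v: "v \<in> carrier V"
  shows "\<pi> g (eps h v) = eps (g \<otimes> h) (\<pi> g v)"
proof -
  have "\<pi> g (eps h v) = \<pi> (g \<otimes> h) (\<pi> (inv h) v)"
    using right g h v by (simp add: eps_def)
  also have "\<dots> = eps (g \<otimes> h) (\<pi> (g \<otimes> h) (\<pi> (inv h) v))"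
    using g h v by (simp add: eps_absorb closed)
  also have "\<dots> = eps (g \<otimes> h) (\<pi> (g \<otimes> h \<otimes> inv h) v)"
    using left[of "g \<otimes> h" "inv h" v] g h v by (simp add: eps_def)
  also have "g \<otimes> h \<otimes> inv h = g" using g h by (simp add: m_assoc)
  finally show ?thesis .
qed

text \<open>Pass \<open>eps h\<close> through the two factors of \<open>eps g\<close> in turn: its
  index becomes g^-1 h and then g g^-1 h = h.\<close>

lemma eps_commute:
  assumes g: "g \<in> carrier G" and h: "h \<in> carrier G" and v: "v \<in> carrier V"
  shows "eps g (eps h v) = eps h (eps g v)"
proof -
  have "eps g (eps h v) = eps (g \<otimes> (inv g \<otimes> h)) (\<pi> g (\<pi> (inv g) v))"
    unfolding eps_def[of g] using g h v by (simp add: hom_eps closed)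
  then show ?thesis using g h by (simp add: eps_def[of g] flip: m_assoc)
qed

text \<open>A list fixes an order of composition. Commutation and idempotence make the result depend
  only on the set of members (\<open>proj_cong\<close>), and it projects onto the fixed space of
  that set.\<close>

definition proj :: "'g list \<Rightarrow> 'v \<Rightarrow> 'v" where
  "proj gs v = foldr eps gs v"

lemma proj_simps [simp]: "proj [] v = v" "proj (g # gs) v = eps g (proj gs v)"
  by (simp_all add: proj_def)

lemma proj_hom:
  "set gs \<subseteq> carrier G \<Longrightarrow> proj gs \<in> LinearCombinations.module_hom complex_field V V"
proof (induction gs)
  case Nil
  show ?case by (intro module_homI) auto
next
  case (Cons g gs)
  then have "(\<lambda>v. eps g (proj gs v)) \<in> LinearCombinations.module_hom complex_field V V"
    by (intro module_hom_comp[of "proj gs" V V "eps g"] eps_hom) auto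
  then show ?case by (simp add: proj_def comp_def)
qed

lemma proj_closed: "set gs \<subseteq> carrier G \<Longrightarrow> v \<in> carrier V \<Longrightarrow> proj gs v \<in> carrier V"
  using module_homD(1)[OF proj_hom] .

lemma proj_eps:
  "set gs \<subseteq> carrier G \<Longrightarrow> h \<in> carrier G \<Longrightarrow> v \<in> carrier V \<Longrightarrow> proj gs (eps h v) = eps h (proj gs v)"
  by (induction gs) (auto simp: proj_closed intro: eps_commute)

lemma eps_proj:
  "set gs \<subseteq> carrier G \<Longrightarrow> h \<in> set gs \<Longrightarrow> v \<in> carrier V \<Longrightarrow> eps h (proj gs v) = proj gs v"
proof (induction gs)
  case (Cons g gs)
  then show ?case
    using eps_commute[of h g "proj gs v"] by (auto simp: proj_closed eps_idem)
qed simp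

lemma proj_ident: "(\<And>h. h \<in> set gs \<Longrightarrow> eps h v = v) \<Longrightarrow> proj gs v = v"
  by (induction gs) auto

lemma proj_commute:
  "set gs \<subseteq> carrier G \<Longrightarrow> set hs \<subseteq> carrier G \<Longrightarrow> v \<in> carrier V \<Longrightarrow>
    proj gs (proj hs v) = proj hs (proj gs v)"
  by (induction gs) (auto simp: proj_closed proj_eps)

text \<open>Each product fixes the range of the other, since the two lists have the same members; as
  they commute, both equal their composite.\<close>

lemma proj_cong:
  assumes "set gs \<subseteq> carrier G" "set gs = set hs" "v \<in> carrier V"
  shows "proj gs v = proj hs v"
proof -
  have "proj gs v = proj hs (proj gs v)"
    using assms by (intro proj_ident[symmetric] eps_proj) auto
  also have "\<dots> = proj gs (proj hs v)" using assms by (simp add: proj_commute)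
  also have "\<dots> = proj hs v" using assms by (intro proj_ident eps_proj) auto
  finally show ?thesis .
qed

lemma hom_proj:
  "g \<in> carrier G \<Longrightarrow> set gs \<subseteq> carrier G \<Longrightarrow> v \<in> carrier V \<Longrightarrow>
    \<pi> g (proj gs v) = proj (map ((\<otimes>) g) gs) (\<pi> g v)"
  by (induction gs) (auto simp: proj_closed hom_eps)

lemma fix_space_eps: "fix_space G V \<pi> A = {v \<in> carrier V. \<forall>g\<in>A. eps g v = v}"
  by (simp add: fix_space_def eps_def)

lemma proj_fix_space: "set gs \<subseteq> carrier G \<Longrightarrow> v \<in> carrier V \<Longrightarrow> proj gs v \<in> fix_space G V \<pi> (set gs)"
  by (simp add: fix_space_eps proj_closed eps_proj)

lemma proj_fix_space_ident: "v \<in> fix_space G V \<pi> (set gs) \<Longrightarrow> proj gs v = v"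
  by (simp add: fix_space_eps proj_ident)

lemma subspace_fix_space:
  assumes A: "A \<subseteq> carrier G"
  shows "VectorSpace.subspace complex_field (fix_space G V \<pi> A) V"
proof -
  interpret V: vectorspace complex_field V by (rule vectorspace)
  show ?thesis
  proof (rule subspaceI[OF vectorspace])
    show "\<zero>\<^bsub>V\<^esub> \<in> fix_space G V \<pi> A"
      using A module_hom_zero[OF vectorspace vectorspace eps_hom] by (auto simp: fix_space_eps)
    show "u \<oplus>\<^bsub>V\<^esub> v \<in> fix_space G V \<pi> A"
      if "u \<in> fix_space G V \<pi> A" "v \<in> fix_space G V \<pi> A" for u v
      using that A module_homD(2)[OF eps_hom] by (auto simp: fix_space_eps subset_iff)
    show "c \<odot>\<^bsub>V\<^esub> u \<in> fix_space G V \<pi> A" if "u \<in> fix_space G V \<pi> A" for c u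
      using that A module_homD(3)[OF eps_hom] by (auto simp: fix_space_eps subset_iff)
  qed (auto simp: fix_space_def)
qed

text \<open>Covariance turns \<open>eps a\<close> into \<open>eps (g \<otimes> a)\<close>. In
  particular the stabilizer of A preserves the fixed space of A, and fixed vectors can be carried
  along an arrow to a connected object.\<close>

lemma hom_fix_space:
  assumes A: "A \<subseteq> carrier G" and v: "v \<in> fix_space G V \<pi> A" and g: "g \<in> carrier G"
  shows "\<pi> g v \<in> fix_space G V \<pi> (g <# A)"
proof -
  have "eps (g \<otimes> a) (\<pi> g v) = \<pi> g v" if "a \<in> A" for a
    using hom_eps[of g a v] that A v g by (auto simp: fix_space_eps)
  then show ?thesis using A v g by (auto simp: fix_space_eps l_coset_def closed)
qed

lemma stable_proj:
  assumes "\<And>g u. g \<in> carrier G \<Longrightarrow> u \<in> U \<Longrightarrow> \<pi> g u \<in> U" "set gs \<subseteq> carrier G" "u \<in> U"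
  shows "proj gs u \<in> U"
  using assms(2) by (induction gs) (auto simp: eps_def assms)

end

locale global_partial_representation = partial_representation G V \<pi>
  for G :: "('g, 'b) monoid_scheme" (structure) and V :: "(complex, 'v) module" and \<pi> +
  fixes H
  assumes subgroup: "subgroup H G"
    and global: "global_partial_rep G H V \<pi>"
begin

lemma H_closed: "h \<in> H \<Longrightarrow> h \<in> carrier G"
  using subgroup.subset[OF subgroup] by blast

lemma global_mult: "h \<in> H \<Longrightarrow> k \<in> H \<Longrightarrow> v \<in> carrier V \<Longrightarrow> \<pi> (h \<otimes> k) v = \<pi> h (\<pi> k v)"
  using global by (simp add: global_partial_rep_def group_rep_def)

lemma eps_H: "h \<in> H \<Longrightarrow> v \<in> carrier V \<Longrightarrow> eps h v = v"
  using global_mult[of h "inv h" v] subgroup.m_inv_closed[OF subgroup]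
  by (simp add: eps_def one H_closed)

text \<open>Globality on H makes the idempotents constant on left cosets of H, which is why unions
  of such cosets are the right index sets.\<close>

lemma eps_mult_H:
  assumes g: "g \<in> carrier G" and h: "h \<in> H" and v: "v \<in> carrier V"
  shows "eps (g \<otimes> h) v = eps g v"
proof -
  note hG = H_closed[OF h] and hi = subgroup.m_inv_closed[OF subgroup h]
  \<comment> \<open>Globality writes u as \<pi> (inv h) applied to \<pi> h u, which supplies the
    trailing factor that the second axiom requires.\<close>
  have 1: "\<pi> (g \<otimes> h) u = \<pi> g (\<pi> h u)" if "u \<in> carrier V" for u
    using right[of g h "\<pi> h u"] eps_H[OF hi that] that g hG by (simp add: eps_def closed)
  have "\<pi> h (\<pi> (inv h \<otimes> inv g) v) = \<pi> (inv g) v"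
    using left[of "inv h" "inv g" v] eps_H[OF h, of "\<pi> (inv g) v"] g hG v
    by (simp add: eps_def closed)
  then show ?thesis using g hG v by (simp add: eps_def 1 inv_mult_group closed)
qed

end

section \<open>The function model of an induced representation\<close>

text \<open>This is A^-1; its elements x index the arrows (A,x) leaving A, hence the basis of the
  left ideal at A.\<close>

definition arrow_set :: "('g, 'b) monoid_scheme \<Rightarrow> 'g set \<Rightarrow> 'g set" where
  "arrow_set G A = {x \<in> carrier G. inv\<^bsub>G\<^esub> x \<in> A}"

text \<open>The element \<open>\<Sum>\<^sub>x (A, x) \<otimes> w\<^sub>x\<close> of the induced representation, with \<open>x\<close> running over
  representatives of \<open>A\<^sup>-\<^sup>1 / K\<^sub>A\<close>, is modelled by the equivariant function \<open>x \<mapsto> w\<^sub>x\<close>; this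
  avoids a choice of representatives.\<close>

definition coind_space ::
  "('g, 'b) monoid_scheme \<Rightarrow> 'g set \<Rightarrow> (complex, 'w) module \<Rightarrow> ('g \<Rightarrow> 'w \<Rightarrow> 'w) \<Rightarrow>
     (complex, 'g \<Rightarrow> 'w) module" where
  "coind_space G A W \<rho> =
     \<lparr> carrier = {f. (\<forall>x. f x \<in> carrier W) \<and> (\<forall>x. x \<notin> arrow_set G A \<longrightarrow> f x = \<zero>\<^bsub>W\<^esub>) \<and>
         (\<forall>x\<in>arrow_set G A. \<forall>k\<in>stabilizer_set G A. f (x \<otimes>\<^bsub>G\<^esub> k) = \<rho> (inv\<^bsub>G\<^esub> k) (f x))},
       mult = (\<lambda>f f'. f), one = (\<lambda>x. \<zero>\<^bsub>W\<^esub>), zero = (\<lambda>x. \<zero>\<^bsub>W\<^esub>),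
       add = (\<lambda>f f' x. f x \<oplus>\<^bsub>W\<^esub> f' x), smult = (\<lambda>c f x. c \<odot>\<^bsub>W\<^esub> f x) \<rparr>"

text \<open>Translation moves the value at z to g z, so the new value at x is read off at g^-1 x; it
  is zero as soon as one of the two points leaves A^-1.\<close>

definition coind_action ::
  "('g, 'b) monoid_scheme \<Rightarrow> 'g set \<Rightarrow> (complex, 'w) module \<Rightarrow> 'g \<Rightarrow> ('g \<Rightarrow> 'w) \<Rightarrow> 'g \<Rightarrow> 'w" where
  "coind_action G A W g f x =
     (if x \<in> arrow_set G A \<and> inv\<^bsub>G\<^esub> g \<otimes>\<^bsub>G\<^esub> x \<in> arrow_set G A then f (inv\<^bsub>G\<^esub> g \<otimes>\<^bsub>G\<^esub> x) else \<zero>\<^bsub>W\<^esub>)"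

text \<open>The function that represents (A,x) tensor w: it is supported on the coset x K_A with
  value w at x. Equivariance then forces the value of \<rho> (k^-1) at w for y = x k, and k^-1 is
  y^-1 x.\<close>

definition delta ::
  "('g, 'b) monoid_scheme \<Rightarrow> 'g set \<Rightarrow> (complex, 'w) module \<Rightarrow> ('g \<Rightarrow> 'w \<Rightarrow> 'w) \<Rightarrow>
     'g \<Rightarrow> 'w \<Rightarrow> 'g \<Rightarrow> 'w" where
  "delta G A W \<rho> x w y =
     (if y \<in> carrier G \<and> inv\<^bsub>G\<^esub> x \<otimes>\<^bsub>G\<^esub> y \<in> stabilizer_set G A then \<rho> (inv\<^bsub>G\<^esub> y \<otimes>\<^bsub>G\<^esub> x) w else \<zero>\<^bsub>W\<^esub>)"

locale stabilizer_rep = Group.group G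
  for G :: "('g, 'b) monoid_scheme" (structure) +
  fixes H A :: "'g set" and W :: "(complex, 'w) module" and \<rho> :: "'g \<Rightarrow> 'w \<Rightarrow> 'w"
  assumes finite_carrier: "finite (carrier G)"
    and subgroup: "subgroup H G"
    and object: "A \<in> coset_unions G H"
    and rep: "group_rep (stabilizer_group G A) W \<rho>"
begin

abbreviation K :: "'g set" where "K \<equiv> stabilizer_set G A"
abbreviation D :: "'g set" where "D \<equiv> arrow_set G A"
abbreviation M :: "(complex, 'g \<Rightarrow> 'w) module" where "M \<equiv> coind_space G A W \<rho>"
abbreviation \<tau> :: "'g \<Rightarrow> ('g \<Rightarrow> 'w) \<Rightarrow> 'g \<Rightarrow> 'w" where "\<tau> \<equiv> coind_action G A W"
abbreviation \<delta> :: "'g \<Rightarrow> 'w \<Rightarrow> 'g \<Rightarrow> 'w" where "\<delta> \<equiv> delta G A W \<rho>"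

lemmas A_subset = coset_unionsD(2)[OF subgroup object]
  and one_A = coset_unionsD(3)[OF subgroup object]

section \<open>The stabilizer of A and the arrows leaving A\<close>

lemma K_iff: "k \<in> K \<longleftrightarrow> k \<in> carrier G \<and> k <# A = A"
  by (simp add: stabilizer_set_def)

lemma subgroup_K: "subgroup K G"
proof (rule subgroupI)
  show "K \<subseteq> carrier G" by (auto simp: K_iff)
  have "\<one> \<in> K" using lcos_mult_one[OF A_subset] by (simp add: K_iff)
  then show "K \<noteq> {}" by auto
next
  fix k assume k: "k \<in> K"
  then have "inv k <# A = inv k <# (k <# A)" by (simp add: K_iff)
  also have "\<dots> = A" using k A_subset by (intro l_coset_inv_cancel) (auto simp: K_iff)
  finally show "inv k \<in> K" using k by (simp add: K_iff)
next
  fix k l assume k: "k \<in> K" and l: "l \<in> K"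
  then have "k \<otimes> l <# A = k <# (l <# A)" using A_subset lcos_m_assoc[OF A_subset, of k l] by (simp add: K_iff)
  then show "k \<otimes> l \<in> K" using k l by (simp add: K_iff)
qed

lemmas K_closed = subgroup.mem_carrier[OF subgroup_K]
  and K_mult = subgroup.m_closed[OF subgroup_K]
  and K_inv = subgroup.m_inv_closed[OF subgroup_K]
  and K_one = subgroup.one_closed[OF subgroup_K]

lemma K_mult_A: "k \<in> K \<Longrightarrow> a \<in> A \<Longrightarrow> k \<otimes> a \<in> A"
  by (auto simp: K_iff l_coset_def)

lemma K_subset_A: "k \<in> K \<Longrightarrow> k \<in> A"
  using K_mult_A[OF _ one_A] K_closed by simp

text \<open>The hypothesis says that A is contained in its translate y A; both are finite of the
  same size, so they coincide.\<close>

lemma K_I: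
  assumes "y \<in> carrier G" "\<And>a. a \<in> A \<Longrightarrow> inv y \<otimes> a \<in> A"
  shows "y \<in> K"
proof -
  have "A \<subseteq> y <# A" using assms A_subset by (auto simp: mem_l_coset_iff[OF A_subset])
  moreover have "finite (y <# A)" "card (y <# A) = card A"
  proof -
    have "y <# A = (\<otimes>) y ` A" by (auto simp: l_coset_def)
    moreover have "inj_on ((\<otimes>) y) A" using A_subset assms(1) by (auto simp: inj_on_def subset_iff)
    moreover have "finite A" using A_subset finite_carrier finite_subset by blast
    ultimately show "finite (y <# A)" "card (y <# A) = card A" by (simp_all add: card_image)
  qed
  ultimately have "A = y <# A" by (intro card_subset_eq) auto
  then show ?thesis using assms(1) by (simp add: K_iff)
qed

lemma D_iff: "x \<in> D \<longleftrightarrow> x \<in> carrier G \<and> inv x \<in> A"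
  by (simp add: arrow_set_def)

lemma D_closed: "x \<in> D \<Longrightarrow> x \<in> carrier G"
  by (simp add: D_iff)

lemma D_mult_K: "x \<in> D \<Longrightarrow> k \<in> K \<Longrightarrow> x \<otimes> k \<in> D"
  using K_mult_A[OF K_inv] K_closed by (auto simp: D_iff inv_mult_group)

lemma K_subset_D: "k \<in> K \<Longrightarrow> k \<in> D"
  using K_subset_A[OF K_inv] K_closed by (auto simp: D_iff)

lemma one_D: "\<one> \<in> D"
  using one_A by (simp add: D_iff)

text \<open>A absorbs H on the right, so A^-1 absorbs it on the left: translation by H never meets
  the truncation, which makes the model H-global.\<close>

lemma H_mult_D: "h \<in> H \<Longrightarrow> x \<in> D \<Longrightarrow> h \<otimes> x \<in> D"
  using coset_unionsD(4)[OF subgroup object] subgroup.mem_carrier[OF subgroup]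
    subgroup.m_inv_closed[OF subgroup]
  by (simp add: D_iff inv_mult_group)

lemma finite_D: "finite D"
  by (rule finite_subset[OF _ finite_carrier]) (auto simp: D_iff)

text \<open>The relation that y lies in x K, unpacked once in the forms used below: it is symmetric,
  and A^-1 is a union of its classes.\<close>

lemma mem_coset_K:
  assumes "x \<in> carrier G" "y \<in> carrier G" "inv x \<otimes> y \<in> K"
  shows "y = x \<otimes> (inv x \<otimes> y)" "inv y \<otimes> x = inv (inv x \<otimes> y)" "inv y \<otimes> x \<in> K"
    "x \<in> D \<Longrightarrow> y \<in> D" "y \<in> D \<Longrightarrow> x \<in> D"
proof -
  show y: "y = x \<otimes> (inv x \<otimes> y)" using assms by (simp flip: m_assoc)
  show inv: "inv y \<otimes> x = inv (inv x \<otimes> y)" using assms by (simp add: inv_mult_group)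
  then show K: "inv y \<otimes> x \<in> K" using K_inv[OF assms(3)] by simp
  show "y \<in> D" if "x \<in> D" using D_mult_K[OF that assms(3)] y by simp
  have "x = y \<otimes> (inv y \<otimes> x)" using assms by (simp flip: m_assoc)
  then show "x \<in> D" if "y \<in> D" using D_mult_K[OF that K] by simp
qed

section \<open>Vector space operations and the stabilizer action on W\<close>

lemma vectorspace_W: "vectorspace complex_field W"
  using rep by (simp add: group_rep_def fd_vector_space_def)

text \<open>The axioms with plain complex scalars instead of the operations of
  \<open>complex_field\<close>, so that they can rewrite pointwise in functions with values in
  W.\<close>

lemma W_zero: "\<zero>\<^bsub>W\<^esub> \<in> carrier W"
  and W_add: "u \<in> carrier W \<Longrightarrow> v \<in> carrier W \<Longrightarrow> u \<oplus>\<^bsub>W\<^esub> v \<in> carrier W"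
  and W_smult: "u \<in> carrier W \<Longrightarrow> c \<odot>\<^bsub>W\<^esub> u \<in> carrier W"
  and W_assoc: "u \<in> carrier W \<Longrightarrow> v \<in> carrier W \<Longrightarrow> w \<in> carrier W \<Longrightarrow>
    u \<oplus>\<^bsub>W\<^esub> v \<oplus>\<^bsub>W\<^esub> w = u \<oplus>\<^bsub>W\<^esub> (v \<oplus>\<^bsub>W\<^esub> w)"
  and W_commute: "u \<in> carrier W \<Longrightarrow> v \<in> carrier W \<Longrightarrow> u \<oplus>\<^bsub>W\<^esub> v = v \<oplus>\<^bsub>W\<^esub> u"
  and W_add_zero: "u \<in> carrier W \<Longrightarrow> u \<oplus>\<^bsub>W\<^esub> \<zero>\<^bsub>W\<^esub> = u" "u \<in> carrier W \<Longrightarrow> \<zero>\<^bsub>W\<^esub> \<oplus>\<^bsub>W\<^esub> u = u"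
  and W_smult_zero: "c \<odot>\<^bsub>W\<^esub> \<zero>\<^bsub>W\<^esub> = \<zero>\<^bsub>W\<^esub>" "u \<in> carrier W \<Longrightarrow> 0 \<odot>\<^bsub>W\<^esub> u = \<zero>\<^bsub>W\<^esub>"
  and W_smult_one: "u \<in> carrier W \<Longrightarrow> 1 \<odot>\<^bsub>W\<^esub> u = u"
  and W_smult_assoc: "u \<in> carrier W \<Longrightarrow> (c * d) \<odot>\<^bsub>W\<^esub> u = c \<odot>\<^bsub>W\<^esub> (d \<odot>\<^bsub>W\<^esub> u)"
  and W_smult_add: "u \<in> carrier W \<Longrightarrow> (c + d) \<odot>\<^bsub>W\<^esub> u = c \<odot>\<^bsub>W\<^esub> u \<oplus>\<^bsub>W\<^esub> d \<odot>\<^bsub>W\<^esub> u"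
  and W_smult_distrib: "u \<in> carrier W \<Longrightarrow> v \<in> carrier W \<Longrightarrow>
    c \<odot>\<^bsub>W\<^esub> (u \<oplus>\<^bsub>W\<^esub> v) = c \<odot>\<^bsub>W\<^esub> u \<oplus>\<^bsub>W\<^esub> c \<odot>\<^bsub>W\<^esub> v"
proof -
  interpret W: vectorspace complex_field W by (rule vectorspace_W)
  show "\<zero>\<^bsub>W\<^esub> \<in> carrier W" by (rule W.M.zero_closed)
  show "u \<in> carrier W \<Longrightarrow> v \<in> carrier W \<Longrightarrow> u \<oplus>\<^bsub>W\<^esub> v \<in> carrier W" by (rule W.M.add.m_closed)
  show "u \<in> carrier W \<Longrightarrow> c \<odot>\<^bsub>W\<^esub> u \<in> carrier W" by (simp add: W.smult_closed)
  show "u \<in> carrier W \<Longrightarrow> v \<in> carrier W \<Longrightarrow> w \<in> carrier W \<Longrightarrow>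
    u \<oplus>\<^bsub>W\<^esub> v \<oplus>\<^bsub>W\<^esub> w = u \<oplus>\<^bsub>W\<^esub> (v \<oplus>\<^bsub>W\<^esub> w)" by (rule W.M.a_assoc)
  show "u \<in> carrier W \<Longrightarrow> v \<in> carrier W \<Longrightarrow> u \<oplus>\<^bsub>W\<^esub> v = v \<oplus>\<^bsub>W\<^esub> u" by (rule W.M.a_comm)
  show "u \<in> carrier W \<Longrightarrow> u \<oplus>\<^bsub>W\<^esub> \<zero>\<^bsub>W\<^esub> = u" by (rule W.M.r_zero)
  show "u \<in> carrier W \<Longrightarrow> \<zero>\<^bsub>W\<^esub> \<oplus>\<^bsub>W\<^esub> u = u" by (rule W.M.l_zero)
  show "c \<odot>\<^bsub>W\<^esub> \<zero>\<^bsub>W\<^esub> = \<zero>\<^bsub>W\<^esub>" using W.smult_r_null[of c] by simp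
  show "u \<in> carrier W \<Longrightarrow> 0 \<odot>\<^bsub>W\<^esub> u = \<zero>\<^bsub>W\<^esub>" using W.smult_l_null[of u] by simp
  show "u \<in> carrier W \<Longrightarrow> 1 \<odot>\<^bsub>W\<^esub> u = u" using W.smult_one[of u] by simp
  show "u \<in> carrier W \<Longrightarrow> (c * d) \<odot>\<^bsub>W\<^esub> u = c \<odot>\<^bsub>W\<^esub> (d \<odot>\<^bsub>W\<^esub> u)"
    using W.smult_assoc1[of c d u] by simp
  show "u \<in> carrier W \<Longrightarrow> (c + d) \<odot>\<^bsub>W\<^esub> u = c \<odot>\<^bsub>W\<^esub> u \<oplus>\<^bsub>W\<^esub> d \<odot>\<^bsub>W\<^esub> u"
    using W.smult_l_distr[of c d u] by simp
  show "u \<in> carrier W \<Longrightarrow> v \<in> carrier W \<Longrightarrow> c \<odot>\<^bsub>W\<^esub> (u \<oplus>\<^bsub>W\<^esub> v) = c \<odot>\<^bsub>W\<^esub> u \<oplus>\<^bsub>W\<^esub> c \<odot>\<^bsub>W\<^esub> v"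
    using W.smult_r_distr[of c u v] by simp
qed

lemma W_neg: "u \<in> carrier W \<Longrightarrow> u \<oplus>\<^bsub>W\<^esub> (-1) \<odot>\<^bsub>W\<^esub> u = \<zero>\<^bsub>W\<^esub>"
  using W_smult_add[of u 1 "-1"] by (simp add: W_smult_one W_smult_zero)

lemma \<rho>_hom: "k \<in> K \<Longrightarrow> \<rho> k \<in> LinearCombinations.module_hom complex_field W W"
  using rep by (simp add: group_rep_def stabilizer_group_def)

lemmas \<rho>_closed = module_homD(1)[OF \<rho>_hom]
  and \<rho>_add = module_homD(2)[OF \<rho>_hom]
  and \<rho>_smult = module_homD(3)[OF \<rho>_hom]
  and \<rho>_zero = module_hom_zero[OF vectorspace_W vectorspace_W \<rho>_hom]

lemma \<rho>_one: "w \<in> carrier W \<Longrightarrow> \<rho> \<one> w = w"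
  using rep by (simp add: group_rep_def stabilizer_group_def)

lemma \<rho>_mult: "k \<in> K \<Longrightarrow> l \<in> K \<Longrightarrow> w \<in> carrier W \<Longrightarrow> \<rho> (k \<otimes> l) w = \<rho> k (\<rho> l w)"
  using rep by (simp add: group_rep_def stabilizer_group_def)

section \<open>The space of equivariant functions and its spanning family \<delta>\<close>

lemma M_simps [simp]:
  "\<zero>\<^bsub>M\<^esub> = (\<lambda>x. \<zero>\<^bsub>W\<^esub>)" "f \<oplus>\<^bsub>M\<^esub> f' = (\<lambda>x. f x \<oplus>\<^bsub>W\<^esub> f' x)" "c \<odot>\<^bsub>M\<^esub> f = (\<lambda>x. c \<odot>\<^bsub>W\<^esub> f x)"
  by (simp_all add: coind_space_def)

lemma M_carrier: "f \<in> carrier M \<longleftrightarrow> (\<forall>x. f x \<in> carrier W) \<and> (\<forall>x. x \<notin> D \<longrightarrow> f x = \<zero>\<^bsub>W\<^esub>) \<and>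
    (\<forall>x\<in>D. \<forall>k\<in>K. f (x \<otimes> k) = \<rho> (inv k) (f x))"
  by (simp add: coind_space_def)

lemma M_closed: "f \<in> carrier M \<Longrightarrow> f x \<in> carrier W"
  and M_outside: "f \<in> carrier M \<Longrightarrow> x \<notin> D \<Longrightarrow> f x = \<zero>\<^bsub>W\<^esub>"
  and M_equivariant: "f \<in> carrier M \<Longrightarrow> x \<in> D \<Longrightarrow> k \<in> K \<Longrightarrow> f (x \<otimes> k) = \<rho> (inv k) (f x)"
  by (simp_all add: M_carrier)

lemma M_add_closed: "f \<in> carrier M \<Longrightarrow> f' \<in> carrier M \<Longrightarrow> f \<oplus>\<^bsub>M\<^esub> f' \<in> carrier M"
  by (simp add: M_carrier W_add W_add_zero W_zero \<rho>_add K_inv)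

lemma M_smult_closed: "f \<in> carrier M \<Longrightarrow> c \<odot>\<^bsub>M\<^esub> f \<in> carrier M"
  by (simp add: M_carrier W_smult W_smult_zero \<rho>_smult K_inv)

lemma M_zero_closed: "\<zero>\<^bsub>M\<^esub> \<in> carrier M"
  by (simp add: M_carrier W_zero \<rho>_zero K_inv)

lemma vectorspace_M: "vectorspace complex_field M"
proof -
  have "\<exists>f'\<in>carrier M. f \<oplus>\<^bsub>M\<^esub> f' = \<zero>\<^bsub>M\<^esub>" if "f \<in> carrier M" for f
    using M_smult_closed[OF that, of "-1"] W_neg[OF M_closed[OF that]]
    by (intro bexI[of _ "(-1) \<odot>\<^bsub>M\<^esub> f"]) simp_all
  moreover have "f \<oplus>\<^bsub>M\<^esub> f' = f' \<oplus>\<^bsub>M\<^esub> f" if "f \<in> carrier M" "f' \<in> carrier M" for f f'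
    using W_commute[OF M_closed M_closed, OF that] by simp
  moreover have "f \<oplus>\<^bsub>M\<^esub> f' \<oplus>\<^bsub>M\<^esub> f'' = f \<oplus>\<^bsub>M\<^esub> (f' \<oplus>\<^bsub>M\<^esub> f'')"
    if "f \<in> carrier M" "f' \<in> carrier M" "f'' \<in> carrier M" for f f' f''
    using W_assoc[OF M_closed M_closed M_closed, OF that] by simp
  moreover have "f \<oplus>\<^bsub>M\<^esub> \<zero>\<^bsub>M\<^esub> = f" if "f \<in> carrier M" for f
    using W_add_zero(1)[OF M_closed, OF that] by simp
  moreover have "(c * d) \<odot>\<^bsub>M\<^esub> f = c \<odot>\<^bsub>M\<^esub> (d \<odot>\<^bsub>M\<^esub> f)" if "f \<in> carrier M" for c d f
    using W_smult_assoc[OF M_closed, OF that] by simp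
  moreover have "1 \<odot>\<^bsub>M\<^esub> f = f" if "f \<in> carrier M" for f
    using W_smult_one[OF M_closed, OF that] by simp
  moreover have "(c + d) \<odot>\<^bsub>M\<^esub> f = c \<odot>\<^bsub>M\<^esub> f \<oplus>\<^bsub>M\<^esub> d \<odot>\<^bsub>M\<^esub> f" if "f \<in> carrier M" for c d f
    using W_smult_add[OF M_closed, OF that] by simp
  moreover have "c \<odot>\<^bsub>M\<^esub> (f \<oplus>\<^bsub>M\<^esub> f') = c \<odot>\<^bsub>M\<^esub> f \<oplus>\<^bsub>M\<^esub> c \<odot>\<^bsub>M\<^esub> f'"
    if "f \<in> carrier M" "f' \<in> carrier M" for c f f'
    using W_smult_distrib[OF M_closed M_closed, OF that] by simp
  ultimately show ?thesis
    by (intro vs_criteria class_field)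
      (simp_all add: M_add_closed M_smult_closed M_zero_closed del: M_simps)
qed

lemma \<delta>_eq:
  assumes "x \<in> carrier G" "y \<in> carrier G" "inv x \<otimes> y \<in> K"
  shows "\<delta> x w y = \<rho> (inv y \<otimes> x) w"
  using assms by (simp add: delta_def)

lemma \<delta>_eq_zero: "inv x \<otimes> y \<notin> K \<or> y \<notin> carrier G \<Longrightarrow> \<delta> x w y = \<zero>\<^bsub>W\<^esub>"
  by (auto simp add: delta_def)

lemma \<delta>_closed:
  assumes x: "x \<in> D" and w: "w \<in> carrier W"
  shows "\<delta> x w \<in> carrier M"
  unfolding M_carrier
proof (intro conjI allI impI ballI)
  note xG = D_closed[OF x]
  show "\<delta> x w y \<in> carrier W" for y
    using mem_coset_K(3)[OF xG] \<rho>_closed[OF _ w] W_zero by (simp add: delta_def)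
  show "\<delta> x w y = \<zero>\<^bsub>W\<^esub>" if "y \<notin> D" for y
    using mem_coset_K(4)[OF xG _ _ x] that by (auto simp: delta_def)
  fix y k assume y: "y \<in> D" and k: "k \<in> K"
  note yG = D_closed[OF y] and kG = K_closed[OF k]
  show "\<delta> x w (y \<otimes> k) = \<rho> (inv k) (\<delta> x w y)"
  proof (cases "inv x \<otimes> y \<in> K")
    case True
    then have "inv x \<otimes> (y \<otimes> k) \<in> K" using K_mult[OF True k] xG yG kG by (simp add: m_assoc)
    then have "\<delta> x w (y \<otimes> k) = \<rho> (inv k \<otimes> (inv y \<otimes> x)) w"
      using xG yG kG by (simp add: \<delta>_eq inv_mult_group m_assoc)
    also have "\<dots> = \<rho> (inv k) (\<rho> (inv y \<otimes> x) w)"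
      using \<rho>_mult[OF K_inv[OF k] mem_coset_K(3)[OF xG yG True] w] .
    finally show ?thesis using True xG yG by (simp add: \<delta>_eq)
  next
    case False
    have "inv x \<otimes> (y \<otimes> k) \<notin> K"
    proof
      assume "inv x \<otimes> (y \<otimes> k) \<in> K"
      then have "inv x \<otimes> (y \<otimes> k) \<otimes> inv k \<in> K" using K_mult K_inv[OF k] by blast
      then show False using False xG yG kG by (simp add: m_assoc)
    qed
    then show ?thesis using False \<rho>_zero[OF K_inv[OF k]] by (simp add: \<delta>_eq_zero)
  qed
qed

lemma \<delta>_add:
  assumes x: "x \<in> D" and w: "w \<in> carrier W" "w' \<in> carrier W"
  shows "\<delta> x (w \<oplus>\<^bsub>W\<^esub> w') = \<delta> x w \<oplus>\<^bsub>M\<^esub> \<delta> x w'"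
  using mem_coset_K(3)[OF D_closed[OF x]] w
  by (auto simp: fun_eq_iff delta_def \<rho>_add W_add_zero W_zero)

lemma \<delta>_smult:
  assumes x: "x \<in> D" and w: "w \<in> carrier W"
  shows "\<delta> x (c \<odot>\<^bsub>W\<^esub> w) = c \<odot>\<^bsub>M\<^esub> \<delta> x w"
  using mem_coset_K(3)[OF D_closed[OF x]] w
  by (auto simp: fun_eq_iff delta_def \<rho>_smult W_smult_zero)

text \<open>Both functions live on the same coset, and y^-1 (x k) = (y^-1 x) k splits the action of
  the stabilizer. This is the balancing relation of the tensor product, read in the model.\<close>

lemma \<delta>_mult_K:
  assumes x: "x \<in> D" and k: "k \<in> K" and w: "w \<in> carrier W"
  shows "\<delta> (x \<otimes> k) w = \<delta> x (\<rho> k w)"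
proof
  fix y
  note xG = D_closed[OF x] and kG = K_closed[OF k]
  show "\<delta> (x \<otimes> k) w y = \<delta> x (\<rho> k w) y"
  proof (cases "y \<in> carrier G")
    case yG: True
    have *: "inv (x \<otimes> k) \<otimes> y = inv k \<otimes> (inv x \<otimes> y)"
      using xG kG yG by (simp add: inv_mult_group m_assoc)
    show ?thesis
    proof (cases "inv x \<otimes> y \<in> K")
      case True
      then have "inv (x \<otimes> k) \<otimes> y \<in> K" using * K_mult[OF K_inv[OF k]] by simp
      moreover have "\<rho> (inv y \<otimes> (x \<otimes> k)) w = \<rho> (inv y \<otimes> x) (\<rho> k w)"
        using \<rho>_mult[OF mem_coset_K(3)[OF xG yG True] k w] xG yG kG by (simp add: m_assoc)
      ultimately show ?thesis using True xG yG kG by (simp add: \<delta>_eq)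
    next
      case False
      have "inv (x \<otimes> k) \<otimes> y \<notin> K"
      proof
        assume "inv (x \<otimes> k) \<otimes> y \<in> K"
        then have "k \<otimes> (inv k \<otimes> (inv x \<otimes> y)) \<in> K" using * K_mult[OF k] by simp
        then show False using False xG yG kG by (simp flip: m_assoc)
      qed
      then show ?thesis using False by (simp add: \<delta>_eq_zero)
    qed
  qed (simp add: \<delta>_eq_zero)
qed

lemma \<delta>_diag: "x \<in> D \<Longrightarrow> w \<in> carrier W \<Longrightarrow> \<delta> x w x = w"
  using D_closed[of x] K_one by (simp add: delta_def \<rho>_one)

text \<open>Equivariance recovers f on the whole coset x K from its value at x. Hence subtracting
  \<open>\<delta> x (f x)\<close> erases f on this coset and leaves it unchanged elsewhere.\<close>

lemma \<delta>_self:
  assumes f: "f \<in> carrier M" and x: "x \<in> D" and y: "y \<in> carrier G" "inv x \<otimes> y \<in> K"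
  shows "\<delta> x (f x) y = f y"
proof -
  note m = mem_coset_K[OF D_closed[OF x] y]
  have "f y = f (x \<otimes> (inv x \<otimes> y))" using m(1) by simp
  also have "\<dots> = \<rho> (inv (inv x \<otimes> y)) (f x)" by (rule M_equivariant[OF f x y(2)])
  finally show ?thesis using D_closed[OF x] y m(2) by (simp add: \<delta>_eq)
qed

text \<open>The shifted coset g x K either lies in A^-1 or misses it entirely, so truncation is all
  or nothing on each \<delta>. This is the explicit formula for the action on (A,x) tensor
  w.\<close>

lemma \<tau>_\<delta>:
  assumes g: "g \<in> carrier G" and x: "x \<in> D" and w: "w \<in> carrier W"
  shows "\<tau> g (\<delta> x w) = (if g \<otimes> x \<in> D then \<delta> (g \<otimes> x) w else \<zero>\<^bsub>M\<^esub>)"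
proof
  fix y
  note xG = D_closed[OF x]
  have eq: "inv x \<otimes> (inv g \<otimes> y) = inv (g \<otimes> x) \<otimes> y"
    "inv (inv g \<otimes> y) \<otimes> x = inv y \<otimes> (g \<otimes> x)" if "y \<in> carrier G"
    using that g xG by (simp_all add: inv_mult_group m_assoc)
  consider "y \<notin> carrier G" | "y \<in> carrier G" "inv (g \<otimes> x) \<otimes> y \<notin> K"
    | "y \<in> carrier G" "inv (g \<otimes> x) \<otimes> y \<in> K" by blast
  then show "\<tau> g (\<delta> x w) y = (if g \<otimes> x \<in> D then \<delta> (g \<otimes> x) w else \<zero>\<^bsub>M\<^esub>) y"
  proof cases
    case 1
    then show ?thesis using D_closed[of y] by (auto simp: coind_action_def \<delta>_eq_zero)
  next
    case 2
    then show ?thesis using eq by (simp add: coind_action_def \<delta>_eq_zero)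
  next
    case 3
    \<comment> \<open>On the coset the source point is in \<open>D\<close> because x is; only the
      target point can be cut off.\<close>
    have "inv g \<otimes> y \<in> D"
      using mem_coset_K(4)[OF xG _ _ x, of "inv g \<otimes> y"] 3 g eq by simp
    moreover have "y \<in> D \<longleftrightarrow> g \<otimes> x \<in> D"
      using mem_coset_K(4,5)[of "g \<otimes> x" y] 3 g xG by auto
    ultimately show ?thesis using eq 3 g xG by (simp add: coind_action_def \<delta>_eq)
  qed
qed

text \<open>Induction on the size of the support: at a point x of the support, subtract
  \<open>\<delta> x (f x)\<close>, which clears x and creates no new nonzero value.\<close>

lemma \<delta>_span:
  assumes U: "VectorSpace.subspace complex_field U M"
    and \<delta>: "\<And>x w. x \<in> D \<Longrightarrow> w \<in> carrier W \<Longrightarrow> \<delta> x w \<in> U"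
  shows "U = carrier M"
proof -
  note UD = subspaceD[OF U]
  have "f \<in> U" if "f \<in> carrier M" for f
    using that
  proof (induction "card {x \<in> D. f x \<noteq> \<zero>\<^bsub>W\<^esub>}" arbitrary: f rule: less_induct)
    case (less f)
    show ?case
    proof (cases "\<exists>x\<in>D. f x \<noteq> \<zero>\<^bsub>W\<^esub>")
      case False
      then have "f = \<zero>\<^bsub>M\<^esub>" using M_outside[OF less.prems] by (auto simp: fun_eq_iff)
      then show ?thesis using UD(2) by simp
    next
      case True
      then obtain x where x: "x \<in> D" "f x \<noteq> \<zero>\<^bsub>W\<^esub>" by blast
      note fW = M_closed[OF less.prems]
      define d where "d = \<delta> x (f x)"
      have d: "d \<in> U" "d \<in> carrier M"
        unfolding d_def using \<delta>[OF x(1) fW] \<delta>_closed[OF x(1) fW] by auto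
      define f' where "f' = f \<oplus>\<^bsub>M\<^esub> (-1) \<odot>\<^bsub>M\<^esub> d"
      have f': "f' \<in> carrier M"
        unfolding f'_def by (rule M_add_closed[OF less.prems M_smult_closed[OF d(2)]])
      have dy: "d y = f y \<or> d y = \<zero>\<^bsub>W\<^esub>" for y
        using \<delta>_self[OF less.prems x(1), of y] \<delta>_eq_zero[of x y] unfolding d_def by blast
      have f'y: "f' y = \<zero>\<^bsub>W\<^esub> \<or> f' y = f y" for y
        using dy[of y]
      proof
        assume "d y = f y"
        then show ?thesis using W_neg[OF fW[of y]] by (simp add: f'_def)
      next
        assume "d y = \<zero>\<^bsub>W\<^esub>"
        then show ?thesis using W_add_zero(1)[OF fW[of y]] by (simp add: f'_def W_smult_zero)
      qed
      have "f' x = \<zero>\<^bsub>W\<^esub>"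
        unfolding f'_def d_def using \<delta>_diag[OF x(1) fW] W_neg[OF fW[of x]] by simp
      then have "{y \<in> D. f' y \<noteq> \<zero>\<^bsub>W\<^esub>} \<subseteq> {y \<in> D. f y \<noteq> \<zero>\<^bsub>W\<^esub>} - {x}"
        using f'y by force
      then have "{y \<in> D. f' y \<noteq> \<zero>\<^bsub>W\<^esub>} \<subset> {y \<in> D. f y \<noteq> \<zero>\<^bsub>W\<^esub>}"
        using x by blast
      then have "card {y \<in> D. f' y \<noteq> \<zero>\<^bsub>W\<^esub>} < card {y \<in> D. f y \<noteq> \<zero>\<^bsub>W\<^esub>}"
        using finite_D by (intro psubset_card_mono) auto
      then have "f' \<in> U" using less.hyps f' by blast
      moreover have "f = f' \<oplus>\<^bsub>M\<^esub> d"
      proof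
        fix y
        have dW: "d y \<in> carrier W" using M_closed[OF d(2)] .
        have "(f' \<oplus>\<^bsub>M\<^esub> d) y = f y \<oplus>\<^bsub>W\<^esub> ((-1) \<odot>\<^bsub>W\<^esub> d y \<oplus>\<^bsub>W\<^esub> d y)"
          unfolding f'_def using W_assoc[OF fW[of y] W_smult[OF dW] dW] by simp
        also have "(-1) \<odot>\<^bsub>W\<^esub> d y \<oplus>\<^bsub>W\<^esub> d y = \<zero>\<^bsub>W\<^esub>"
          using W_commute[OF W_smult[OF dW] dW] W_neg[OF dW] by simp
        finally show "f y = (f' \<oplus>\<^bsub>M\<^esub> d) y" using W_add_zero(1)[OF fW[of y]] by simp
      qed
      ultimately show ?thesis using UD(3)[of f' d] d(1) by simp
    qed
  qed
  then show ?thesis using UD(1) by blast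
qed

text \<open>Pulls a subspace of the model back to W, the form in which spanning sets and
  irreducibility of W are brought to bear.\<close>

lemma \<delta>_subspace:
  assumes x: "x \<in> D" and U: "VectorSpace.subspace complex_field U M"
  shows "VectorSpace.subspace complex_field {w \<in> carrier W. \<delta> x w \<in> U} W"
proof (rule subspaceI[OF vectorspace_W])
  have "\<delta> x \<zero>\<^bsub>W\<^esub> = \<zero>\<^bsub>M\<^esub>" using \<delta>_smult[OF x W_zero, of 0] M_closed[OF \<delta>_closed[OF x W_zero]]
    by (simp add: W_smult_zero)
  then show "\<zero>\<^bsub>W\<^esub> \<in> {w \<in> carrier W. \<delta> x w \<in> U}" using W_zero subspaceD(2)[OF U] by simp
  show "u \<oplus>\<^bsub>W\<^esub> v \<in> {w \<in> carrier W. \<delta> x w \<in> U}"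
    if "u \<in> {w \<in> carrier W. \<delta> x w \<in> U}" "v \<in> {w \<in> carrier W. \<delta> x w \<in> U}" for u v
    using that subspaceD(3)[OF U, of "\<delta> x u" "\<delta> x v"] \<delta>_add[OF x, of u v] by (auto simp: W_add)
  show "c \<odot>\<^bsub>W\<^esub> u \<in> {w \<in> carrier W. \<delta> x w \<in> U}" if "u \<in> {w \<in> carrier W. \<delta> x w \<in> U}" for c u
    using that subspaceD(4)[OF U, of "\<delta> x u"] \<delta>_smult[OF x, of u c] by (auto simp: W_smult)
qed auto

text \<open>\<open>D\<close> is finite, so a finite spanning set B of W yields the finite family of
  all \<open>\<delta> x b\<close>. Its span contains every \<open>\<delta> x w\<close>, because the
  w with this property form a subspace containing B.\<close>

lemma fd_vector_space_M: "fd_vector_space M"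
proof -
  interpret W: vectorspace complex_field W by (rule vectorspace_W)
  interpret M: vectorspace complex_field M by (rule vectorspace_M)
  have "W.fin_dim" using rep by (simp add: group_rep_def fd_vector_space_def)
  then obtain B where B: "finite B" "B \<subseteq> carrier W" "W.span B = carrier W"
    unfolding W.fin_dim_def by blast
  let ?S = "(\<lambda>(x, b). \<delta> x b) ` (D \<times> B)"
  have SM: "?S \<subseteq> carrier M" using \<delta>_closed B(2) by auto
  note span = M.span_is_subspace[OF SM]
  have "\<delta> x w \<in> M.span ?S" if x: "x \<in> D" and w: "w \<in> carrier W" for x w
  proof -
    let ?U = "{w \<in> carrier W. \<delta> x w \<in> M.span ?S}"
    have "B \<subseteq> ?U" using M.in_own_span[OF SM] x B(2) by blast
    then have "W.span B \<subseteq> ?U"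
      by (rule W.span_is_subset) (use \<delta>_subspace[OF x span] in \<open>simp add: VectorSpace.subspace_def\<close>)
    then show ?thesis using B(3) w by blast
  qed
  then have "M.span ?S = carrier M" by (rule \<delta>_span[OF span])
  moreover have "finite ?S" using B(1) finite_D by simp
  ultimately have "M.fin_dim" unfolding M.fin_dim_def using SM by (intro exI[of _ ?S]) simp
  then show ?thesis using vectorspace_M by (simp add: fd_vector_space_def)
qed

section \<open>The truncated translation action on the model\<close>

lemma D_mult_K_iff: "x \<in> carrier G \<Longrightarrow> k \<in> K \<Longrightarrow> x \<otimes> k \<in> D \<longleftrightarrow> x \<in> D"
  using D_mult_K[of x k] D_mult_K[of "x \<otimes> k" "inv k"] K_inv[of k] K_closed[of k]
  by (auto simp: m_assoc)

lemma inv_mult_D: "g \<in> carrier G \<Longrightarrow> x \<in> carrier G \<Longrightarrow> inv g \<otimes> x \<in> D \<longleftrightarrow> inv x \<otimes> g \<in> A"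
  by (simp add: D_iff inv_mult_group)

lemma \<tau>_closed:
  assumes g: "g \<in> carrier G" and f: "f \<in> carrier M"
  shows "\<tau> g f \<in> carrier M"
  unfolding M_carrier
proof (intro conjI allI impI ballI)
  show "\<tau> g f x \<in> carrier W" for x using M_closed[OF f] W_zero by (simp add: coind_action_def)
  show "\<tau> g f x = \<zero>\<^bsub>W\<^esub>" if "x \<notin> D" for x using that by (simp add: coind_action_def)
  fix x k assume x: "x \<in> D" and k: "k \<in> K"
  have eq: "inv g \<otimes> (x \<otimes> k) = inv g \<otimes> x \<otimes> k"
    using g D_closed[OF x] K_closed[OF k] by (simp add: m_assoc)
  have iff: "inv g \<otimes> x \<otimes> k \<in> D \<longleftrightarrow> inv g \<otimes> x \<in> D"
    using g D_closed[OF x] k by (intro D_mult_K_iff) auto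
  show "\<tau> g f (x \<otimes> k) = \<rho> (inv k) (\<tau> g f x)"
    using D_mult_K[OF x k] x M_equivariant[OF f _ k, of "inv g \<otimes> x"] \<rho>_zero[OF K_inv[OF k]]
    by (simp add: coind_action_def eq iff)
qed

lemma \<tau>_hom: "g \<in> carrier G \<Longrightarrow> \<tau> g \<in> LinearCombinations.module_hom complex_field M M"
proof (rule module_homI)
  assume g: "g \<in> carrier G"
  show "\<tau> g f \<in> carrier M" if "f \<in> carrier M" for f using \<tau>_closed[OF g that] .
  show "\<tau> g (f \<oplus>\<^bsub>M\<^esub> f') = \<tau> g f \<oplus>\<^bsub>M\<^esub> \<tau> g f'" for f f'
    by (rule ext) (simp add: coind_action_def W_add_zero(1)[OF W_zero])
  show "\<tau> g (c \<odot>\<^bsub>M\<^esub> f) = c \<odot>\<^bsub>M\<^esub> \<tau> g f" for c f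
    by (rule ext) (simp add: coind_action_def W_smult_zero(1))
qed

lemma \<tau>_one:
  assumes f: "f \<in> carrier M"
  shows "\<tau> \<one> f = f"
proof
  fix x show "\<tau> \<one> f x = f x"
    using M_outside[OF f, of x] D_closed[of x] by (cases "x \<in> D") (simp_all add: coind_action_def)
qed

text \<open>Composing two translations differs from translating by the product only in testing the
  intermediate point. After the outer \<open>inv g\<close> that point is x itself, which has been
  tested already.\<close>

lemma \<tau>_left:
  assumes g: "g \<in> carrier G" and h: "h \<in> carrier G" and f: "f \<in> carrier M"
  shows "\<tau> (inv g) (\<tau> (g \<otimes> h) f) = \<tau> (inv g) (\<tau> g (\<tau> h f))"
proof
  fix x
  show "\<tau> (inv g) (\<tau> (g \<otimes> h) f) x = \<tau> (inv g) (\<tau> g (\<tau> h f)) x"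
  proof (cases "x \<in> D")
    case True
    have "inv g \<otimes> (g \<otimes> x) = x" "inv (g \<otimes> h) \<otimes> (g \<otimes> x) = inv h \<otimes> x"
      using g h D_closed[OF True] by (simp_all add: inv_mult_group m_assoc flip: m_assoc[of "inv g" g x])
    then show ?thesis using g True by (simp add: coind_action_def)
  qed (simp add: coind_action_def)
qed

lemma \<tau>_right:
  assumes g: "g \<in> carrier G" and h: "h \<in> carrier G" and f: "f \<in> carrier M"
  shows "\<tau> (g \<otimes> h) (\<tau> (inv h) f) = \<tau> g (\<tau> h (\<tau> (inv h) f))"
proof
  fix x
  show "\<tau> (g \<otimes> h) (\<tau> (inv h) f) x = \<tau> g (\<tau> h (\<tau> (inv h) f)) x"
  proof (cases "x \<in> D")
    case True
    \<comment> \<open>The intermediate point. The inner translation by \<open>inv h\<close> already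
      tests it, since that is where it reads f.\<close>
    define z where "z = inv g \<otimes> x"
    have z: "inv (g \<otimes> h) \<otimes> x = inv h \<otimes> z" "h \<otimes> (inv h \<otimes> z) = z"
      using g h D_closed[OF True]
      by (simp_all add: z_def inv_mult_group m_assoc flip: m_assoc[of h "inv h"])
    then show ?thesis using h True by (simp add: coind_action_def flip: z_def)
  qed (simp add: coind_action_def)
qed

lemma global_partial_rep_M: "global_partial_rep G H M \<tau>"
proof -
  note HG = subgroup.mem_carrier[OF subgroup]
  have "\<tau> (h \<otimes> k) f = \<tau> h (\<tau> k f)" if h: "h \<in> H" and k: "k \<in> H" for h k f
  proof
    fix x
    show "\<tau> (h \<otimes> k) f x = \<tau> h (\<tau> k f) x"
    proof (cases "x \<in> D")
      case True
      have "inv (h \<otimes> k) \<otimes> x = inv k \<otimes> (inv h \<otimes> x)"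
        using HG[OF h] HG[OF k] D_closed[OF True] by (simp add: inv_mult_group m_assoc)
      moreover have "inv h \<otimes> x \<in> D" "inv k \<otimes> (inv h \<otimes> x) \<in> D"
        using H_mult_D subgroup.m_inv_closed[OF subgroup] h k True by auto
      ultimately show ?thesis using True by (simp add: coind_action_def)
    qed (simp add: coind_action_def)
  qed
  then show ?thesis
    unfolding global_partial_rep_def partial_rep_def group_rep_def
    using fd_vector_space_M \<tau>_hom \<tau>_one \<tau>_left \<tau>_right HG by simp
qed

section \<open>Idempotents and fixed spaces in the model\<close>

sublocale model: global_partial_representation G M \<tau> H
  using global_partial_rep_M
  by (intro global_partial_representation.intro partial_representation.intro group_axioms subgroup
      partial_representation_axioms.intro global_partial_representation_axioms.intro)
    (simp_all add: global_partial_rep_def)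

text \<open>The two translations cancel and only their tests remain: g^-1 y lies in A^-1 exactly
  when y^-1 g lies in A.\<close>

lemma model_eps:
  assumes g: "g \<in> carrier G"
  shows "model.eps g f y = (if y \<in> D \<and> inv y \<otimes> g \<in> A then f y else \<zero>\<^bsub>W\<^esub>)"
proof (cases "y \<in> D")
  case True
  have "g \<otimes> (inv g \<otimes> y) = y" using g D_closed[OF True] by (simp flip: m_assoc)
  then show ?thesis
    using g True inv_mult_D[OF g D_closed[OF True]] by (simp add: model.eps_def coind_action_def)
qed (simp add: model.eps_def coind_action_def)

lemma model_proj:
  assumes f: "f \<in> carrier M"
  shows "set gs \<subseteq> carrier G \<Longrightarrow>
    model.proj gs f y = (if \<forall>g\<in>set gs. inv y \<otimes> g \<in> A then f y else \<zero>\<^bsub>W\<^esub>)"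
proof (cases "y \<in> D")
  case True
  then show "set gs \<subseteq> carrier G \<Longrightarrow> ?thesis" by (induction gs) (simp_all add: model_eps)
next
  case False
  then show "set gs \<subseteq> carrier G \<Longrightarrow> ?thesis"
    using M_outside[OF f False] by (induction gs) (simp_all add: model_eps)
qed

text \<open>Every idempotent is multiplication by an indicator, so being fixed restricts only the
  support: B must be contained in y A wherever f is nonzero at y.\<close>

lemma fix_space_iff:
  assumes B: "B \<subseteq> carrier G"
  shows "f \<in> fix_space G M \<tau> B \<longleftrightarrow>
    f \<in> carrier M \<and> (\<forall>y. f y \<noteq> \<zero>\<^bsub>W\<^esub> \<longrightarrow> (\<forall>g\<in>B. inv y \<otimes> g \<in> A))"
proof -
  have "model.eps g f = f \<longleftrightarrow> (\<forall>y. f y \<noteq> \<zero>\<^bsub>W\<^esub> \<longrightarrow> inv y \<otimes> g \<in> A)"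
    if "g \<in> B" "f \<in> carrier M" for g
  proof -
    have "g \<in> carrier G" using that(1) B by blast
    then show ?thesis
      unfolding fun_eq_iff model_eps[OF \<open>g \<in> carrier G\<close>] using M_outside[OF that(2)] by metis
  qed
  then show ?thesis unfolding model.fix_space_eps by blast
qed

lemma \<delta>_one_eq_zero: "y \<notin> K \<Longrightarrow> \<delta> \<one> w y = \<zero>\<^bsub>W\<^esub>"
  by (cases "y \<in> carrier G") (simp_all add: delta_def)

lemma \<delta>_one_fix_space:
  assumes w: "w \<in> carrier W"
  shows "\<delta> \<one> w \<in> fix_space G M \<tau> A"
  unfolding fix_space_iff[OF A_subset]
proof (intro conjI allI impI ballI)
  show "\<delta> \<one> w \<in> carrier M" by (rule \<delta>_closed[OF one_D w])
  fix y g assume "\<delta> \<one> w y \<noteq> \<zero>\<^bsub>W\<^esub>" and g: "g \<in> A"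
  then have "y \<in> K" using \<delta>_one_eq_zero by blast
  then show "inv y \<otimes> g \<in> A" using K_mult_A[OF K_inv g] by blast
qed

text \<open>On the support A is contained in y A, so y lies in \<open>K\<close> by
  \<open>K_I\<close>; on \<open>K\<close> equivariance leaves only the value at \<one> free. So
  evaluation at \<one> identifies the fixed space with W.\<close>

lemma fix_space_eq_\<delta>:
  assumes f: "f \<in> fix_space G M \<tau> A"
  shows "f = \<delta> \<one> (f \<one>)"
proof
  fix y
  note f' = f[unfolded fix_space_iff[OF A_subset]]
  show "f y = \<delta> \<one> (f \<one>) y"
  proof (cases "y \<in> K")
    case True
    then show ?thesis using \<delta>_self[of f \<one> y] f' one_D K_closed by simp
  next
    case False
    have "f y = \<zero>\<^bsub>W\<^esub>"
    proof (rule ccontr)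
      assume nz: "f y \<noteq> \<zero>\<^bsub>W\<^esub>"
      then have "y \<in> D" using M_outside f' by blast
      then have "y \<in> K" using f' nz by (intro K_I D_closed) auto
      then show False using False by simp
    qed
    then show ?thesis using \<delta>_one_eq_zero[OF False] by simp
  qed
qed

lemma \<tau>_\<delta>_one:
  assumes "x \<in> D" "w \<in> carrier W"
  shows "\<tau> x (\<delta> \<one> w) = \<delta> x w"
  using \<tau>_\<delta>[OF D_closed one_D assms(2), OF assms(1)] D_closed[OF assms(1)] assms by simp

lemma \<tau>_\<delta>_one_K:
  assumes "k \<in> K" "w \<in> carrier W"
  shows "\<tau> k (\<delta> \<one> w) = \<delta> \<one> (\<rho> k w)"
  using \<tau>_\<delta>_one[OF K_subset_D assms(2), OF assms(1)] \<delta>_mult_K[OF one_D assms] K_closed[OF assms(1)]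
  by simp

lemma \<delta>_one_nonzero: "w \<in> carrier W \<Longrightarrow> w \<noteq> \<zero>\<^bsub>W\<^esub> \<Longrightarrow> \<delta> \<one> w \<noteq> \<zero>\<^bsub>M\<^esub>"
proof
  assume w: "w \<in> carrier W" "w \<noteq> \<zero>\<^bsub>W\<^esub>" and "\<delta> \<one> w = \<zero>\<^bsub>M\<^esub>"
  then have "\<delta> \<one> w \<one> = \<zero>\<^bsub>W\<^esub>" by simp
  then show False using \<delta>_diag[OF one_D w(1)] w(2) by simp
qed

text \<open>From any nonzero f in a stable U, translating and projecting isolates a nonzero
  \<open>\<delta> \<one> w\<close> in U. The w with \<open>\<delta> \<one> w\<close> in U form a
  stable subspace of W, hence all of it, and translates of these functions span the model.\<close>

lemma irreducible_M:
  assumes irr: "irreducible_action (stabilizer_group G A) W \<rho>"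
  shows "irreducible_action G M \<tau>"
  unfolding irreducible_action_def
proof (intro conjI allI impI)
  obtain w where "w \<in> carrier W" "w \<noteq> \<zero>\<^bsub>W\<^esub>"
    using irr W_zero unfolding irreducible_action_def by blast
  then show "carrier M \<noteq> {\<zero>\<^bsub>M\<^esub>}" using \<delta>_one_nonzero \<delta>_closed[OF one_D] by blast
next
  fix U assume "VectorSpace.subspace complex_field U M \<and> (\<forall>g\<in>carrier G. \<forall>u\<in>U. \<tau> g u \<in> U)"
  then have U: "VectorSpace.subspace complex_field U M"
    and stable: "\<And>g u. g \<in> carrier G \<Longrightarrow> u \<in> U \<Longrightarrow> \<tau> g u \<in> U" by auto
  note UD = subspaceD[OF U]
  show "U = {\<zero>\<^bsub>M\<^esub>} \<or> U = carrier M"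
  proof (cases "U = {\<zero>\<^bsub>M\<^esub>}")
    case False
    then obtain f where f: "f \<in> U" "f \<noteq> \<zero>\<^bsub>M\<^esub>" using UD(2) by blast
    then have fM: "f \<in> carrier M" using UD(1) by blast
    obtain x where x: "f x \<noteq> \<zero>\<^bsub>W\<^esub>" using f(2) by (auto simp: fun_eq_iff)
    have xD: "x \<in> D" using M_outside[OF fM] x by blast
    note xG = D_closed[OF xD]
    obtain gs where gs: "set gs = A"
      using finite_list finite_subset[OF A_subset finite_carrier] by blast
    \<comment> \<open>Both x and \<one> lie in \<open>D\<close>, so the translation is not cut off
      at \<one> and carries the value at x there.\<close>
    define f' where "f' = \<tau> (inv x) f"
    have f': "f' \<in> U" "f' \<in> carrier M" "f' \<one> = f x"
      unfolding f'_def using stable f(1) \<tau>_closed fM xG one_D xD by (auto simp: coind_action_def)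
    define f'' where "f'' = model.proj gs f'"
    have f'': "f'' \<in> U" "f'' \<in> fix_space G M \<tau> A"
      unfolding f''_def
      using model.stable_proj[OF stable _ f'(1)] model.proj_fix_space[OF _ f'(2)] gs A_subset
      by auto
    \<comment> \<open>At \<one> every test is g in A and succeeds, so the projection keeps this
      value.\<close>
    have "f'' \<one> = f x"
      unfolding f''_def using model_proj[OF f'(2), of gs \<one>] gs A_subset f'(3)
      by (auto simp: subset_iff)
    then have \<delta>f: "\<delta> \<one> (f x) \<in> U" using fix_space_eq_\<delta>[OF f''(2)] f''(1) by simp
    let ?U = "{w \<in> carrier W. \<delta> \<one> w \<in> U}"
    have "\<forall>k\<in>carrier (stabilizer_group G A). \<forall>w\<in>?U. \<rho> k w \<in> ?U"
    proof (intro ballI)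
      fix k w assume "k \<in> carrier (stabilizer_group G A)" and w: "w \<in> ?U"
      then have k: "k \<in> K" by (simp add: stabilizer_group_def)
      have "\<delta> \<one> (\<rho> k w) = \<tau> k (\<delta> \<one> w)" using \<tau>_\<delta>_one_K[OF k] w by simp
      then show "\<rho> k w \<in> ?U" using stable[OF K_closed[OF k]] w \<rho>_closed[OF k] by simp
    qed
    then have "?U = {\<zero>\<^bsub>W\<^esub>} \<or> ?U = carrier W"
      using irr \<delta>_subspace[OF one_D U] unfolding irreducible_action_def by blast
    moreover have "f x \<in> ?U" using \<delta>f M_closed[OF fM] by simp
    ultimately have "?U = carrier W" using x by blast
    then have "\<delta> x w \<in> U" if "x \<in> D" "w \<in> carrier W" for x w
      using that \<tau>_\<delta>_one[OF that] stable[OF D_closed[OF that(1)], of "\<delta> \<one> w"] by auto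
    then show ?thesis using \<delta>_span[OF U] by blast
  qed simp
qed

end

section \<open>Isomorphisms between function models\<close>

lemma fix_space_isomorphic:
  assumes V: "partial_representation G V \<pi>"
    and W: "partial_representation G W \<sigma>"
    and T: "T \<in> LinearCombinations.module_hom complex_field V W" "bij_betw T (carrier V) (carrier W)"
      "\<forall>g\<in>carrier G. \<forall>v\<in>carrier V. T (\<pi> g v) = \<sigma> g (T v)"
    and A: "A \<subseteq> carrier G" and v: "v \<in> carrier V"
  shows "T v \<in> fix_space G W \<sigma> A \<longleftrightarrow> v \<in> fix_space G V \<pi> A"
proof -
  interpret V: partial_representation G V \<pi> by fact
  have "\<sigma> g (\<sigma> (inv\<^bsub>G\<^esub> g) (T v)) = T v \<longleftrightarrow> \<pi> g (\<pi> (inv\<^bsub>G\<^esub> g) v) = v" if "g \<in> A" for g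
  proof -
    have g: "g \<in> carrier G" using that A by blast
    have "\<sigma> g (\<sigma> (inv\<^bsub>G\<^esub> g) (T v)) = T (\<pi> g (\<pi> (inv\<^bsub>G\<^esub> g) v))"
      using g v T(3) V.closed by simp
    then show ?thesis
      using bij_betw_imp_inj_on[OF T(2)] V.closed g v by (simp add: inj_on_eq_iff)
  qed
  then show ?thesis using v module_homD(1)[OF T(1)] by (auto simp: fix_space_def)
qed

text \<open>Fixed vectors are transported by T, so \<open>\<delta> \<one> w\<close> becomes a
  nonzero function in the model of A' that is fixed for A. At any x where it does not vanish,
  \<open>fix_space_iff\<close> yields the inclusion.\<close>

lemma isomorphic_coind_subset:
  assumes R: "stabilizer_rep G H A W \<rho>" and R': "stabilizer_rep G H A' W' \<rho>'"
    and nz: "carrier W \<noteq> {\<zero>\<^bsub>W\<^esub>}"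
    and iso: "isomorphic_actions G (coind_space G A W \<rho>) (coind_action G A W)
      (coind_space G A' W' \<rho>') (coind_action G A' W')"
  shows "\<exists>x\<in>arrow_set G A'. A \<subseteq> x <#\<^bsub>G\<^esub> A'"
proof -
  interpret R: stabilizer_rep G H A W \<rho> by fact
  interpret R': stabilizer_rep G H A' W' \<rho>' by fact
  obtain T where T: "T \<in> LinearCombinations.module_hom complex_field R.M R'.M"
      "bij_betw T (carrier R.M) (carrier R'.M)"
      "\<forall>g\<in>carrier G. \<forall>v\<in>carrier R.M. T (R.\<tau> g v) = R'.\<tau> g (T v)"
    using iso unfolding isomorphic_actions_def by blast
  obtain w where w: "w \<in> carrier W" "w \<noteq> \<zero>\<^bsub>W\<^esub>" using nz R.W_zero by blast
  let ?f = "R.\<delta> \<one>\<^bsub>G\<^esub> w"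
  have f: "?f \<in> carrier R.M" by (rule R.\<delta>_closed[OF R.one_D w(1)])
  have Tf: "T ?f \<in> fix_space G R'.M R'.\<tau> A"
    using fix_space_isomorphic[OF R.model.partial_representation_axioms
        R'.model.partial_representation_axioms T R.A_subset f] R.\<delta>_one_fix_space[OF w(1)] by simp
  have "T ?f \<noteq> \<zero>\<^bsub>R'.M\<^esub>"
  proof
    assume "T ?f = \<zero>\<^bsub>R'.M\<^esub>"
    then have "T ?f = T \<zero>\<^bsub>R.M\<^esub>"
      using module_hom_zero[OF R.vectorspace_M R'.vectorspace_M T(1)] by simp
    then have "?f = \<zero>\<^bsub>R.M\<^esub>"
      using inj_onD[OF bij_betw_imp_inj_on[OF T(2)]] f R.M_zero_closed by blast
    then show False using R.\<delta>_one_nonzero[OF w] by blast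
  qed
  then obtain x where x: "T ?f x \<noteq> \<zero>\<^bsub>W'\<^esub>" by (auto simp: fun_eq_iff)
  have Tf': "T ?f \<in> carrier R'.M" "\<forall>g\<in>A. inv\<^bsub>G\<^esub> x \<otimes>\<^bsub>G\<^esub> g \<in> A'"
    using Tf x unfolding R'.fix_space_iff[OF R.A_subset] by auto
  have xD: "x \<in> R'.D" using R'.M_outside[OF Tf'(1)] x by blast
  have "A \<subseteq> x <#\<^bsub>G\<^esub> A'"
    using Tf'(2) R.A_subset by (auto simp: R.mem_l_coset_iff[OF R'.A_subset R'.D_closed[OF xD]])
  then show ?thesis using xD by blast
qed

text \<open>Inclusions in both directions bound each cardinality by the other. An inclusion of
  finite sets of equal size is an equality, and the x that comes with it is an arrow between the
  objects.\<close>

lemma isomorphic_coind_connected: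
  assumes R: "stabilizer_rep G H A W \<rho>" and R': "stabilizer_rep G H A' W' \<rho>'"
    and nz: "carrier W \<noteq> {\<zero>\<^bsub>W\<^esub>}" "carrier W' \<noteq> {\<zero>\<^bsub>W'\<^esub>}"
    and iso: "isomorphic_actions G (coind_space G A W \<rho>) (coind_action G A W)
      (coind_space G A' W' \<rho>') (coind_action G A' W')"
  shows "(A', A) \<in> gpd_connected G H"
proof -
  interpret R: stabilizer_rep G H A W \<rho> by fact
  interpret R': stabilizer_rep G H A' W' \<rho>' by fact
  have iso': "isomorphic_actions G R'.M R'.\<tau> R.M R.\<tau>"
    by (rule isomorphic_actions_sym[OF R.vectorspace_M R.\<tau>_closed iso])
  have card: "finite (x <#\<^bsub>G\<^esub> B) \<and> card (x <#\<^bsub>G\<^esub> B) \<le> card B" if "B \<subseteq> carrier G" for x B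
  proof -
    have "x <#\<^bsub>G\<^esub> B = (\<otimes>\<^bsub>G\<^esub>) x ` B" by (auto simp: l_coset_def)
    then show ?thesis
      using card_image_le finite_subset[OF that R.finite_carrier] by simp
  qed
  obtain x where x: "x \<in> arrow_set G A'" "A \<subseteq> x <#\<^bsub>G\<^esub> A'"
    using isomorphic_coind_subset[OF R R' nz(1) iso] by blast
  obtain x' where x': "A' \<subseteq> x' <#\<^bsub>G\<^esub> A"
    using isomorphic_coind_subset[OF R' R nz(2) iso'] by blast
  have "card A' \<le> card A"
    using card[OF R.A_subset, of x'] card_mono[of "x' <#\<^bsub>G\<^esub> A" A'] x' by linarith
  then have "A = x <#\<^bsub>G\<^esub> A'"
    using card[OF R'.A_subset, of x] x(2) by (intro card_seteq) auto
  then show ?thesis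
    using x(1) R'.object unfolding R.gpd_connected_iff arrow_set_def by blast
qed

lemma isomorphic_coindI:
  assumes R: "stabilizer_rep G H A W \<rho>" and R': "stabilizer_rep G H A W' \<rho>'"
    and iso: "isomorphic_actions (stabilizer_group G A) W \<rho> W' \<rho>'"
  shows "isomorphic_actions G (coind_space G A W \<rho>) (coind_action G A W)
      (coind_space G A W' \<rho>') (coind_action G A W')"
proof -
  interpret R: stabilizer_rep G H A W \<rho> by fact
  interpret R': stabilizer_rep G H A W' \<rho>' by fact
  \<comment> \<open>Stated for arbitrary representations and types because it is applied both to S
    and to its inverse.\<close>
  have hom_map: "(\<lambda>f x. S (f x)) \<in> LinearCombinations.module_hom complex_field
      (coind_space G A U \<upsilon>) (coind_space G A U' \<upsilon>')"
    if Q: "stabilizer_rep G H A U \<upsilon>" and Q': "stabilizer_rep G H A U' \<upsilon>'"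
      and S: "S \<in> LinearCombinations.module_hom complex_field U U'"
      and SE: "\<forall>k\<in>stabilizer_set G A. \<forall>u\<in>carrier U. S (\<upsilon> k u) = \<upsilon>' k (S u)"
    for U :: "(complex, 'x) module" and \<upsilon> and U' :: "(complex, 'y) module" and \<upsilon>' S
  proof -
    interpret Q: stabilizer_rep G H A U \<upsilon> by fact
    interpret Q': stabilizer_rep G H A U' \<upsilon>' by fact
    show ?thesis
    proof (rule module_homI)
      fix f assume f: "f \<in> carrier Q.M"
      show "(\<lambda>x. S (f x)) \<in> carrier Q'.M"
        unfolding Q'.M_carrier
        using Q.M_closed[OF f] Q.M_outside[OF f] Q.M_equivariant[OF f] module_homD(1)[OF S]
          module_hom_zero[OF Q.vectorspace_W Q'.vectorspace_W S] SE Q.K_inv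
        by simp
      show "(\<lambda>x. S ((c \<odot>\<^bsub>Q.M\<^esub> f) x)) = c \<odot>\<^bsub>Q'.M\<^esub> (\<lambda>x. S (f x))" for c
        using Q.M_closed[OF f] module_homD(3)[OF S] by simp
    next
      fix f f' assume f: "f \<in> carrier Q.M" "f' \<in> carrier Q.M"
      show "(\<lambda>x. S ((f \<oplus>\<^bsub>Q.M\<^esub> f') x)) = (\<lambda>x. S (f x)) \<oplus>\<^bsub>Q'.M\<^esub> (\<lambda>x. S (f' x))"
        using Q.M_closed[OF f(1)] Q.M_closed[OF f(2)] module_homD(2)[OF S] by simp
    qed
  qed
  obtain S where S: "S \<in> LinearCombinations.module_hom complex_field W W'"
      "bij_betw S (carrier W) (carrier W')"
      "\<forall>k\<in>R.K. \<forall>v\<in>carrier W. S (\<rho> k v) = \<rho>' k (S v)"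
    using iso unfolding isomorphic_actions_def stabilizer_group_def by auto
  let ?S' = "inv_into (carrier W) S"
  have S': "?S' w \<in> carrier W" "S (?S' w) = w" if "w \<in> carrier W'" for w
    using that S(2) by (auto simp: bij_betw_def f_inv_into_f inv_into_into)
  have S'S: "?S' (S v) = v" if "v \<in> carrier W" for v
    using that S(2) by (auto simp: bij_betw_def)
  have S'_equiv: "\<forall>k\<in>R.K. \<forall>w\<in>carrier W'. ?S' (\<rho>' k w) = \<rho> k (?S' w)"
  proof (intro ballI)
    fix k w assume k: "k \<in> R.K" and w: "w \<in> carrier W'"
    have "S (\<rho> k (?S' w)) = \<rho>' k w" using S(3) k S'[OF w] by simp
    then show "?S' (\<rho>' k w) = \<rho> k (?S' w)" using S'S[OF R.\<rho>_closed[OF k S'(1)[OF w]]] by simp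
  qed
  note F = hom_map[OF R R' S(1) S(3)]
  note F' = hom_map[OF R' R module_hom_inv_into[OF R.vectorspace_W S(1,2)] S'_equiv]
  have "bij_betw (\<lambda>f x. S (f x)) (carrier R.M) (carrier R'.M)"
  proof (rule bij_betw_byWitness[where f' = "\<lambda>f x. ?S' (f x)"])
    show "\<forall>f\<in>carrier R.M. (\<lambda>x. ?S' (S (f x))) = f" using S'S R.M_closed by simp
    show "\<forall>f\<in>carrier R'.M. (\<lambda>x. S (?S' (f x))) = f" using S'(2) R'.M_closed by simp
    show "(\<lambda>f x. S (f x)) ` carrier R.M \<subseteq> carrier R'.M" using module_homD(1)[OF F] by blast
    show "(\<lambda>f x. ?S' (f x)) ` carrier R'.M \<subseteq> carrier R.M" using module_homD(1)[OF F'] by blast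
  qed
  \<comment> \<open>Truncation is respected because S maps zero to zero.\<close>
  moreover have "(\<lambda>x. S (R.\<tau> g f x)) = R'.\<tau> g (\<lambda>x. S (f x))" for g f
    by (rule ext)
      (simp add: coind_action_def module_hom_zero[OF R.vectorspace_W R'.vectorspace_W S(1)])
  ultimately show ?thesis
    unfolding isomorphic_actions_def using F by (intro bexI[of _ "\<lambda>f x. S (f x)"]) simp_all
qed

text \<open>T matches the fixed spaces of A in the two models, and these are copies of W and W' on
  which \<open>K\<close> acts through \<rho> and \<rho>'.\<close>

lemma isomorphic_coindD:
  assumes R: "stabilizer_rep G H A W \<rho>" and R': "stabilizer_rep G H A W' \<rho>'"
    and iso: "isomorphic_actions G (coind_space G A W \<rho>) (coind_action G A W)
      (coind_space G A W' \<rho>') (coind_action G A W')"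
  shows "isomorphic_actions (stabilizer_group G A) W \<rho> W' \<rho>'"
proof -
  interpret R: stabilizer_rep G H A W \<rho> by fact
  interpret R': stabilizer_rep G H A W' \<rho>' by fact
  obtain T where T: "T \<in> LinearCombinations.module_hom complex_field R.M R'.M"
      "bij_betw T (carrier R.M) (carrier R'.M)"
      "\<forall>g\<in>carrier G. \<forall>v\<in>carrier R.M. T (R.\<tau> g v) = R'.\<tau> g (T v)"
    using iso unfolding isomorphic_actions_def by blast
  note fix_iff = fix_space_isomorphic[OF R.model.partial_representation_axioms
        R'.model.partial_representation_axioms T R.A_subset]
  \<comment> \<open>The restriction of T to the fixed spaces in coordinates: embed w by \<delta> at
    \<one>, read the result off at \<one>.\<close>
  define S where "S w = T (R.\<delta> \<one>\<^bsub>G\<^esub> w) \<one>\<^bsub>G\<^esub>" for w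
  note \<delta>M = R.\<delta>_closed[OF R.one_D] and \<delta>M' = R'.\<delta>_closed[OF R'.one_D]
  note TM = module_homD(1)[OF T(1) \<delta>M]
  have S_closed: "S w \<in> carrier W'" if "w \<in> carrier W" for w
    unfolding S_def by (rule R'.M_closed[OF TM[OF that]])
  have T\<delta>: "T (R.\<delta> \<one>\<^bsub>G\<^esub> w) = R'.\<delta> \<one>\<^bsub>G\<^esub> (S w)" if "w \<in> carrier W" for w
    unfolding S_def using fix_iff[OF \<delta>M[OF that]] R.\<delta>_one_fix_space[OF that]
    by (intro R'.fix_space_eq_\<delta>) simp
  have "S \<in> LinearCombinations.module_hom complex_field W W'"
  proof (rule module_homI)
    show "S (u \<oplus>\<^bsub>W\<^esub> v) = S u \<oplus>\<^bsub>W'\<^esub> S v" if "u \<in> carrier W" "v \<in> carrier W" for u v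
      unfolding S_def R.\<delta>_add[OF R.one_D that] module_homD(2)[OF T(1) \<delta>M \<delta>M, OF that] by simp
    show "S (c \<odot>\<^bsub>W\<^esub> v) = c \<odot>\<^bsub>W'\<^esub> S v" if "v \<in> carrier W" for c v
      unfolding S_def R.\<delta>_smult[OF R.one_D that] module_homD(3)[OF T(1) \<delta>M, OF that] by simp
  qed (rule S_closed)
  moreover have "bij_betw S (carrier W) (carrier W')"
  proof (rule bij_betwI')
    fix u v assume uv: "u \<in> carrier W" "v \<in> carrier W"
    show "S u = S v \<longleftrightarrow> u = v"
    proof
      assume "S u = S v"
      then have "R.\<delta> \<one>\<^bsub>G\<^esub> u = R.\<delta> \<one>\<^bsub>G\<^esub> v"
        using T\<delta> uv inj_onD[OF bij_betw_imp_inj_on[OF T(2)]] \<delta>M by metis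
      then show "u = v" using R.\<delta>_diag[OF R.one_D] uv by metis
    qed simp
  next
    fix w assume w: "w \<in> carrier W'"
    \<comment> \<open>The preimage of a fixed function is fixed, hence of the form \<delta> at
      \<one> again, and its value at \<one> is the required preimage of w.\<close>
    obtain f where f: "f \<in> carrier R.M" "T f = R'.\<delta> \<one>\<^bsub>G\<^esub> w"
      using bij_betw_imp_surj_on[OF T(2)] \<delta>M'[OF w] by (metis imageE)
    have "f \<in> fix_space G R.M R.\<tau> A"
      using fix_iff[OF f(1)] R'.\<delta>_one_fix_space[OF w] f(2) by simp
    then have "S (f \<one>\<^bsub>G\<^esub>) = T f \<one>\<^bsub>G\<^esub>" unfolding S_def using R.fix_space_eq_\<delta> by metis
    then have "w = S (f \<one>\<^bsub>G\<^esub>)" using f(2) R'.\<delta>_diag[OF R'.one_D w] by simp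
    then show "\<exists>v\<in>carrier W. w = S v" using R.M_closed[OF f(1)] by blast
  qed (rule S_closed)
  moreover have "S (\<rho> k w) = \<rho>' k (S w)" if k: "k \<in> R.K" and w: "w \<in> carrier W" for k w
  proof -
    have "S (\<rho> k w) = T (R.\<tau> k (R.\<delta> \<one>\<^bsub>G\<^esub> w)) \<one>\<^bsub>G\<^esub>"
      unfolding S_def R.\<tau>_\<delta>_one_K[OF k w] ..
    also have "\<dots> = R'.\<delta> \<one>\<^bsub>G\<^esub> (\<rho>' k (S w)) \<one>\<^bsub>G\<^esub>"
      unfolding T(3)[rule_format, OF R.K_closed[OF k] \<delta>M[OF w]] T\<delta>[OF w] R'.\<tau>_\<delta>_one_K[OF k S_closed[OF w]] ..
    also have "\<dots> = \<rho>' k (S w)"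
      by (rule R'.\<delta>_diag[OF R'.one_D R'.\<rho>_closed[OF k S_closed[OF w]]])
    finally show ?thesis .
  qed
  ultimately show ?thesis by (auto simp: isomorphic_actions_def stabilizer_group_def)
qed

section \<open>Irreducible partial representations are induced\<close>

locale maximal_object = global_partial_representation G V \<pi> H
  for G :: "('g, 'b) monoid_scheme" (structure) and V :: "(complex, 'v) module" and \<pi> H +
  fixes A
  assumes finite_carrier: "finite (carrier G)"
    and irreducible: "irreducible_action G V \<pi>"
    and object: "A \<in> coset_unions G H"
    and nonzero: "fix_space G V \<pi> A \<noteq> {\<zero>\<^bsub>V\<^esub>}"
    and maximal: "\<And>B. B \<in> coset_unions G H \<Longrightarrow> fix_space G V \<pi> B \<noteq> {\<zero>\<^bsub>V\<^esub>} \<Longrightarrow> card B \<le> card A"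
begin

abbreviation F :: "'v set" where "F \<equiv> fix_space G V \<pi> A"
text \<open>Only the carrier changes: W keeps the type of V, and \<pi> itself serves as the action
  of the stabilizer.\<close>

abbreviation W :: "(complex, 'v) module" where "W \<equiv> V\<lparr>carrier := F\<rparr>"

lemmas A_subset = coset_unionsD(2)[OF subgroup object]

lemma F_subspace: "VectorSpace.subspace complex_field F V"
  by (rule subspace_fix_space[OF A_subset])

lemmas F_carrier = subsetD[OF subspaceD(1)[OF F_subspace]]
  and F_zero = subspaceD(2)[OF F_subspace]

lemma vectorspace_W: "vectorspace complex_field W"
  by (rule vectorspace.subspace_is_vs[OF vectorspace F_subspace])

lemma eps_F: "a \<in> A \<Longrightarrow> v \<in> F \<Longrightarrow> eps a v = v"
  by (simp add: fix_space_eps)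

text \<open>Maximality of \<open>A\<close> enters here: a nonzero \<open>eps h v\<close> would be fixed by all of
  \<open>A \<union> hH\<close>.\<close>

lemma eps_F_outside:
  assumes h: "h \<in> carrier G" "h \<notin> A" and v: "v \<in> F"
  shows "eps h v = \<zero>\<^bsub>V\<^esub>"
proof (rule ccontr)
  assume nz: "eps h v \<noteq> \<zero>\<^bsub>V\<^esub>"
  note vV = F_carrier[OF v] and HG = subgroup.mem_carrier[OF subgroup]
  define B where "B = A \<union> (h <# H)"
  have hH: "h <# H \<subseteq> carrier G" using l_coset_subset_G[OF subgroup.subset[OF subgroup] h(1)] .
  have "b \<otimes> k \<in> h <# H" if b: "b \<in> h <# H" and k: "k \<in> H" for b k
  proof -
    obtain l where l: "l \<in> H" "b = h \<otimes> l" using b by (auto simp: l_coset_def)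
    then have "b \<otimes> k = h \<otimes> (l \<otimes> k)" using h HG k by (simp add: m_assoc)
    then show ?thesis using subgroup.m_closed[OF subgroup l(1) k] by (auto simp: l_coset_def)
  qed
  then have B: "B \<in> coset_unions G H"
    using coset_unionsD[OF subgroup object] hH unfolding B_def coset_unions_iff[OF subgroup] by blast
  have "eps b (eps h v) = eps h v" if "b \<in> B" for b
  proof (cases "b \<in> A")
    case True
    then show ?thesis using eps_commute[OF _ h(1) vV, of b] eps_F[OF True v] A_subset by auto
  next
    case False
    then obtain k where k: "k \<in> H" "b = h \<otimes> k" using \<open>b \<in> B\<close> by (auto simp: B_def l_coset_def)
    \<comment> \<open>On the coset h H all idempotents agree with \<open>eps h\<close>, which fixes
      its own range.\<close>
    then show ?thesis using eps_mult_H[OF h(1) k(1)] eps_closed[OF h(1) vV] eps_idem[OF h(1) vV] by simp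
  qed
  then have "eps h v \<in> fix_space G V \<pi> B" using eps_closed[OF h(1) vV] by (simp add: fix_space_eps)
  then have "card B \<le> card A" using nz by (intro maximal[OF B]) blast
  moreover have "h \<in> B" using lcos_self[OF h(1) subgroup] by (simp add: B_def)
  moreover have "A \<subseteq> B" by (simp add: B_def)
  moreover have "finite B" using coset_unionsD(2)[OF subgroup B] finite_carrier finite_subset by blast
  ultimately have "A = B" by (intro card_seteq)
  then show False using h(2) \<open>h \<in> B\<close> by simp
qed

definition gs :: "'g list" where "gs = (SOME gs. set gs = A)"
text \<open>Plays the part of the groupoid unit (A,1): it acts as the sum of all (B,1) with A
  contained in B, and maximality of A leaves only one of these.\<close>

definition e :: "'v \<Rightarrow> 'v" where "e = proj gs"

lemma set_gs: "set gs = A"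
  unfolding gs_def using finite_list[OF finite_subset[OF A_subset finite_carrier]]
  by (rule someI_ex)

lemma gs_subset: "set gs \<subseteq> carrier G"
  using A_subset set_gs by simp

lemma e_F: "v \<in> carrier V \<Longrightarrow> e v \<in> F"
  using proj_fix_space[OF gs_subset] by (simp add: e_def set_gs)

lemma e_ident: "v \<in> F \<Longrightarrow> e v = v"
  using proj_fix_space_ident[of v gs] by (simp add: e_def set_gs)

lemma e_hom: "e \<in> LinearCombinations.module_hom complex_field V V"
  unfolding e_def by (rule proj_hom[OF gs_subset])

lemma e_eps:
  assumes "h \<in> carrier G" "v \<in> carrier V"
  shows "e (eps h v) = (if h \<in> A then e v else \<zero>\<^bsub>V\<^esub>)"
proof -
  have "e (eps h v) = eps h (e v)" unfolding e_def by (rule proj_eps[OF gs_subset assms])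
  then show ?thesis
    using eps_F[OF _ e_F[OF assms(2)]] eps_F_outside[OF assms(1) _ e_F[OF assms(2)]] by simp
qed

text \<open>The vector \<pi> h v lies in the range of \<open>eps h\<close>, which \<open>e\<close>
  annihilates.\<close>

lemma e_outside: "h \<in> carrier G \<Longrightarrow> h \<notin> A \<Longrightarrow> v \<in> carrier V \<Longrightarrow> e (\<pi> h v) = \<zero>\<^bsub>V\<^esub>"
  using e_eps[of h "\<pi> h v"] eps_absorb[of h v] closed by simp

text \<open>The correction in \<open>eps_mult\<close> is \<open>eps a\<close>, and \<open>e\<close>
  absorbs it for a in A: behind \<open>e\<close>, multiplication by elements of A on the left is
  genuinely multiplicative.\<close>

lemma e_mult:
  assumes "a \<in> A" "h \<in> carrier G" "v \<in> carrier V"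
  shows "e (\<pi> a (\<pi> h v)) = e (\<pi> (a \<otimes> h) v)"
proof -
  have a: "a \<in> carrier G" using assms A_subset by blast
  have "e (\<pi> a (\<pi> h v)) = e (eps a (\<pi> (a \<otimes> h) v))" using eps_mult[OF a assms(2,3)] by simp
  then show ?thesis using e_eps[OF a closed, of "a \<otimes> h" v] a assms by simp
qed

abbreviation K where "K \<equiv> stabilizer_set G A"

lemma K_iff: "k \<in> K \<longleftrightarrow> k \<in> carrier G \<and> k <# A = A"
  by (simp add: stabilizer_set_def)

lemma K_subset_A:
  assumes "k \<in> K"
  shows "k \<in> A"
proof -
  have "k \<otimes> \<one> \<in> k <# A" using coset_unionsD(3)[OF subgroup object] by (auto simp: l_coset_def)
  then show ?thesis using assms by (simp add: K_iff)
qed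

lemma hom_K: "k \<in> K \<Longrightarrow> v \<in> F \<Longrightarrow> \<pi> k v \<in> F"
  using hom_fix_space[OF A_subset, of v k] by (simp add: K_iff)

lemma group_rep_W: "group_rep (stabilizer_group G A) W \<pi>"
proof -
  have "e \<in> LinearCombinations.module_hom complex_field V W"
    using module_homD[OF e_hom] e_F by (intro module_homI) auto
  moreover have "e ` carrier V = carrier W"
    using e_F e_ident F_carrier by (force simp: image_iff)
  ultimately have "fd_vector_space W"
    by (rule fd_vector_space_image[OF fd_vector_space vectorspace_W])
  moreover have "\<pi> k \<in> LinearCombinations.module_hom complex_field W W" if "k \<in> K" for k
    using module_homD[OF hom, of k] that hom_K[OF that] F_carrier
    by (intro module_homI) (auto simp: K_iff)
  moreover have "\<pi> (k \<otimes> l) v = \<pi> k (\<pi> l v)" if k: "k \<in> K" and l: "l \<in> K" and v: "v \<in> F" for k l v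
  proof -
    have kG: "k \<in> carrier G" "l \<in> carrier G" using k l by (auto simp: K_iff)
    have "k \<otimes> l <# A = k <# (l <# A)" using lcos_m_assoc[OF A_subset kG] by simp
    then have kl: "k \<otimes> l \<in> K" using k l by (simp add: K_iff)
    \<comment> \<open>For k in the stabilizer the correction \<open>eps k\<close> is trivial on F,
      because k lies in A.\<close>
    have "\<pi> k (\<pi> l v) = eps k (\<pi> (k \<otimes> l) v)" using eps_mult kG F_carrier[OF v] by simp
    then show ?thesis using eps_F[OF K_subset_A[OF k] hom_K[OF kl v]] by simp
  qed
  ultimately show ?thesis
    using one F_carrier by (simp add: group_rep_def stabilizer_group_def)
qed

sublocale S: stabilizer_rep G H A W \<pi>
  by (intro stabilizer_rep.intro stabilizer_rep_axioms.intro group_axioms finite_carrier subgroup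
      object group_rep_W)

text \<open>The Frobenius reciprocity map. An equivariant map into the model is determined by its
  value at \<one>, here \<open>e v\<close>, and equivariance for \<open>inv x\<close> forces the
  value at x.\<close>

definition \<theta> :: "'v \<Rightarrow> 'g \<Rightarrow> 'v" where
  "\<theta> v x = (if x \<in> S.D then e (\<pi> (inv x) v) else \<zero>\<^bsub>V\<^esub>)"

text \<open>Left multiplication by k permutes A, so it only reorders the idempotents composing
  \<open>e\<close>.\<close>

lemma e_hom_K:
  assumes k: "k \<in> K" and v: "v \<in> carrier V"
  shows "\<pi> k (e v) = e (\<pi> k v)"
proof -
  have kG: "k \<in> carrier G" using k by (simp add: K_iff)
  have *: "set (map ((\<otimes>) k) gs) = set gs" using k by (auto simp: set_gs K_iff l_coset_def)
  have "\<pi> k (e v) = proj (map ((\<otimes>) k) gs) (\<pi> k v)"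
    unfolding e_def by (rule hom_proj[OF kG gs_subset v])
  also have "\<dots> = e (\<pi> k v)"
    unfolding e_def using * gs_subset by (intro proj_cong closed[OF kG v]) auto
  finally show ?thesis .
qed

lemma \<theta>_closed:
  assumes v: "v \<in> carrier V"
  shows "\<theta> v \<in> carrier S.M"
  unfolding S.M_carrier
proof (intro conjI allI impI ballI)
  show "\<theta> v x \<in> carrier W" for x
    using e_F[OF closed[OF _ v]] F_zero S.D_closed by (simp add: \<theta>_def)
  show "\<theta> v x = \<zero>\<^bsub>W\<^esub>" if "x \<notin> S.D" for x using that by (simp add: \<theta>_def)
  fix x k assume x: "x \<in> S.D" and k: "k \<in> K"
  note xG = S.D_closed[OF x] and kG = S.K_closed[OF k] and k' = S.K_inv[OF k]
  have "\<pi> (inv k) (e (\<pi> (inv x) v)) = e (\<pi> (inv k) (\<pi> (inv x) v))"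
    using e_hom_K[OF k' closed[OF _ v]] xG by simp
  also have "\<dots> = e (\<pi> (inv k \<otimes> inv x) v)"
    using e_mult[OF K_subset_A[OF k'] _ v] xG by simp
  finally show "\<theta> v (x \<otimes> k) = \<pi> (inv k) (\<theta> v x)"
    using x S.D_mult_K[OF x k] xG kG by (simp add: \<theta>_def inv_mult_group)
qed

lemma \<theta>_hom: "\<theta> \<in> LinearCombinations.module_hom complex_field V S.M"
proof (rule module_homI)
  fix u v assume uv: "u \<in> carrier V" "v \<in> carrier V"
  show "\<theta> (u \<oplus>\<^bsub>V\<^esub> v) = \<theta> u \<oplus>\<^bsub>S.M\<^esub> \<theta> v"
  proof
    fix x show "\<theta> (u \<oplus>\<^bsub>V\<^esub> v) x = (\<theta> u \<oplus>\<^bsub>S.M\<^esub> \<theta> v) x"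
      using module_homD(2)[OF hom[of "inv x"] uv] module_homD(2)[OF e_hom closed closed, OF _ uv(1) _ uv(2)]
        S.W_add_zero(1)[OF S.W_zero] S.D_closed
      by (simp add: \<theta>_def)
  qed
next
  fix c v assume v: "v \<in> carrier V"
  show "\<theta> (c \<odot>\<^bsub>V\<^esub> v) = c \<odot>\<^bsub>S.M\<^esub> \<theta> v"
  proof
    fix x show "\<theta> (c \<odot>\<^bsub>V\<^esub> v) x = (c \<odot>\<^bsub>S.M\<^esub> \<theta> v) x"
      using module_homD(3)[OF hom[of "inv x"] v] module_homD(3)[OF e_hom closed, OF _ v]
        S.W_smult_zero(1) S.D_closed
      by (simp add: \<theta>_def)
  qed
qed (rule \<theta>_closed)

text \<open>On \<open>D\<close> the left value is \<open>e\<close> applied to \<pi> (x^-1 g) v. If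
  x^-1 g lies outside A then \<open>e\<close> kills this, and exactly then the translation in the
  model is cut off.\<close>

lemma \<theta>_equivariant:
  assumes g: "g \<in> carrier G" and v: "v \<in> carrier V"
  shows "\<theta> (\<pi> g v) = S.\<tau> g (\<theta> v)"
proof
  fix x
  show "\<theta> (\<pi> g v) x = S.\<tau> g (\<theta> v) x"
  proof (cases "x \<in> S.D")
    case True
    note xG = S.D_closed[OF True]
    have *: "\<theta> (\<pi> g v) x = e (\<pi> (inv x \<otimes> g) v)"
      using e_mult[OF _ g v, of "inv x"] True by (simp add: \<theta>_def S.D_iff)
    show ?thesis
    proof (cases "inv x \<otimes> g \<in> A")
      case A: True
      then show ?thesis
        using * True S.inv_mult_D[OF g xG] g xG by (simp add: coind_action_def \<theta>_def inv_mult_group)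
    next
      case False
      then show ?thesis
        using * True S.inv_mult_D[OF g xG] e_outside[OF _ False v] g xG by (simp add: coind_action_def)
    qed
  qed (simp add: \<theta>_def coind_action_def)
qed

lemma \<theta>_F:
  assumes v: "v \<in> F"
  shows "\<theta> v = S.\<delta> \<one> v"
proof
  fix x
  note vV = F_carrier[OF v]
  consider "x \<notin> S.D" | "x \<in> K" | "x \<in> S.D" "x \<notin> K" by blast
  then show "\<theta> v x = S.\<delta> \<one> v x"
  proof cases
    case 1
    then have "x \<notin> K" using S.K_subset_D by blast
    then show ?thesis using 1 S.\<delta>_one_eq_zero[of x v] by (simp add: \<theta>_def)
  next
    case 2
    then show ?thesis
      using S.K_subset_D S.K_closed e_ident[OF hom_K[OF S.K_inv v]] by (simp add: \<theta>_def S.\<delta>_eq)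
  next
    case 3
    note xG = S.D_closed[OF 3(1)]
    \<comment> \<open>Since x is not in \<open>K\<close>, some a is moved out of A by x^-1. The
      vector \<pi> (x^-1) v is fixed by the idempotent at x^-1 a, which \<open>e\<close>
      annihilates.\<close>
    obtain a where a: "a \<in> A" "inv x \<otimes> a \<notin> A" using S.K_I[OF xG] 3(2) by blast
    have aG: "a \<in> carrier G" using a(1) A_subset by blast
    have "eps (inv x \<otimes> a) (\<pi> (inv x) v) = \<pi> (inv x) v"
      using hom_eps[OF _ aG vV, of "inv x"] eps_F[OF a(1) v] xG by simp
    then have "e (\<pi> (inv x) v) = \<zero>\<^bsub>V\<^esub>"
      using e_eps[of "inv x \<otimes> a" "\<pi> (inv x) v"] a aG xG closed[OF _ vV] by simp
    then show ?thesis using 3 S.\<delta>_one_eq_zero[of x v] by (simp add: \<theta>_def)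
  qed
qed

lemma stable_subspace:
  assumes U: "VectorSpace.subspace complex_field U V"
    and "\<And>g u. g \<in> carrier G \<Longrightarrow> u \<in> U \<Longrightarrow> \<pi> g u \<in> U"
  shows "U = {\<zero>\<^bsub>V\<^esub>} \<or> U = carrier V"
  using irreducible assms unfolding irreducible_action_def by simp

lemma preimage_subspace:
  assumes U: "VectorSpace.subspace complex_field U W"
  shows "VectorSpace.subspace complex_field {v \<in> carrier V. \<forall>x. \<theta> v x \<in> U} V"
proof -
  interpret V: vectorspace complex_field V by (rule vectorspace)
  note UD = subspaceD[OF U, simplified]
  show ?thesis
  proof (rule subspaceI[OF vectorspace])
    show "\<zero>\<^bsub>V\<^esub> \<in> {v \<in> carrier V. \<forall>x. \<theta> v x \<in> U}"
      using module_hom_zero[OF vectorspace S.vectorspace_M \<theta>_hom] UD(2) V.M.zero_closed by simp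
    show "u \<oplus>\<^bsub>V\<^esub> v \<in> {v \<in> carrier V. \<forall>x. \<theta> v x \<in> U}"
      if "u \<in> {v \<in> carrier V. \<forall>x. \<theta> v x \<in> U}" "v \<in> {v \<in> carrier V. \<forall>x. \<theta> v x \<in> U}" for u v
      using that UD(3) module_homD(2)[OF \<theta>_hom] V.M.add.m_closed by simp
    show "c \<odot>\<^bsub>V\<^esub> u \<in> {v \<in> carrier V. \<forall>x. \<theta> v x \<in> U}"
      if "u \<in> {v \<in> carrier V. \<forall>x. \<theta> v x \<in> U}" for c u
      using that UD(4) module_homD(3)[OF \<theta>_hom] V.smult_closed by simp
  qed blast
qed

text \<open>Translation only rearranges the components of a vector or replaces them by zero, so the
  preimage is stable under G. Taking U = 0 yields the kernel of \<theta>; a stable U yields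
  irreducibility of W.\<close>

lemma preimage_stable:
  assumes U: "VectorSpace.subspace complex_field U W"
  shows "{v \<in> carrier V. \<forall>x. \<theta> v x \<in> U} = {\<zero>\<^bsub>V\<^esub>} \<or> {v \<in> carrier V. \<forall>x. \<theta> v x \<in> U} = carrier V"
proof (rule stable_subspace[OF preimage_subspace[OF U]])
  fix g u assume g: "g \<in> carrier G" and u: "u \<in> {v \<in> carrier V. \<forall>x. \<theta> v x \<in> U}"
  then have "\<theta> (\<pi> g u) x \<in> U" for x
    using \<theta>_equivariant[OF g, of u] subspaceD(2)[OF U] by (simp add: coind_action_def)
  then show "\<pi> g u \<in> {v \<in> carrier V. \<forall>x. \<theta> v x \<in> U}" using closed[OF g] u by simp
qed

text \<open>A nonzero w in F has component w at \<one>, so the kernel of \<theta> is a proper stable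
  subspace and vanishes. The image is everything because it contains each
  \<open>\<delta> x w\<close>, as the image of \<pi> x w.\<close>

lemma isomorphic_coind: "isomorphic_actions G V \<pi> S.M S.\<tau>"
proof -
  interpret V: vectorspace complex_field V by (rule vectorspace)
  interpret \<theta>: linear_map complex_field V S.M \<theta>
    by (rule linear_mapI[OF vectorspace S.vectorspace_M \<theta>_hom])
  have zeroW: "VectorSpace.subspace complex_field {\<zero>\<^bsub>V\<^esub>} W"
    using S.W_zero S.W_add_zero(1)[OF S.W_zero] S.W_smult_zero(1)
    by (intro subspaceI[OF vectorspace_W]) auto
  obtain w where w: "w \<in> F" "w \<noteq> \<zero>\<^bsub>V\<^esub>" using nonzero F_zero by blast
  have "\<theta> w \<one> \<noteq> \<zero>\<^bsub>V\<^esub>" using \<theta>_F[OF w(1)] S.\<delta>_diag[OF S.one_D] w by simp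
  then have ker: "{v \<in> carrier V. \<forall>x. \<theta> v x \<in> {\<zero>\<^bsub>V\<^esub>}} = {\<zero>\<^bsub>V\<^esub>}"
    using preimage_stable[OF zeroW] F_carrier[OF w(1)] by blast
  have "inj_on \<theta> (carrier V)"
  proof (rule inj_onI)
    fix u v assume uv: "u \<in> carrier V" "v \<in> carrier V" "\<theta> u = \<theta> v"
    let ?d = "u \<oplus>\<^bsub>V\<^esub> (-1) \<odot>\<^bsub>V\<^esub> v"
    have sv: "(-1) \<odot>\<^bsub>V\<^esub> v \<in> carrier V" using V.smult_closed uv(2) by simp
    have d: "?d \<in> carrier V" using uv(1) sv V.M.add.m_closed by blast
    have "\<theta> ?d x = \<zero>\<^bsub>V\<^esub>" for x
      using module_homD(2)[OF \<theta>_hom uv(1) sv] module_homD(3)[OF \<theta>_hom uv(2), of "-1"] uv(3)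
        S.W_neg[OF S.M_closed[OF \<theta>_closed[OF uv(2)]]]
      by simp
    then have "?d = \<zero>\<^bsub>V\<^esub>" using ker d by blast
    moreover have "\<ominus>\<^bsub>V\<^esub> v = (-1) \<odot>\<^bsub>V\<^esub> v"
      using V.smult_minus_1[OF uv(2)] by (simp add: class_ring_simps)
    ultimately have "u \<ominus>\<^bsub>V\<^esub> v = \<zero>\<^bsub>V\<^esub>" by (simp add: a_minus_def)
    then show "u = v" using V.M.minus_other_side uv by blast
  qed
  moreover have "\<theta> ` carrier V = carrier S.M"
  proof (rule S.\<delta>_span)
    show "VectorSpace.subspace complex_field (\<theta> ` carrier V) S.M"
      using \<theta>.imT_is_subspace by (simp add: \<theta>.im_def)
    fix x w assume x: "x \<in> S.D" and "w \<in> carrier W"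
    then have w: "w \<in> F" by simp
    have "S.\<delta> x w = \<theta> (\<pi> x w)"
      using \<theta>_equivariant[OF S.D_closed[OF x] F_carrier[OF w]] \<theta>_F[OF w] S.\<tau>_\<delta>_one[OF x] w by simp
    then show "S.\<delta> x w \<in> \<theta> ` carrier V" using closed[OF S.D_closed[OF x] F_carrier[OF w]] by blast
  qed
  ultimately show ?thesis
    unfolding isomorphic_actions_def bij_betw_def using \<theta>_hom \<theta>_equivariant by blast
qed

text \<open>A stable U in W pulls back to zero or to all of V. Components of u in U are zero or
  \<pi> (x^-1) u with x in \<open>K\<close>, so u lies in the pullback; and the component of w in F
  at \<one> is w itself.\<close>

lemma irreducible_W: "irreducible_rep (stabilizer_group G A) W \<pi>"
  unfolding irreducible_rep_def irreducible_action_def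
proof (intro conjI allI impI group_rep_W)
  show "carrier W \<noteq> {\<zero>\<^bsub>W\<^esub>}" using nonzero by simp
  fix U assume "VectorSpace.subspace complex_field U W \<and>
    (\<forall>g\<in>carrier (stabilizer_group G A). \<forall>u\<in>U. \<pi> g u \<in> U)"
  then have U: "VectorSpace.subspace complex_field U W"
    and stable: "\<And>k u. k \<in> K \<Longrightarrow> u \<in> U \<Longrightarrow> \<pi> k u \<in> U"
    by (auto simp: stabilizer_group_def)
  note UD = subspaceD[OF U, simplified]
  show "U = {\<zero>\<^bsub>W\<^esub>} \<or> U = carrier W"
    using preimage_stable[OF U]
  proof
    assume *: "{v \<in> carrier V. \<forall>x. \<theta> v x \<in> U} = {\<zero>\<^bsub>V\<^esub>}"
    have "u = \<zero>\<^bsub>V\<^esub>" if u: "u \<in> U" for u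
    proof -
      have uF: "u \<in> F" using UD(1) u by blast
      have "\<theta> u x \<in> U" for x
      proof (cases "x \<in> K")
        case True
        then show ?thesis using \<theta>_F[OF uF] stable[OF S.K_inv u] S.K_closed by (simp add: S.\<delta>_eq)
      next
        case False
        then show ?thesis using \<theta>_F[OF uF] S.\<delta>_one_eq_zero[OF False, of u] UD(2) by simp
      qed
      then show ?thesis using * F_carrier[OF uF] by blast
    qed
    then have "U = {\<zero>\<^bsub>V\<^esub>}" using UD(2) by blast
    then show ?thesis by simp
  next
    assume *: "{v \<in> carrier V. \<forall>x. \<theta> v x \<in> U} = carrier V"
    have "w \<in> U" if w: "w \<in> F" for w
    proof -
      have "\<theta> w \<one> \<in> U" using * F_carrier[OF w] by blast
      then show ?thesis using \<theta>_F[OF w] S.\<delta>_diag[OF S.one_D] w by simp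
    qed
    then have "U = F" using UD(1) by blast
    then show ?thesis by simp
  qed
qed

end

section \<open>Free spaces and linear extension\<close>

lemma lookup_scale_pm [simp]: "Poly_Mapping.lookup (scale_pm c f) x = c * Poly_Mapping.lookup f x"
  by (simp add: scale_pm_def Poly_Mapping.map.rep_eq when_def)

lemma lookup_basis_elt: "Poly_Mapping.lookup (basis_elt x) y = (if x = y then 1 else 0)"
  by (simp add: basis_elt_def lookup_single when_def)

lemma keys_basis_elt [simp]: "Poly_Mapping.keys (basis_elt x) = {x}"
  by (simp add: basis_elt_def)

lemma scale_pm_simps:
  "scale_pm c 0 = 0" "scale_pm 0 f = 0" "scale_pm 1 f = f"
  "scale_pm c (f + g) = scale_pm c f + scale_pm c g"
  "scale_pm c (f - g) = scale_pm c f - scale_pm c g"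
  "scale_pm (c + d) f = scale_pm c f + scale_pm d f"
  "scale_pm c (scale_pm d f) = scale_pm (c * d) f"
  "scale_pm (- 1) f = - f"
  by (rule poly_mapping_eqI; simp add: lookup_add lookup_minus algebra_simps)+

lemma scale_pm_sum: "scale_pm c (sum \<phi> B) = (\<Sum>x\<in>B. scale_pm c (\<phi> x))"
  by (rule poly_mapping_eqI) (simp add: lookup_sum sum_distrib_left)

lemma keys_scale_pm: "Poly_Mapping.keys (scale_pm c f) \<subseteq> Poly_Mapping.keys f"
  by (auto simp: in_keys_iff)

lemma keys_minus: "Poly_Mapping.keys (f - g) \<subseteq> Poly_Mapping.keys f \<union> Poly_Mapping.keys (g :: 'x \<Rightarrow>\<^sub>0 complex)"
  by (auto simp: in_keys_iff lookup_minus)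

lemma keys_sum_subset:
  "(\<And>x. x \<in> B \<Longrightarrow> Poly_Mapping.keys (\<phi> x) \<subseteq> S) \<Longrightarrow> Poly_Mapping.keys (sum \<phi> B) \<subseteq> S"
proof (induction B rule: infinite_finite_induct)
  case (insert x B)
  then show ?case using keys_add[of "\<phi> x" "sum \<phi> B"] by auto
qed auto

lemma lin_ext_superset:
  "finite B \<Longrightarrow> Poly_Mapping.keys f \<subseteq> B \<Longrightarrow>
    lin_ext \<phi> f = (\<Sum>x\<in>B. scale_pm (Poly_Mapping.lookup f x) (\<phi> x))"
  unfolding lin_ext_def by (rule sum.mono_neutral_left) (auto simp: in_keys_iff scale_pm_simps)

lemma lin_ext_add: "lin_ext \<phi> (f + g) = lin_ext \<phi> f + lin_ext \<phi> g"
proof -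
  let ?B = "Poly_Mapping.keys f \<union> Poly_Mapping.keys g"
  have "lin_ext \<phi> h = (\<Sum>x\<in>?B. scale_pm (Poly_Mapping.lookup h x) (\<phi> x))"
    if "Poly_Mapping.keys h \<subseteq> ?B" for h
    by (rule lin_ext_superset) (use that in auto)
  then show ?thesis by (simp add: keys_add lookup_add scale_pm_simps sum.distrib)
qed

lemma lin_ext_scale: "lin_ext \<phi> (scale_pm c f) = scale_pm c (lin_ext \<phi> f)"
proof -
  have "lin_ext \<phi> (scale_pm c f) =
      (\<Sum>x\<in>Poly_Mapping.keys f. scale_pm (Poly_Mapping.lookup (scale_pm c f) x) (\<phi> x))"
    by (rule lin_ext_superset) (auto simp: keys_scale_pm)
  then show ?thesis by (simp add: lin_ext_def scale_pm_sum scale_pm_simps)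
qed

lemma lin_ext_zero [simp]: "lin_ext \<phi> 0 = 0"
  by (simp add: lin_ext_def)

lemma lin_ext_basis [simp]: "lin_ext \<phi> (basis_elt x) = \<phi> x"
  by (simp add: lin_ext_def lookup_basis_elt scale_pm_simps)

lemma lin_ext_sum: "lin_ext \<phi> (sum F B) = (\<Sum>x\<in>B. lin_ext \<phi> (F x))"
  by (induction B rule: infinite_finite_induct) (auto simp: lin_ext_add)

lemma lin_ext_fun_add: "lin_ext (\<lambda>x. \<phi> x + \<psi> x) f = lin_ext \<phi> f + lin_ext \<psi> f"
  by (simp add: lin_ext_def scale_pm_simps sum.distrib)

lemma lin_ext_fun_scale: "lin_ext (\<lambda>x. scale_pm c (\<phi> x)) f = scale_pm c (lin_ext \<phi> f)"
  by (simp add: lin_ext_def scale_pm_simps scale_pm_sum mult.commute)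

lemma keys_lin_ext:
  "(\<And>x. x \<in> Poly_Mapping.keys f \<Longrightarrow> Poly_Mapping.keys (\<phi> x) \<subseteq> S) \<Longrightarrow>
    Poly_Mapping.keys (lin_ext \<phi> f) \<subseteq> S"
  unfolding lin_ext_def by (intro keys_sum_subset) (metis subset_trans keys_scale_pm)

lemma poly_mapping_eq_lin_ext: "lin_ext basis_elt f = f"
proof (rule poly_mapping_eqI)
  fix k
  have "(\<Sum>x\<in>Poly_Mapping.keys f. Poly_Mapping.lookup f x * (if x = k then 1 else 0)) =
      Poly_Mapping.lookup f k"
    by (simp add: if_distrib sum.delta in_keys_iff cong: if_cong)
  then show "Poly_Mapping.lookup (lin_ext basis_elt f) k = Poly_Mapping.lookup f k"
    by (simp add: lin_ext_def lookup_sum lookup_basis_elt)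
qed

text \<open>Reduces linear statements about formal sums to basis elements; carrying the bound on the
  keys along keeps every intermediate term in the space with basis S.\<close>

lemma poly_mapping_linear_induct [consumes 1, case_names zero basis add scale]:
  assumes keys: "Poly_Mapping.keys (f :: 'x \<Rightarrow>\<^sub>0 complex) \<subseteq> S"
    and zero: "P 0"
    and basis: "\<And>x. x \<in> S \<Longrightarrow> P (basis_elt x)"
    and add: "\<And>f g. Poly_Mapping.keys f \<subseteq> S \<Longrightarrow> Poly_Mapping.keys g \<subseteq> S \<Longrightarrow> P f \<Longrightarrow> P g \<Longrightarrow> P (f + g)"
    and scale: "\<And>c f. Poly_Mapping.keys f \<subseteq> S \<Longrightarrow> P f \<Longrightarrow> P (scale_pm c f)"
  shows "P f"
proof -
  define F where "F x = scale_pm (Poly_Mapping.lookup f x) (basis_elt x)" for x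
  have F: "P (F x) \<and> Poly_Mapping.keys (F x) \<subseteq> S" if "x \<in> S" for x
  proof
    show "P (F x)" unfolding F_def using scale[OF _ basis[OF that]] that by simp
    show "Poly_Mapping.keys (F x) \<subseteq> S"
      unfolding F_def using keys_scale_pm[of "Poly_Mapping.lookup f x" "basis_elt x"] that by auto
  qed
  have "P (sum F B) \<and> Poly_Mapping.keys (sum F B) \<subseteq> S" if "finite B" "B \<subseteq> S" for B
    using that
  proof (induction B rule: finite_induct)
    case (insert x B)
    then show ?case
      using F[of x] add[of "F x" "sum F B"] keys_add[of "F x" "sum F B"] by auto
  qed (simp add: zero)
  from this[OF finite_keys keys] have "P (sum F (Poly_Mapping.keys f))" ..
  moreover have "sum F (Poly_Mapping.keys f) = f"
    using poly_mapping_eq_lin_ext[of f] unfolding lin_ext_def F_def .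
  ultimately show ?thesis by simp
qed

lemma free_space_simps [simp]:
  "carrier (free_space S) = {f. Poly_Mapping.keys f \<subseteq> S}" "\<zero>\<^bsub>free_space S\<^esub> = 0"
  "f \<oplus>\<^bsub>free_space S\<^esub> g = f + g" "c \<odot>\<^bsub>free_space S\<^esub> f = scale_pm c f"
  by (simp_all add: free_space_def basis_algebra_def)

lemma vectorspace_free_space: "vectorspace complex_field (free_space S)"
proof -
  have "\<exists>g\<in>carrier (free_space S). f \<oplus>\<^bsub>free_space S\<^esub> g = \<zero>\<^bsub>free_space S\<^esub>"
    if "f \<in> carrier (free_space S)" for f
    using that keys_scale_pm[of "-1" f] by (intro bexI[of _ "scale_pm (-1) f"]) (auto simp: scale_pm_simps(8))
  moreover have "Poly_Mapping.keys (f + g) \<subseteq> S"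
    if "Poly_Mapping.keys f \<subseteq> S" "Poly_Mapping.keys g \<subseteq> S" for f g :: "'a \<Rightarrow>\<^sub>0 complex"
    using that keys_add[of f g] by blast
  moreover have "Poly_Mapping.keys (scale_pm c f) \<subseteq> S" if "Poly_Mapping.keys f \<subseteq> S" for c f
    using that keys_scale_pm[of c f] by blast
  ultimately show ?thesis
    by (intro vs_criteria class_field) (simp_all add: scale_pm_simps add_ac)
qed

text \<open>The analogue of \<open>lin_ext\<close> with values in a module given by a carrier: the
  linear map out of a free space prescribed on its basis. The action of the group algebra on W has
  this form.\<close>

definition mod_ext :: "(complex, 'm) module \<Rightarrow> ('x \<Rightarrow> 'm) \<Rightarrow> ('x \<Rightarrow>\<^sub>0 complex) \<Rightarrow> 'm" where
  "mod_ext M \<phi> f = (\<Oplus>\<^bsub>M\<^esub>x\<in>Poly_Mapping.keys f. Poly_Mapping.lookup f x \<odot>\<^bsub>M\<^esub> \<phi> x)"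

context
  fixes M :: "(complex, 'm) module" and \<phi> :: "'x \<Rightarrow> 'm" and S
  assumes M: "vectorspace complex_field M"
    and \<phi>: "\<And>x. x \<in> S \<Longrightarrow> \<phi> x \<in> carrier M"
begin

interpretation M: vectorspace complex_field M by (rule M)

lemma smult_\<phi>: "x \<in> S \<Longrightarrow> c \<odot>\<^bsub>M\<^esub> \<phi> x \<in> carrier M"
  using M.smult_closed[of c "\<phi> x"] \<phi> by simp

lemma mod_ext_superset:
  assumes "finite B" "Poly_Mapping.keys f \<subseteq> B" "B \<subseteq> S"
  shows "mod_ext M \<phi> f = (\<Oplus>\<^bsub>M\<^esub>x\<in>B. Poly_Mapping.lookup f x \<odot>\<^bsub>M\<^esub> \<phi> x)"
  unfolding mod_ext_def
proof (rule M.M.add.finprod_mono_neutral_cong_left[OF assms(1,2)])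
  fix x assume "x \<in> B - Poly_Mapping.keys f"
  then show "Poly_Mapping.lookup f x \<odot>\<^bsub>M\<^esub> \<phi> x = \<zero>\<^bsub>M\<^esub>"
    using M.smult_l_null[of "\<phi> x"] \<phi>[of x] assms(3) by (auto simp: in_keys_iff)
qed (use assms(3) smult_\<phi> in auto)

lemma mod_ext_hom: "mod_ext M \<phi> \<in> LinearCombinations.module_hom complex_field (free_space S) M"
proof (rule module_homI)
  fix f assume "f \<in> carrier (free_space S)"
  then have f: "Poly_Mapping.keys f \<subseteq> S" by simp
  show "mod_ext M \<phi> f \<in> carrier M"
    unfolding mod_ext_def using f smult_\<phi> by (intro M.M.finsum_closed) auto
  fix c
  have "mod_ext M \<phi> (scale_pm c f) =
      (\<Oplus>\<^bsub>M\<^esub>x\<in>Poly_Mapping.keys f. Poly_Mapping.lookup (scale_pm c f) x \<odot>\<^bsub>M\<^esub> \<phi> x)"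
    by (rule mod_ext_superset[OF finite_keys keys_scale_pm f])
  also have "\<dots> = (\<Oplus>\<^bsub>M\<^esub>x\<in>Poly_Mapping.keys f. c \<odot>\<^bsub>M\<^esub> (Poly_Mapping.lookup f x \<odot>\<^bsub>M\<^esub> \<phi> x))"
  proof (rule M.M.finsum_cong')
    fix x assume "x \<in> Poly_Mapping.keys f"
    then have x: "x \<in> S" using f by blast
    show "Poly_Mapping.lookup (scale_pm c f) x \<odot>\<^bsub>M\<^esub> \<phi> x = c \<odot>\<^bsub>M\<^esub> (Poly_Mapping.lookup f x \<odot>\<^bsub>M\<^esub> \<phi> x)"
      using M.smult_assoc1[of c "Poly_Mapping.lookup f x" "\<phi> x"] \<phi>[OF x] by simp
  next
    show "(\<lambda>x. c \<odot>\<^bsub>M\<^esub> (Poly_Mapping.lookup f x \<odot>\<^bsub>M\<^esub> \<phi> x)) \<in> Poly_Mapping.keys f \<rightarrow> carrier M"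
      using f M.smult_closed[of c] smult_\<phi> by auto
  qed simp
  also have "\<dots> = c \<odot>\<^bsub>M\<^esub> mod_ext M \<phi> f"
    unfolding mod_ext_def using f smult_\<phi> by (subst M.finsum_smult) auto
  finally show "mod_ext M \<phi> (c \<odot>\<^bsub>free_space S\<^esub> f) = c \<odot>\<^bsub>M\<^esub> mod_ext M \<phi> f" by simp
next
  fix f g assume "f \<in> carrier (free_space S)" "g \<in> carrier (free_space S)"
  then have fg: "Poly_Mapping.keys f \<subseteq> S" "Poly_Mapping.keys g \<subseteq> S" by auto
  let ?B = "Poly_Mapping.keys f \<union> Poly_Mapping.keys g"
  have eq: "mod_ext M \<phi> h = (\<Oplus>\<^bsub>M\<^esub>x\<in>?B. Poly_Mapping.lookup h x \<odot>\<^bsub>M\<^esub> \<phi> x)"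
    if "Poly_Mapping.keys h \<subseteq> ?B" for h
    by (rule mod_ext_superset) (use fg that in auto)
  have Pi: "(\<lambda>x. Poly_Mapping.lookup h x \<odot>\<^bsub>M\<^esub> \<phi> x) \<in> ?B \<rightarrow> carrier M" for h
    using fg smult_\<phi> by auto
  have "mod_ext M \<phi> (f + g) = (\<Oplus>\<^bsub>M\<^esub>x\<in>?B. Poly_Mapping.lookup (f + g) x \<odot>\<^bsub>M\<^esub> \<phi> x)"
    by (rule eq) (rule keys_add)
  also have "\<dots> =
      (\<Oplus>\<^bsub>M\<^esub>x\<in>?B. Poly_Mapping.lookup f x \<odot>\<^bsub>M\<^esub> \<phi> x \<oplus>\<^bsub>M\<^esub> Poly_Mapping.lookup g x \<odot>\<^bsub>M\<^esub> \<phi> x)"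
  proof (rule M.M.finsum_cong')
    fix x assume "x \<in> ?B"
    then have x: "x \<in> S" using fg by blast
    show "Poly_Mapping.lookup (f + g) x \<odot>\<^bsub>M\<^esub> \<phi> x =
        Poly_Mapping.lookup f x \<odot>\<^bsub>M\<^esub> \<phi> x \<oplus>\<^bsub>M\<^esub> Poly_Mapping.lookup g x \<odot>\<^bsub>M\<^esub> \<phi> x"
      using M.smult_l_distr[of "Poly_Mapping.lookup f x" "Poly_Mapping.lookup g x" "\<phi> x"] \<phi>[OF x]
      by (simp add: lookup_add)
  next
    show "(\<lambda>x. Poly_Mapping.lookup f x \<odot>\<^bsub>M\<^esub> \<phi> x \<oplus>\<^bsub>M\<^esub> Poly_Mapping.lookup g x \<odot>\<^bsub>M\<^esub> \<phi> x) \<in> ?B \<rightarrow> carrier M"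
      using fg smult_\<phi> by (intro Pi_I M.M.add.m_closed) auto
  qed simp
  also have "\<dots> = mod_ext M \<phi> f \<oplus>\<^bsub>M\<^esub> mod_ext M \<phi> g"
    using eq[of f] eq[of g] by (simp add: M.M.finsum_addf[OF Pi Pi])
  finally show "mod_ext M \<phi> (f \<oplus>\<^bsub>free_space S\<^esub> g) = mod_ext M \<phi> f \<oplus>\<^bsub>M\<^esub> mod_ext M \<phi> g" by simp
qed

lemma mod_ext_basis:
  assumes "x \<in> S"
  shows "mod_ext M \<phi> (basis_elt x) = \<phi> x"
proof -
  have "mod_ext M \<phi> (basis_elt x) = 1 \<odot>\<^bsub>M\<^esub> \<phi> x"
    using M.M.finsum_insert[of "{}" x "\<lambda>y. Poly_Mapping.lookup (basis_elt x) y \<odot>\<^bsub>M\<^esub> \<phi> y"]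
      smult_\<phi>[OF assms] by (simp add: mod_ext_def lookup_basis_elt)
  then show ?thesis using M.smult_one[OF \<phi>[OF assms]] by simp
qed

lemmas mod_ext_closed = module_homD(1)[OF mod_ext_hom, simplified]
  and mod_ext_add = module_homD(2)[OF mod_ext_hom, simplified]
  and mod_ext_scale = module_homD(3)[OF mod_ext_hom, simplified]

lemma mod_ext_zero: "mod_ext M \<phi> 0 = \<zero>\<^bsub>M\<^esub>"
  by (simp add: mod_ext_def)

end

lemma free_space_hom_eqI:
  assumes M: "vectorspace complex_field M"
    and h: "h \<in> LinearCombinations.module_hom complex_field (free_space S) M"
    and h': "h' \<in> LinearCombinations.module_hom complex_field (free_space S) M"
    and basis: "\<And>x. x \<in> S \<Longrightarrow> h (basis_elt x) = h' (basis_elt x)"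
    and f: "Poly_Mapping.keys f \<subseteq> S"
  shows "h f = h' f"
  using f
proof (induction rule: poly_mapping_linear_induct)
  case zero
  show ?case
    using module_hom_zero[OF vectorspace_free_space M h] module_hom_zero[OF vectorspace_free_space M h']
    by simp
next
  case (add f g)
  then show ?case using module_homD(2)[OF h, of f g] module_homD(2)[OF h', of f g] by simp
next
  case (scale c f)
  then show ?case using module_homD(3)[OF h, of f c] module_homD(3)[OF h', of f c] by simp
qed (rule basis)

section \<open>Quotients by kernels\<close>

text \<open>The first isomorphism theorem for the cosets of \<open>quotient_space\<close>. The
  quotient receives its vector space structure from M through \<open>transport\<close>.\<close>

locale quotient_by_kernel =
  fixes V :: "(complex, 'v) module" and M :: "(complex, 'm) module" and \<Phi> N
  assumes V: "vectorspace complex_field V"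
    and M: "fd_vector_space M"
    and hom: "\<Phi> \<in> LinearCombinations.module_hom complex_field V M"
    and surj: "\<Phi> ` carrier V = carrier M"
    and N: "N = {v \<in> carrier V. \<Phi> v = \<zero>\<^bsub>M\<^esub>}"
begin

sublocale V: vectorspace complex_field V by (rule V)
sublocale M: vectorspace complex_field M using M by (simp add: fd_vector_space_def)

lemma M': "vectorspace complex_field M" by unfold_locales

interpretation \<Phi>: linear_map complex_field V M \<Phi>
  by (rule linear_mapI[OF V M' hom])

lemma difference:
  assumes "v \<in> carrier V" "u \<in> carrier V"
  shows "v \<ominus>\<^bsub>V\<^esub> u \<in> carrier V" "\<Phi> (v \<ominus>\<^bsub>V\<^esub> u) = \<Phi> v \<ominus>\<^bsub>M\<^esub> \<Phi> u" "v \<ominus>\<^bsub>V\<^esub> u \<oplus>\<^bsub>V\<^esub> u = v"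
proof -
  show "v \<ominus>\<^bsub>V\<^esub> u \<in> carrier V" using assms by (rule V.M.minus_closed)
  show "\<Phi> (v \<ominus>\<^bsub>V\<^esub> u) = \<Phi> v \<ominus>\<^bsub>M\<^esub> \<Phi> u" using assms by (rule \<Phi>.f_minus)
  show "v \<ominus>\<^bsub>V\<^esub> u \<oplus>\<^bsub>V\<^esub> u = v"
    using assms V.M.a_assoc[of v "\<ominus>\<^bsub>V\<^esub> u" u] V.M.l_neg[of u] V.M.a_inv_closed[of u]
    by (simp add: a_minus_def)
qed

text \<open>Elements of a coset differ by the kernel, so cosets are fibres of \<Phi>, and statements
  about cosets become statements about values of \<Phi>.\<close>

lemma coset_eq:
  assumes u: "u \<in> carrier V"
  shows "N +>\<^bsub>V\<^esub> u = {v \<in> carrier V. \<Phi> v = \<Phi> u}"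
proof (rule Set.set_eqI)
  fix v
  show "v \<in> N +>\<^bsub>V\<^esub> u \<longleftrightarrow> v \<in> {v \<in> carrier V. \<Phi> v = \<Phi> u}"
  proof
    assume "v \<in> N +>\<^bsub>V\<^esub> u"
    then obtain n where n: "n \<in> N" "v = n \<oplus>\<^bsub>V\<^esub> u" by (auto simp: a_r_coset_def')
    then have "n \<in> carrier V" "\<Phi> n = \<zero>\<^bsub>M\<^esub>" by (auto simp: N)
    then show "v \<in> {v \<in> carrier V. \<Phi> v = \<Phi> u}"
      using module_homD(2)[OF hom _ u, of n] M.M.l_zero[OF module_homD(1)[OF hom u]] n(2)
        V.M.add.m_closed[OF _ u] by simp
  next
    assume v: "v \<in> {v \<in> carrier V. \<Phi> v = \<Phi> u}"
    then have "\<Phi> v \<ominus>\<^bsub>M\<^esub> \<Phi> u = \<zero>\<^bsub>M\<^esub>"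
      using M.M.r_neg[OF module_homD(1)[OF hom u]] by (simp add: a_minus_def)
    then have "v \<ominus>\<^bsub>V\<^esub> u \<in> N" using difference(1,2)[of v u] u v by (simp add: N)
    then show "v \<in> N +>\<^bsub>V\<^esub> u" using difference(3)[of v u] u v by (auto simp: a_r_coset_def' intro!: bexI[of _ "v \<ominus>\<^bsub>V\<^esub> u"])
  qed
qed

lemma coset_eq_iff:
  assumes "u \<in> carrier V" "v \<in> carrier V"
  shows "N +>\<^bsub>V\<^esub> u = N +>\<^bsub>V\<^esub> v \<longleftrightarrow> \<Phi> u = \<Phi> v"
  unfolding coset_eq[OF assms(1)] coset_eq[OF assms(2)] using assms by auto

abbreviation "Q \<equiv> quotient_space V N"

lemma Q_carrier: "X \<in> carrier Q \<longleftrightarrow> (\<exists>u\<in>carrier V. X = N +>\<^bsub>V\<^esub> u)"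
  by (auto simp: quotient_space_def A_RCOSETS_def')

text \<open>The choice of a representative is harmless because \<Phi> is constant on cosets.\<close>

definition induced_map :: "'v set \<Rightarrow> 'm" where
  "induced_map X = \<Phi> (SOME v. v \<in> X)"

lemma induced_map_coset:
  assumes u: "u \<in> carrier V"
  shows "induced_map (N +>\<^bsub>V\<^esub> u) = \<Phi> u"
proof -
  have "u \<in> N +>\<^bsub>V\<^esub> u" using u by (simp add: coset_eq)
  then have "(SOME v. v \<in> N +>\<^bsub>V\<^esub> u) \<in> N +>\<^bsub>V\<^esub> u" by (rule someI)
  then show ?thesis unfolding coset_eq[OF u] induced_map_def by simp
qed

lemma coset_add:
  assumes u: "u \<in> carrier V" and v: "v \<in> carrier V"
  shows "(N +>\<^bsub>V\<^esub> u) \<oplus>\<^bsub>Q\<^esub> (N +>\<^bsub>V\<^esub> v) = N +>\<^bsub>V\<^esub> (u \<oplus>\<^bsub>V\<^esub> v)"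
proof -
  have uv: "u \<oplus>\<^bsub>V\<^esub> v \<in> carrier V" using u v by (rule V.M.add.m_closed)
  have "(\<exists>a\<in>{a \<in> carrier V. \<Phi> a = \<Phi> u}. \<exists>b\<in>{b \<in> carrier V. \<Phi> b = \<Phi> v}. x = a \<oplus>\<^bsub>V\<^esub> b) \<longleftrightarrow>
      x \<in> carrier V \<and> \<Phi> x = \<Phi> (u \<oplus>\<^bsub>V\<^esub> v)" for x
  proof
    assume "\<exists>a\<in>{a \<in> carrier V. \<Phi> a = \<Phi> u}. \<exists>b\<in>{b \<in> carrier V. \<Phi> b = \<Phi> v}. x = a \<oplus>\<^bsub>V\<^esub> b"
    then show "x \<in> carrier V \<and> \<Phi> x = \<Phi> (u \<oplus>\<^bsub>V\<^esub> v)"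
      using module_homD(2)[OF hom] u v V.M.add.m_closed by auto
  next
    assume x: "x \<in> carrier V \<and> \<Phi> x = \<Phi> (u \<oplus>\<^bsub>V\<^esub> v)"
    note \<Phi>uv = module_homD(1)[OF hom u] module_homD(1)[OF hom v]
    \<comment> \<open>The splitting is x = (x - v) + v; the first summand is shown to lie in the
      coset of u.\<close>
    have "\<Phi> (x \<ominus>\<^bsub>V\<^esub> v) = \<Phi> u \<oplus>\<^bsub>M\<^esub> \<Phi> v \<ominus>\<^bsub>M\<^esub> \<Phi> v"
      using difference(2)[of x v] x v module_homD(2)[OF hom u v] by simp
    also have "\<dots> = \<Phi> u"
      using M.M.a_assoc[OF \<Phi>uv M.M.a_inv_closed[OF \<Phi>uv(2)]] M.M.r_neg[OF \<Phi>uv(2)]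
        M.M.r_zero[OF \<Phi>uv(1)] by (simp add: a_minus_def)
    finally show "\<exists>a\<in>{a \<in> carrier V. \<Phi> a = \<Phi> u}. \<exists>b\<in>{b \<in> carrier V. \<Phi> b = \<Phi> v}. x = a \<oplus>\<^bsub>V\<^esub> b"
      using difference(1,3)[of x v] x v by (intro bexI[of _ "x \<ominus>\<^bsub>V\<^esub> v"] bexI[of _ v]) simp_all
  qed
  then show ?thesis
    unfolding coset_eq[OF u] coset_eq[OF v] coset_eq[OF uv]
    by (simp add: quotient_space_def set_add_def' set_eq_iff)
qed

text \<open>Every representative contributes the same coset to the union defining the scalar
  multiple, and there is at least one representative, namely u.\<close>

lemma coset_smult:
  assumes u: "u \<in> carrier V"
  shows "c \<odot>\<^bsub>Q\<^esub> (N +>\<^bsub>V\<^esub> u) = N +>\<^bsub>V\<^esub> (c \<odot>\<^bsub>V\<^esub> u)"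
proof -
  have cl: "c \<odot>\<^bsub>V\<^esub> x \<in> carrier V" if "x \<in> carrier V" for x using V.smult_closed[of c x] that by simp
  have "N +>\<^bsub>V\<^esub> (c \<odot>\<^bsub>V\<^esub> x) = N +>\<^bsub>V\<^esub> (c \<odot>\<^bsub>V\<^esub> u)" if "x \<in> N +>\<^bsub>V\<^esub> u" for x
    using that u cl module_homD(3)[OF hom] by (simp add: coset_eq)
  then have "(\<Union>x\<in>N +>\<^bsub>V\<^esub> u. N +>\<^bsub>V\<^esub> (c \<odot>\<^bsub>V\<^esub> x)) =
      (\<Union>x\<in>N +>\<^bsub>V\<^esub> u. N +>\<^bsub>V\<^esub> (c \<odot>\<^bsub>V\<^esub> u))"
    by (rule SUP_cong[OF refl])
  moreover have "u \<in> N +>\<^bsub>V\<^esub> u" using u by (simp add: coset_eq)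
  ultimately show ?thesis unfolding quotient_space_def by (simp, blast)
qed

lemma N_coset: "N = N +>\<^bsub>V\<^esub> \<zero>\<^bsub>V\<^esub>"
  using coset_eq[OF V.M.zero_closed] module_hom_zero[OF V M' hom] by (simp add: N)

lemma transport_induced_map: "transport Q M induced_map"
proof
  show "fd_vector_space M" by (rule M)
  show "bij_betw induced_map (carrier Q) (carrier M)"
  proof (rule bij_betwI')
    fix X Y assume "X \<in> carrier Q" "Y \<in> carrier Q"
    then obtain u v where "u \<in> carrier V" "X = N +>\<^bsub>V\<^esub> u" "v \<in> carrier V" "Y = N +>\<^bsub>V\<^esub> v"
      by (auto simp: Q_carrier)
    then show "induced_map X = induced_map Y \<longleftrightarrow> X = Y" by (simp add: induced_map_coset coset_eq_iff)
  next
    fix X assume "X \<in> carrier Q"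
    then show "induced_map X \<in> carrier M"
      using module_homD(1)[OF hom] by (auto simp: Q_carrier induced_map_coset)
  next
    fix m assume "m \<in> carrier M"
    then obtain u where u: "u \<in> carrier V" "m = \<Phi> u" using surj by blast
    then show "\<exists>X\<in>carrier Q. m = induced_map X"
      using Q_carrier induced_map_coset[OF u(1)] by metis
  qed
  have zero: "\<zero>\<^bsub>Q\<^esub> = N +>\<^bsub>V\<^esub> \<zero>\<^bsub>V\<^esub>" using N_coset by (simp add: quotient_space_def)
  show "\<zero>\<^bsub>Q\<^esub> \<in> carrier Q" using zero Q_carrier V.M.zero_closed by blast
  show "induced_map \<zero>\<^bsub>Q\<^esub> = \<zero>\<^bsub>M\<^esub>"
    using zero induced_map_coset[OF V.M.zero_closed] module_hom_zero[OF V M' hom] by simp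
next
  fix X Y assume "X \<in> carrier Q" "Y \<in> carrier Q"
  then obtain u v where u: "u \<in> carrier V" "X = N +>\<^bsub>V\<^esub> u" and v: "v \<in> carrier V" "Y = N +>\<^bsub>V\<^esub> v"
    by (auto simp: Q_carrier)
  note uv = V.M.add.m_closed[OF u(1) v(1)]
  show "X \<oplus>\<^bsub>Q\<^esub> Y \<in> carrier Q"
    using coset_add[OF u(1) v(1)] u(2) v(2) uv Q_carrier by blast
  show "induced_map (X \<oplus>\<^bsub>Q\<^esub> Y) = induced_map X \<oplus>\<^bsub>M\<^esub> induced_map Y"
    using coset_add[OF u(1) v(1)] u v induced_map_coset[OF uv] module_homD(2)[OF hom u(1) v(1)]
    by (simp add: induced_map_coset)
next
  fix c X assume "X \<in> carrier Q"
  then obtain u where u: "u \<in> carrier V" "X = N +>\<^bsub>V\<^esub> u" by (auto simp: Q_carrier)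
  have cu: "c \<odot>\<^bsub>V\<^esub> u \<in> carrier V" using V.smult_closed[of c u] u(1) by simp
  show "c \<odot>\<^bsub>Q\<^esub> X \<in> carrier Q" using coset_smult[OF u(1)] u(2) cu Q_carrier by blast
  show "induced_map (c \<odot>\<^bsub>Q\<^esub> X) = c \<odot>\<^bsub>M\<^esub> induced_map X"
    using coset_smult[OF u(1)] u induced_map_coset[OF cu] module_homD(3)[OF hom u(1)]
    by (simp add: induced_map_coset)
qed

end

section \<open>Comparison of the tensor product with the function model\<close>

context stabilizer_rep begin

abbreviation L :: "(complex, ('g set \<times> 'g) \<Rightarrow>\<^sub>0 complex) module" where
  "L \<equiv> left_ideal_at G H A"
abbreviation gmul (infixl "\<star>" 70) where
  "f \<star> g \<equiv> f \<otimes>\<^bsub>groupoid_algebra G H\<^esub> g"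
abbreviation b :: "'g \<Rightarrow> ('g set \<times> 'g) \<Rightarrow>\<^sub>0 complex" where
  "b x \<equiv> basis_elt (A, x)"

lemma gmul_eq: "f \<star> g = lin_ext (\<lambda>x. lin_ext (\<lambda>y.
    case gpd_mult G x y of None \<Rightarrow> 0 | Some z \<Rightarrow> basis_elt z) g) f"
  by (simp add: groupoid_algebra_def basis_algebra_def)

lemma gmul_linear:
  "(f + f') \<star> g = f \<star> g + f' \<star> g" "scale_pm c f \<star> g = scale_pm c (f \<star> g)" "0 \<star> g = 0"
  "f \<star> (g + g') = f \<star> g + f \<star> g'" "f \<star> scale_pm c g = scale_pm c (f \<star> g)" "f \<star> 0 = 0"
  "sum F B \<star> g = (\<Sum>x\<in>B. F x \<star> g)"
proof -
  have "lin_ext (\<lambda>x. 0 :: ('g set \<times> 'g) \<Rightarrow>\<^sub>0 complex) f = 0"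
    by (simp add: lin_ext_def scale_pm_simps)
  then show "f \<star> 0 = 0" by (simp add: gmul_eq)
qed (simp_all only: gmul_eq lin_ext_add lin_ext_scale lin_ext_zero lin_ext_fun_add
      lin_ext_fun_scale lin_ext_sum)

lemma gmul_basis: "basis_elt (B, g) \<star> basis_elt (C, h) = (if B = h <# C then basis_elt (C, g \<otimes> h) else 0)"
  by (simp add: gmul_eq)

text \<open>Right multiplication by (A,1) keeps the basis arrows with source A and kills all others,
  since (B,g)(A,1) is defined only for B = A.\<close>

lemma L_carrier: "carrier L = {f. Poly_Mapping.keys f \<subseteq> {A} \<times> D}"
proof (rule Set.set_eqI)
  fix f
  let ?C = "coset_groupoid G H"
  have C: "carrier (groupoid_algebra G H) = {f. Poly_Mapping.keys f \<subseteq> ?C}"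
    by (simp add: groupoid_algebra_def basis_algebra_def)
  have sub: "Poly_Mapping.keys (h \<star> b \<one>) \<subseteq> {A} \<times> D" if "Poly_Mapping.keys h \<subseteq> ?C" for h
    using that
  proof (induction rule: poly_mapping_linear_induct)
    case (basis x)
    then show ?case
      using lcos_mult_one[OF A_subset]
      by (cases x) (auto simp: gmul_basis coset_groupoid_def D_iff)
  next
    case (add f g)
    show ?case
      unfolding gmul_linear using keys_add[of "f \<star> b \<one>" "g \<star> b \<one>"] add(3,4) by blast
  next
    case (scale c f)
    show ?case unfolding gmul_linear by (rule subset_trans[OF keys_scale_pm scale(2)])
  qed (simp add: gmul_linear)
  have id: "h \<star> b \<one> = h" if "Poly_Mapping.keys h \<subseteq> {A} \<times> D" for h
    using that
  proof (induction rule: poly_mapping_linear_induct)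
    case (basis x)
    then show ?case
      using lcos_mult_one[OF A_subset] by (cases x) (auto simp: gmul_basis D_iff)
  qed (simp_all add: gmul_linear)
  have "{A} \<times> D \<subseteq> ?C" using object by (auto simp: coset_groupoid_def D_iff)
  then have "f \<in> {h \<star> b \<one> | h. Poly_Mapping.keys h \<subseteq> ?C} \<longleftrightarrow> Poly_Mapping.keys f \<subseteq> {A} \<times> D"
    using sub id[of f, symmetric] by blast
  then show "f \<in> carrier L \<longleftrightarrow> f \<in> {f. Poly_Mapping.keys f \<subseteq> {A} \<times> D}"
    by (simp add: left_ideal_at_def C)
qed

lemma L_simps: "f \<oplus>\<^bsub>L\<^esub> f' = f + f'" "c \<odot>\<^bsub>L\<^esub> f = scale_pm c f"
  by (simp_all add: left_ideal_at_def groupoid_algebra_def basis_algebra_def)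

lemma L_induct [consumes 1, case_names zero basis add scale]:
  assumes "m \<in> carrier L" "P 0" "\<And>x. x \<in> D \<Longrightarrow> P (b x)"
    "\<And>m m'. m \<in> carrier L \<Longrightarrow> m' \<in> carrier L \<Longrightarrow> P m \<Longrightarrow> P m' \<Longrightarrow> P (m + m')"
    "\<And>c m. m \<in> carrier L \<Longrightarrow> P m \<Longrightarrow> P (scale_pm c m)"
  shows "P m"
  using assms(1)[unfolded L_carrier, simplified]
  by (induction rule: poly_mapping_linear_induct) (use assms in \<open>auto simp: L_carrier\<close>)

lemma L_basis: "x \<in> D \<Longrightarrow> b x \<in> carrier L"
  by (simp add: L_carrier)

lemma L_add: "m \<in> carrier L \<Longrightarrow> m' \<in> carrier L \<Longrightarrow> m + m' \<in> carrier L"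
  using keys_add[of m m'] by (auto simp: L_carrier)

lemma L_scale: "m \<in> carrier L \<Longrightarrow> scale_pm c m \<in> carrier L"
  using keys_scale_pm[of c m] by (auto simp: L_carrier)

lemma L_zero: "0 \<in> carrier L"
  by (simp add: L_carrier)

lemma M_hom_rules:
  "\<lbrakk>f1 \<in> carrier M; f2 \<in> carrier M; f3 \<in> carrier M; f4 \<in> carrier M\<rbrakk> \<Longrightarrow>
    f1 \<oplus>\<^bsub>M\<^esub> f2 \<oplus>\<^bsub>M\<^esub> (f3 \<oplus>\<^bsub>M\<^esub> f4) = f1 \<oplus>\<^bsub>M\<^esub> f3 \<oplus>\<^bsub>M\<^esub> (f2 \<oplus>\<^bsub>M\<^esub> f4)"
  "\<lbrakk>f1 \<in> carrier M; f2 \<in> carrier M\<rbrakk> \<Longrightarrow> c \<odot>\<^bsub>M\<^esub> (f1 \<oplus>\<^bsub>M\<^esub> f2) = c \<odot>\<^bsub>M\<^esub> f1 \<oplus>\<^bsub>M\<^esub> c \<odot>\<^bsub>M\<^esub> f2"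
  "f1 \<in> carrier M \<Longrightarrow> c \<odot>\<^bsub>M\<^esub> (d \<odot>\<^bsub>M\<^esub> f1) = d \<odot>\<^bsub>M\<^esub> (c \<odot>\<^bsub>M\<^esub> f1)"
  "\<zero>\<^bsub>M\<^esub> \<oplus>\<^bsub>M\<^esub> \<zero>\<^bsub>M\<^esub> = \<zero>\<^bsub>M\<^esub>" "c \<odot>\<^bsub>M\<^esub> \<zero>\<^bsub>M\<^esub> = \<zero>\<^bsub>M\<^esub>"
proof -
  show "f1 \<oplus>\<^bsub>M\<^esub> f2 \<oplus>\<^bsub>M\<^esub> (f3 \<oplus>\<^bsub>M\<^esub> f4) = f1 \<oplus>\<^bsub>M\<^esub> f3 \<oplus>\<^bsub>M\<^esub> (f2 \<oplus>\<^bsub>M\<^esub> f4)"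
    if "f1 \<in> carrier M" "f2 \<in> carrier M" "f3 \<in> carrier M" "f4 \<in> carrier M"
  proof -
    interpret M: vectorspace complex_field M by (rule vectorspace_M)
    note cl = that M.M.add.m_closed
    have "f1 \<oplus>\<^bsub>M\<^esub> f2 \<oplus>\<^bsub>M\<^esub> (f3 \<oplus>\<^bsub>M\<^esub> f4) = f1 \<oplus>\<^bsub>M\<^esub> (f2 \<oplus>\<^bsub>M\<^esub> f3 \<oplus>\<^bsub>M\<^esub> f4)"
      using M.M.a_assoc[of f1 f2 "f3 \<oplus>\<^bsub>M\<^esub> f4"] M.M.a_assoc[of f2 f3 f4] cl by metis
    also have "\<dots> = f1 \<oplus>\<^bsub>M\<^esub> (f3 \<oplus>\<^bsub>M\<^esub> f2 \<oplus>\<^bsub>M\<^esub> f4)" using M.M.a_comm[of f2 f3] cl by metis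
    also have "\<dots> = f1 \<oplus>\<^bsub>M\<^esub> f3 \<oplus>\<^bsub>M\<^esub> (f2 \<oplus>\<^bsub>M\<^esub> f4)"
      using M.M.a_assoc[of f1 f3 "f2 \<oplus>\<^bsub>M\<^esub> f4"] M.M.a_assoc[of f3 f2 f4] cl by metis
    finally show ?thesis .
  qed
  show "c \<odot>\<^bsub>M\<^esub> (f1 \<oplus>\<^bsub>M\<^esub> f2) = c \<odot>\<^bsub>M\<^esub> f1 \<oplus>\<^bsub>M\<^esub> c \<odot>\<^bsub>M\<^esub> f2" if "f1 \<in> carrier M" "f2 \<in> carrier M"
    using W_smult_distrib[OF M_closed M_closed, OF that] by simp
  show "c \<odot>\<^bsub>M\<^esub> (d \<odot>\<^bsub>M\<^esub> f1) = d \<odot>\<^bsub>M\<^esub> (c \<odot>\<^bsub>M\<^esub> f1)" if "f1 \<in> carrier M"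
    using W_smult_assoc[OF M_closed[OF that], of c d] W_smult_assoc[OF M_closed[OF that], of d c]
    by (simp add: mult.commute)
  show "\<zero>\<^bsub>M\<^esub> \<oplus>\<^bsub>M\<^esub> \<zero>\<^bsub>M\<^esub> = \<zero>\<^bsub>M\<^esub>" by (simp add: W_add_zero(1)[OF W_zero])
  show "c \<odot>\<^bsub>M\<^esub> \<zero>\<^bsub>M\<^esub> = \<zero>\<^bsub>M\<^esub>" by (simp add: W_smult_zero(1))
qed

text \<open>The balanced bilinear map that will represent the tensor product; the pair of (A,x) and
  w goes to \<open>\<delta> x w\<close>. In the left ideal the object in a key is always A, so only
  the second component is read.\<close>

definition \<beta> :: "(('g set \<times> 'g) \<Rightarrow>\<^sub>0 complex) \<Rightarrow> 'w \<Rightarrow> 'g \<Rightarrow> 'w" where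
  "\<beta> m w = mod_ext M (\<lambda>y. \<delta> (snd y) w) m"

definition \<Phi> :: "((('g set \<times> 'g) \<Rightarrow>\<^sub>0 complex) \<times> 'w \<Rightarrow>\<^sub>0 complex) \<Rightarrow> 'g \<Rightarrow> 'w" where
  "\<Phi> F = mod_ext M (\<lambda>(m, w). \<beta> m w) F"

context
  fixes w assumes w: "w \<in> carrier W"
begin

lemma \<beta>_aux: "y \<in> {A} \<times> D \<Longrightarrow> \<delta> (snd y) w \<in> carrier M"
  using \<delta>_closed[OF _ w] by auto

lemma \<beta>_closed: "m \<in> carrier L \<Longrightarrow> \<beta> m w \<in> carrier M"
  unfolding \<beta>_def L_carrier by (rule mod_ext_closed[OF vectorspace_M \<beta>_aux]) auto

lemma \<beta>_add_left: "m \<in> carrier L \<Longrightarrow> m' \<in> carrier L \<Longrightarrow> \<beta> (m + m') w = \<beta> m w \<oplus>\<^bsub>M\<^esub> \<beta> m' w"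
  unfolding \<beta>_def L_carrier by (rule mod_ext_add[OF vectorspace_M \<beta>_aux]) auto

lemma \<beta>_scale_left: "m \<in> carrier L \<Longrightarrow> \<beta> (scale_pm c m) w = c \<odot>\<^bsub>M\<^esub> \<beta> m w"
  unfolding \<beta>_def L_carrier by (rule mod_ext_scale[OF vectorspace_M \<beta>_aux]) auto

lemma \<beta>_zero_left: "\<beta> 0 w = \<zero>\<^bsub>M\<^esub>"
  unfolding \<beta>_def by (rule mod_ext_zero[OF vectorspace_M \<beta>_aux])

lemma \<beta>_basis: "x \<in> D \<Longrightarrow> \<beta> (b x) w = \<delta> x w"
  unfolding \<beta>_def using mod_ext_basis[OF vectorspace_M \<beta>_aux, where x = "(A, x)"] by simp

end

text \<open>Linearity in m is built into \<beta>; linearity in w has to be inferred from that of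
  \<delta>, by induction on m.\<close>

lemma \<beta>_add_right:
  assumes m: "m \<in> carrier L" and w: "w \<in> carrier W" "w' \<in> carrier W"
  shows "\<beta> m (w \<oplus>\<^bsub>W\<^esub> w') = \<beta> m w \<oplus>\<^bsub>M\<^esub> \<beta> m w'"
  using m
proof (induction rule: L_induct)
  case zero
  show ?case
    unfolding \<beta>_zero_left[OF w(1)] \<beta>_zero_left[OF w(2)] \<beta>_zero_left[OF W_add[OF w]] M_hom_rules(4) ..
next
  case (basis x)
  show ?case
    unfolding \<beta>_basis[OF w(1) basis] \<beta>_basis[OF w(2) basis] \<beta>_basis[OF W_add[OF w] basis]
    by (rule \<delta>_add[OF basis w])
next
  case (add m m')
  show ?case
    unfolding \<beta>_add_left[OF w(1) add(1,2)] \<beta>_add_left[OF w(2) add(1,2)]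
      \<beta>_add_left[OF W_add[OF w] add(1,2)] add(3,4)
    by (rule M_hom_rules(1)[OF \<beta>_closed \<beta>_closed \<beta>_closed \<beta>_closed]) (use w add in auto)
next
  case (scale c m)
  show ?case
    unfolding \<beta>_scale_left[OF w(1) scale(1)] \<beta>_scale_left[OF w(2) scale(1)]
      \<beta>_scale_left[OF W_add[OF w] scale(1)] scale(2)
    by (rule M_hom_rules(2)[OF \<beta>_closed \<beta>_closed]) (use w scale in auto)
qed

lemma \<beta>_scale_right:
  assumes m: "m \<in> carrier L" and w: "w \<in> carrier W"
  shows "\<beta> m (c \<odot>\<^bsub>W\<^esub> w) = c \<odot>\<^bsub>M\<^esub> \<beta> m w"
  using m
proof (induction rule: L_induct)
  case zero
  show ?case unfolding \<beta>_zero_left[OF w] \<beta>_zero_left[OF W_smult[OF w]] M_hom_rules(5) ..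
next
  case (basis x)
  show ?case unfolding \<beta>_basis[OF w basis] \<beta>_basis[OF W_smult[OF w] basis] by (rule \<delta>_smult[OF basis w])
next
  case (add m m')
  show ?case
    unfolding \<beta>_add_left[OF w add(1,2)] \<beta>_add_left[OF W_smult[OF w] add(1,2)] add(3,4)
    by (rule M_hom_rules(2)[OF \<beta>_closed \<beta>_closed, symmetric]) (use w add in auto)
next
  case (scale d m)
  show ?case
    unfolding \<beta>_scale_left[OF w scale(1)] \<beta>_scale_left[OF W_smult[OF w] scale(1)] scale(2)
    by (rule M_hom_rules(3)[OF \<beta>_closed[OF w scale(1)]])
qed

section \<open>The group algebra of the stabilizer acting on both tensor factors\<close>

abbreviation "R \<equiv> group_algebra (stabilizer_group G A)"
abbreviation "ra \<equiv> right_corner_action G H A"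
abbreviation "la \<equiv> group_algebra_action W \<rho>"

lemma R_carrier: "carrier R = {r. Poly_Mapping.keys r \<subseteq> K}"
  by (simp add: group_algebra_def basis_algebra_def stabilizer_group_def)

lemma ra_linear:
  "ra (m + m') r = ra m r + ra m' r" "ra (scale_pm c m) r = scale_pm c (ra m r)" "ra 0 r = 0"
  "ra m (r + r') = ra m r + ra m r'" "ra m (scale_pm c r) = scale_pm c (ra m r)" "ra m 0 = 0"
  by (simp_all add: right_corner_action_def corner_embed_def gmul_linear lin_ext_add lin_ext_scale)

text \<open>The product of (A,x) and (A,k) is defined because k A = A.\<close>

lemma ra_basis: "k \<in> K \<Longrightarrow> ra (b x) (basis_elt k) = b (x \<otimes> k)"
  by (simp add: right_corner_action_def corner_embed_def gmul_basis K_iff)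

lemma ra_basis_closed: "m \<in> carrier L \<Longrightarrow> k \<in> K \<Longrightarrow> ra m (basis_elt k) \<in> carrier L"
  by (induction rule: L_induct)
    (simp_all add: ra_linear ra_basis L_zero L_add L_scale L_basis D_mult_K)

lemma ra_closed: "r \<in> carrier R \<Longrightarrow> m \<in> carrier L \<Longrightarrow> ra m r \<in> carrier L"
  unfolding R_carrier mem_Collect_eq
  by (induction rule: poly_mapping_linear_induct)
    (simp_all add: ra_linear ra_basis_closed L_zero L_add L_scale)

lemma la_eq: "la r w = mod_ext W (\<lambda>k. \<rho> k w) r"
  by (simp add: group_algebra_action_def mod_ext_def)

context
  fixes w assumes w: "w \<in> carrier W"
begin

lemma la_closed: "Poly_Mapping.keys r \<subseteq> K \<Longrightarrow> la r w \<in> carrier W"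
  unfolding la_eq by (rule mod_ext_closed[where S = K, OF vectorspace_W \<rho>_closed[OF _ w]])

lemma la_add: "Poly_Mapping.keys r \<subseteq> K \<Longrightarrow> Poly_Mapping.keys r' \<subseteq> K \<Longrightarrow>
    la (r + r') w = la r w \<oplus>\<^bsub>W\<^esub> la r' w"
  unfolding la_eq by (rule mod_ext_add[where S = K, OF vectorspace_W \<rho>_closed[OF _ w]])

lemma la_scale: "Poly_Mapping.keys r \<subseteq> K \<Longrightarrow> la (scale_pm c r) w = c \<odot>\<^bsub>W\<^esub> la r w"
  unfolding la_eq by (rule mod_ext_scale[where S = K, OF vectorspace_W \<rho>_closed[OF _ w]])

lemma la_zero: "la 0 w = \<zero>\<^bsub>W\<^esub>"
  unfolding la_eq by (rule mod_ext_zero[where S = K, OF vectorspace_W \<rho>_closed[OF _ w]])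

lemma la_basis: "k \<in> K \<Longrightarrow> la (basis_elt k) w = \<rho> k w"
  unfolding la_eq by (rule mod_ext_basis[where S = K, OF vectorspace_W \<rho>_closed[OF _ w]])

end

text \<open>On basis elements this is \<open>\<delta>_mult_K\<close>; linearity extends it here in
  m, and afterwards in the element of the group algebra.\<close>

lemma \<beta>_balanced_basis:
  assumes k: "k \<in> K" and w: "w \<in> carrier W" and m: "m \<in> carrier L"
  shows "\<beta> (ra m (basis_elt k)) w = \<beta> m (\<rho> k w)"
  using m
proof (induction rule: L_induct)
  case zero
  show ?case by (simp only: ra_linear \<beta>_zero_left[OF w] \<beta>_zero_left[OF \<rho>_closed[OF k w]])
next
  case (basis x)
  show ?case
    by (simp only: ra_basis[OF k] \<beta>_basis[OF w D_mult_K[OF basis k]]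
        \<beta>_basis[OF \<rho>_closed[OF k w] basis] \<delta>_mult_K[OF basis k w])
next
  case (add m m')
  show ?case
    by (simp only: ra_linear \<beta>_add_left[OF w ra_basis_closed[OF add(1) k] ra_basis_closed[OF add(2) k]]
        \<beta>_add_left[OF \<rho>_closed[OF k w] add(1,2)] add(3,4))
next
  case (scale c m)
  show ?case
    by (simp only: ra_linear \<beta>_scale_left[OF w ra_basis_closed[OF scale(1) k]]
        \<beta>_scale_left[OF \<rho>_closed[OF k w] scale(1)] scale(2))
qed

lemma \<beta>_balanced:
  assumes r: "r \<in> carrier R" and w: "w \<in> carrier W" and m: "m \<in> carrier L"
  shows "\<beta> (ra m r) w = \<beta> m (la r w)"
  using r[unfolded R_carrier mem_Collect_eq]
proof (induction rule: poly_mapping_linear_induct)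
  case zero
  have "\<beta> m \<zero>\<^bsub>W\<^esub> = \<zero>\<^bsub>M\<^esub>"
    using \<beta>_scale_right[OF m W_zero, of 0] W_smult_zero(2)[OF M_closed[OF \<beta>_closed[OF W_zero m]]]
    by (simp add: W_smult_zero(1))
  then show ?case by (simp only: ra_linear \<beta>_zero_left[OF w] la_zero[OF w])
next
  case (basis k)
  show ?case by (simp only: \<beta>_balanced_basis[OF basis w m] la_basis[OF w basis])
next
  case (add r r')
  have "r \<in> carrier R" "r' \<in> carrier R" using add by (simp_all add: R_carrier)
  then show ?case
    by (simp only: ra_linear \<beta>_add_left[OF w ra_closed[OF _ m] ra_closed[OF _ m]] la_add[OF w add(1,2)]
        \<beta>_add_right[OF m la_closed[OF w add(1)] la_closed[OF w add(2)]] add(3,4))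
next
  case (scale c r)
  have "r \<in> carrier R" using scale by (simp add: R_carrier)
  then show ?case
    by (simp only: ra_linear \<beta>_scale_left[OF w ra_closed[OF _ m]] la_scale[OF w scale(1)]
        \<beta>_scale_right[OF m la_closed[OF w scale(1)]] scale(2))
qed

section \<open>The tensor relations and the kernel of \<Phi>\<close>

abbreviation "P \<equiv> carrier L \<times> carrier W"
abbreviation "N \<equiv> tensor_kernel R L ra W la"
abbreviation "rels \<equiv> tensor_relations R L ra W la"

lemma \<Phi>_aux: "p \<in> P \<Longrightarrow> (\<lambda>(m, w). \<beta> m w) p \<in> carrier M"
  using \<beta>_closed by auto

lemma \<Phi>_hom: "\<Phi> \<in> LinearCombinations.module_hom complex_field (free_space P) M"
proof -
  have "\<Phi> = mod_ext M (\<lambda>(m, w). \<beta> m w)" by (rule ext) (rule \<Phi>_def)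
  then show ?thesis by (simp only: mod_ext_hom[where S = P, OF vectorspace_M \<Phi>_aux])
qed

lemmas \<Phi>_closed = module_homD(1)[OF \<Phi>_hom, simplified]
  and \<Phi>_add = module_homD(2)[OF \<Phi>_hom, unfolded free_space_simps mem_Collect_eq]
  and \<Phi>_scale = module_homD(3)[OF \<Phi>_hom, unfolded free_space_simps mem_Collect_eq]

lemma \<Phi>_basis: "m \<in> carrier L \<Longrightarrow> w \<in> carrier W \<Longrightarrow> \<Phi> (basis_elt (m, w)) = \<beta> m w"
  unfolding \<Phi>_def using mod_ext_basis[OF vectorspace_M \<Phi>_aux, where x = "(m, w)"] by simp

lemma \<Phi>_diff_eq_zero:
  assumes "Poly_Mapping.keys F \<subseteq> P" "Poly_Mapping.keys F' \<subseteq> P" "\<Phi> F = \<Phi> F'"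
  shows "Poly_Mapping.keys (F - F') \<subseteq> P" "\<Phi> (F - F') = \<zero>\<^bsub>M\<^esub>"
proof -
  show "Poly_Mapping.keys (F - F') \<subseteq> P" using keys_minus[of F F'] assms by blast
  have F': "Poly_Mapping.keys (scale_pm (-1) F') \<subseteq> P" using keys_scale_pm[of "-1" F'] assms(2) by blast
  have "\<Phi> (F - F') = \<Phi> (F + scale_pm (-1) F')" by (simp add: scale_pm_simps(8))
  also have "\<dots> = \<Phi> F \<oplus>\<^bsub>M\<^esub> (-1) \<odot>\<^bsub>M\<^esub> \<Phi> F"
    unfolding \<Phi>_add[OF assms(1) F'] \<Phi>_scale[OF assms(2)] assms(3) ..
  also have "\<dots> = \<zero>\<^bsub>M\<^esub>" using W_neg[OF M_closed[OF \<Phi>_closed[OF assms(1)]]] by simp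
  finally show "\<Phi> (F - F') = \<zero>\<^bsub>M\<^esub>" .
qed

text \<open>Each relation is put in the form of a single difference, so that vanishing under \<Phi>
  becomes equality of two values, as \<open>\<Phi>_diff_eq_zero\<close> expects.\<close>

lemma relation_cases:
  assumes "F \<in> rels"
  obtains
    (add_left) m m' w where "m \<in> carrier L" "m' \<in> carrier L" "w \<in> carrier W"
      "F = basis_elt (m + m', w) - (basis_elt (m, w) + basis_elt (m', w))"
  | (add_right) m w w' where "m \<in> carrier L" "w \<in> carrier W" "w' \<in> carrier W"
      "F = basis_elt (m, w \<oplus>\<^bsub>W\<^esub> w') - (basis_elt (m, w) + basis_elt (m, w'))"
  | (scale_left) c m w where "m \<in> carrier L" "w \<in> carrier W"
      "F = basis_elt (scale_pm c m, w) - scale_pm c (basis_elt (m, w))"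
  | (scale_right) c m w where "m \<in> carrier L" "w \<in> carrier W"
      "F = basis_elt (m, c \<odot>\<^bsub>W\<^esub> w) - scale_pm c (basis_elt (m, w))"
  | (balanced) m r w where "m \<in> carrier L" "r \<in> carrier R" "w \<in> carrier W"
      "F = basis_elt (ra m r, w) - basis_elt (m, la r w)"
  using assms unfolding tensor_relations_def L_simps Un_iff mem_Collect_eq diff_diff_eq by blast

lemma basis_P: "m \<in> carrier L \<Longrightarrow> w \<in> carrier W \<Longrightarrow> Poly_Mapping.keys (basis_elt (m, w)) \<subseteq> P"
  by simp

lemma add_P: "Poly_Mapping.keys F \<subseteq> P \<Longrightarrow> Poly_Mapping.keys F' \<subseteq> P \<Longrightarrow> Poly_Mapping.keys (F + F') \<subseteq> P"
  using keys_add[of F F'] by blast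

lemma scale_P: "Poly_Mapping.keys F \<subseteq> P \<Longrightarrow> Poly_Mapping.keys (scale_pm c F) \<subseteq> P"
  using keys_scale_pm[of c F] by blast

lemma relation_kernel:
  assumes "F \<in> rels"
  shows "Poly_Mapping.keys F \<subseteq> P \<and> \<Phi> F = \<zero>\<^bsub>M\<^esub>"
  using assms
proof (cases rule: relation_cases)
  case (add_left m m' w)
  note p = basis_P[OF L_add[OF add_left(1,2)] add_left(3)] basis_P[OF add_left(1,3)]
    basis_P[OF add_left(2,3)]
  have "\<Phi> (basis_elt (m + m', w)) = \<Phi> (basis_elt (m, w) + basis_elt (m', w))"
    unfolding \<Phi>_add[OF p(2,3)] \<Phi>_basis[OF L_add[OF add_left(1,2)] add_left(3)]
      \<Phi>_basis[OF add_left(1,3)] \<Phi>_basis[OF add_left(2,3)]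
    by (rule \<beta>_add_left[OF add_left(3,1,2)])
  then show ?thesis unfolding add_left(4) using \<Phi>_diff_eq_zero[OF p(1) add_P[OF p(2,3)]] by blast
next
  case (add_right m w w')
  note p = basis_P[OF add_right(1) W_add[OF add_right(2,3)]] basis_P[OF add_right(1,2)]
    basis_P[OF add_right(1,3)]
  have "\<Phi> (basis_elt (m, w \<oplus>\<^bsub>W\<^esub> w')) = \<Phi> (basis_elt (m, w) + basis_elt (m, w'))"
    unfolding \<Phi>_add[OF p(2,3)] \<Phi>_basis[OF add_right(1) W_add[OF add_right(2,3)]]
      \<Phi>_basis[OF add_right(1,2)] \<Phi>_basis[OF add_right(1,3)]
    by (rule \<beta>_add_right[OF add_right(1-3)])
  then show ?thesis unfolding add_right(4) using \<Phi>_diff_eq_zero[OF p(1) add_P[OF p(2,3)]] by blast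
next
  case (scale_left c m w)
  note p = basis_P[OF L_scale[OF scale_left(1)] scale_left(2)] basis_P[OF scale_left(1,2)]
  have "\<Phi> (basis_elt (scale_pm c m, w)) = \<Phi> (scale_pm c (basis_elt (m, w)))"
    unfolding \<Phi>_scale[OF p(2)] \<Phi>_basis[OF L_scale[OF scale_left(1)] scale_left(2)]
      \<Phi>_basis[OF scale_left(1,2)]
    by (rule \<beta>_scale_left[OF scale_left(2,1)])
  then show ?thesis unfolding scale_left(3) using \<Phi>_diff_eq_zero[OF p(1) scale_P[OF p(2)]] by blast
next
  case (scale_right c m w)
  note p = basis_P[OF scale_right(1) W_smult[OF scale_right(2)]] basis_P[OF scale_right(1,2)]
  have "\<Phi> (basis_elt (m, c \<odot>\<^bsub>W\<^esub> w)) = \<Phi> (scale_pm c (basis_elt (m, w)))"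
    unfolding \<Phi>_scale[OF p(2)] \<Phi>_basis[OF scale_right(1) W_smult[OF scale_right(2)]]
      \<Phi>_basis[OF scale_right(1,2)]
    by (rule \<beta>_scale_right[OF scale_right(1,2)])
  then show ?thesis unfolding scale_right(3) using \<Phi>_diff_eq_zero[OF p(1) scale_P[OF p(2)]] by blast
next
  case (balanced m r w)
  have la: "la r w \<in> carrier W" using la_closed[OF balanced(3)] balanced(2) by (simp add: R_carrier)
  note p = basis_P[OF ra_closed[OF balanced(2,1)] balanced(3)] basis_P[OF balanced(1) la]
  have "\<Phi> (basis_elt (ra m r, w)) = \<Phi> (basis_elt (m, la r w))"
    unfolding \<Phi>_basis[OF ra_closed[OF balanced(2,1)] balanced(3)] \<Phi>_basis[OF balanced(1) la]
    by (rule \<beta>_balanced[OF balanced(2,3,1)])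
  then show ?thesis unfolding balanced(4) using \<Phi>_diff_eq_zero[OF p(1,2)] by blast
qed

lemma rels_subset: "rels \<subseteq> carrier (free_space P)"
  using relation_kernel by auto

lemma N_subspace: "VectorSpace.subspace complex_field N (free_space P)"
proof -
  interpret F: vectorspace complex_field "free_space P" by (rule vectorspace_free_space)
  show ?thesis unfolding tensor_kernel_def by (rule F.span_is_subspace[OF rels_subset])
qed

lemma rels_N: "F \<in> rels \<Longrightarrow> F \<in> N"
proof -
  interpret F: vectorspace complex_field "free_space P" by (rule vectorspace_free_space)
  show "F \<in> rels \<Longrightarrow> F \<in> N"
    unfolding tensor_kernel_def using F.in_own_span[OF rels_subset] by blast
qed

text \<open>\<Phi> respects every relation, so its kernel contains their span. The reverse inclusion
  is the substantial one and comes from a section.\<close>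

lemma N_kernel: "F \<in> N \<Longrightarrow> Poly_Mapping.keys F \<subseteq> P \<and> \<Phi> F = \<zero>\<^bsub>M\<^esub>"
proof -
  interpret F: vectorspace complex_field "free_space P" by (rule vectorspace_free_space)
  interpret \<Phi>: linear_map complex_field "free_space P" M \<Phi>
    by (rule linear_mapI[OF vectorspace_free_space vectorspace_M \<Phi>_hom])
  have "submodule complex_field \<Phi>.ker (free_space P)"
    using \<Phi>.kerT_is_subspace by (simp add: VectorSpace.subspace_def)
  moreover have "rels \<subseteq> \<Phi>.ker" using relation_kernel by (auto simp: \<Phi>.ker_def)
  ultimately have "N \<subseteq> \<Phi>.ker" unfolding tensor_kernel_def by (intro F.span_is_subset)
  then show "F \<in> N \<Longrightarrow> Poly_Mapping.keys F \<subseteq> P \<and> \<Phi> F = \<zero>\<^bsub>M\<^esub>" by (auto simp: \<Phi>.ker_def)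
qed

lemma N_zero: "0 \<in> N"
  and N_add: "F \<in> N \<Longrightarrow> F' \<in> N \<Longrightarrow> F + F' \<in> N"
  and N_scale: "F \<in> N \<Longrightarrow> scale_pm c F \<in> N"
  using subspaceD[OF N_subspace] by simp_all

lemma N_minus: "F \<in> N \<Longrightarrow> F' \<in> N \<Longrightarrow> F - F' \<in> N"
  using N_add[of F "scale_pm (-1) F'"] N_scale[of F' "-1"] by (simp add: scale_pm_simps(8))

lemma N_sum: "(\<And>x. x \<in> B \<Longrightarrow> F x \<in> N) \<Longrightarrow> sum F B \<in> N"
  by (induction B rule: infinite_finite_induct) (auto simp: N_zero N_add)

lemma N_add_left: "m \<in> carrier L \<Longrightarrow> m' \<in> carrier L \<Longrightarrow> w \<in> carrier W \<Longrightarrow>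
    basis_elt (m + m', w) - basis_elt (m, w) - basis_elt (m', w) \<in> N"
  and N_add_right: "m \<in> carrier L \<Longrightarrow> w \<in> carrier W \<Longrightarrow> w' \<in> carrier W \<Longrightarrow>
    basis_elt (m, w \<oplus>\<^bsub>W\<^esub> w') - basis_elt (m, w) - basis_elt (m, w') \<in> N"
  and N_scale_left: "m \<in> carrier L \<Longrightarrow> w \<in> carrier W \<Longrightarrow>
    basis_elt (scale_pm c m, w) - scale_pm c (basis_elt (m, w)) \<in> N"
  and N_scale_right: "m \<in> carrier L \<Longrightarrow> w \<in> carrier W \<Longrightarrow>
    basis_elt (m, c \<odot>\<^bsub>W\<^esub> w) - scale_pm c (basis_elt (m, w)) \<in> N"
  and N_balanced: "m \<in> carrier L \<Longrightarrow> r \<in> carrier R \<Longrightarrow> w \<in> carrier W \<Longrightarrow>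
    basis_elt (ra m r, w) - basis_elt (m, la r w) \<in> N"
  by (rule rels_N; unfold tensor_relations_def L_simps; blast)+

lemma N_zero_right:
  assumes "m \<in> carrier L"
  shows "basis_elt (m, \<zero>\<^bsub>W\<^esub>) \<in> N"
  using N_scale_right[OF assms W_zero, of 0] by (simp add: W_smult_zero(1) scale_pm_simps)

lemma N_zero_left:
  assumes "w \<in> carrier W"
  shows "basis_elt (0, w) \<in> N"
  using N_scale_left[OF L_zero assms, of 0] by (simp add: scale_pm_simps)

text \<open>A section of \<open>\<Phi>\<close> modulo \<open>N\<close>. Averaging over the whole coset \<open>x K\<^sub>A\<close> instead of choosing
  a representative is what requires division by \<open>card K\<close>.\<close>

definition sec :: "('g \<Rightarrow> 'w) \<Rightarrow> ((('g set \<times> 'g) \<Rightarrow>\<^sub>0 complex) \<times> 'w \<Rightarrow>\<^sub>0 complex)" where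
  "sec f = (\<Sum>x\<in>D. scale_pm (1 / of_nat (card K)) (basis_elt (b x, f x)))"

text \<open>The pairs (b x, w) are formal basis elements, so \<open>sec\<close> is additive only
  modulo the relations in w, applied at every x.\<close>

lemma sec_add:
  assumes f: "f \<in> carrier M" "f' \<in> carrier M"
  shows "sec (f \<oplus>\<^bsub>M\<^esub> f') - sec f - sec f' \<in> N"
proof -
  have eq: "sec (f \<oplus>\<^bsub>M\<^esub> f') - sec f - sec f' = (\<Sum>x\<in>D. scale_pm (1 / of_nat (card K))
      (basis_elt (b x, f x \<oplus>\<^bsub>W\<^esub> f' x) - basis_elt (b x, f x) - basis_elt (b x, f' x)))"
    by (simp only: sec_def M_simps scale_pm_simps sum_subtractf)
  show ?thesis unfolding eq by (intro N_sum N_scale N_add_right L_basis M_closed f)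
qed

lemma sec_scale:
  assumes f: "f \<in> carrier M"
  shows "sec (c \<odot>\<^bsub>M\<^esub> f) - scale_pm c (sec f) \<in> N"
proof -
  have eq: "sec (c \<odot>\<^bsub>M\<^esub> f) - scale_pm c (sec f) = (\<Sum>x\<in>D. scale_pm (1 / of_nat (card K))
      (basis_elt (b x, c \<odot>\<^bsub>W\<^esub> f x) - scale_pm c (basis_elt (b x, f x))))"
    by (simp only: sec_def M_simps scale_pm_simps scale_pm_sum sum_subtractf mult.commute)
  show ?thesis unfolding eq by (intro N_sum N_scale N_scale_right L_basis M_closed f)
qed

text \<open>This is not the zero of the free space but a combination of formal pairs with second
  entry zero, each of which follows from the relations.\<close>

lemma sec_zero: "sec \<zero>\<^bsub>M\<^esub> \<in> N"
  unfolding sec_def M_simps by (intro N_sum N_scale N_zero_right L_basis)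

lemma card_coset_K:
  assumes y: "y \<in> D"
  shows "card {x \<in> D. inv y \<otimes> x \<in> K} = card K"
proof -
  note yG = D_closed[OF y]
  have "(\<otimes>) y ` K = {x \<in> D. inv y \<otimes> x \<in> K}"
  proof (intro equalityI subsetI)
    fix x assume "x \<in> (\<otimes>) y ` K"
    then obtain k where k: "k \<in> K" "x = y \<otimes> k" by blast
    then have "inv y \<otimes> x = k" using yG K_closed[OF k(1)] by (simp flip: m_assoc)
    then show "x \<in> {x \<in> D. inv y \<otimes> x \<in> K}" using k D_mult_K[OF y k(1)] by simp
  next
    fix x assume "x \<in> {x \<in> D. inv y \<otimes> x \<in> K}"
    then show "x \<in> (\<otimes>) y ` K" using mem_coset_K(1)[OF yG, of x] D_closed[of x] by blast
  qed
  moreover have "inj_on ((\<otimes>) y) K" using yG K_closed by (auto intro!: inj_onI)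
  ultimately show ?thesis using card_image by metis
qed

lemma card_K: "card K \<noteq> 0"
proof -
  have "finite K" using finite_subset[OF _ finite_carrier] K_closed by blast
  then show ?thesis using K_one by auto
qed

lemma sum_constant_scale: "finite S \<Longrightarrow> (\<Sum>x\<in>S. F) = scale_pm (of_nat (card S)) F"
  by (induction S rule: finite_induct) (simp_all add: scale_pm_simps)

text \<open>Modulo N only the points of y K contribute, and by balancing each of them contributes b
  y tensor w. There are \<open>card K\<close> such points, which the factor in \<open>sec\<close>
  compensates.\<close>

lemma sec_\<delta>:
  assumes y: "y \<in> D" and w: "w \<in> carrier W"
  shows "sec (\<delta> y w) - basis_elt (b y, w) \<in> N"
proof -
  note yG = D_closed[OF y]
  let ?B = "basis_elt (b y, w)" and ?c = "1 / of_nat (card K) :: complex"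
  have term_N: "basis_elt (b x, \<delta> y w x) - (if inv y \<otimes> x \<in> K then ?B else 0) \<in> N" if x: "x \<in> D" for x
  proof (cases "inv y \<otimes> x \<in> K")
    case True
    note m = mem_coset_K[OF yG D_closed[OF x] True]
    \<comment> \<open>The stabilizer element x^-1 y carries b x to b y on the left factor and w to
      \<open>\<delta> y w x\<close> on the right one.\<close>
    have "ra (b x) (basis_elt (inv x \<otimes> y)) = b y"
      using ra_basis[OF m(3), of x] yG D_closed[OF x] by (simp flip: m_assoc)
    moreover have "la (basis_elt (inv x \<otimes> y)) w = \<delta> y w x"
      using la_basis[OF w m(3)] \<delta>_eq[OF yG D_closed[OF x] True] by simp
    moreover have "basis_elt (inv x \<otimes> y) \<in> carrier R" using m(3) by (simp add: R_carrier)
    ultimately have "?B - basis_elt (b x, \<delta> y w x) \<in> N"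
      using N_balanced[OF L_basis[OF x] _ w, of "basis_elt (inv x \<otimes> y)"] by simp
    then show ?thesis using True N_minus[OF N_zero, of "?B - basis_elt (b x, \<delta> y w x)"] by simp
  next
    case False
    then show ?thesis using \<delta>_eq_zero[of y x w] N_zero_right[OF L_basis[OF x]] by simp
  qed
  have "(\<Sum>x\<in>D. scale_pm ?c (if inv y \<otimes> x \<in> K then ?B else 0)) =
      scale_pm ?c (\<Sum>x\<in>{x \<in> D. inv y \<otimes> x \<in> K}. ?B)"
    using sum.inter_filter[OF finite_D, of "\<lambda>_. ?B" "\<lambda>x. inv y \<otimes> x \<in> K"]
    by (simp add: scale_pm_sum)
  also have "\<dots> = ?B"
    using card_K finite_D by (simp add: sum_constant_scale card_coset_K[OF y] scale_pm_simps)
  finally have eq: "sec (\<delta> y w) - ?B = (\<Sum>x\<in>D. scale_pm ?c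
      (basis_elt (b x, \<delta> y w x) - (if inv y \<otimes> x \<in> K then ?B else 0)))"
    by (simp only: sec_def scale_pm_simps sum_subtractf)
  show ?thesis unfolding eq by (intro N_sum N_scale term_N)
qed

lemma sec_\<beta>:
  assumes m: "m \<in> carrier L" and w: "w \<in> carrier W"
  shows "sec (\<beta> m w) - basis_elt (m, w) \<in> N"
  using m
proof (induction rule: L_induct)
  case zero
  show ?case unfolding \<beta>_zero_left[OF w] by (rule N_minus[OF sec_zero N_zero_left[OF w]])
next
  case (basis x)
  show ?case unfolding \<beta>_basis[OF w basis] by (rule sec_\<delta>[OF basis w])
next
  case (add m m')
  note s = sec_add[OF \<beta>_closed[OF w add(1)] \<beta>_closed[OF w add(2)]]
  have "sec (\<beta> m w \<oplus>\<^bsub>M\<^esub> \<beta> m' w) - basis_elt (m + m', w) =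
      (sec (\<beta> m w \<oplus>\<^bsub>M\<^esub> \<beta> m' w) - sec (\<beta> m w) - sec (\<beta> m' w)) +
      (sec (\<beta> m w) - basis_elt (m, w)) + (sec (\<beta> m' w) - basis_elt (m', w)) -
      (basis_elt (m + m', w) - basis_elt (m, w) - basis_elt (m', w))"
    by (simp add: algebra_simps)
  then show ?case
    unfolding \<beta>_add_left[OF w add(1,2)]
    using N_minus[OF N_add[OF N_add[OF s add(3)] add(4)] N_add_left[OF add(1,2) w]] by metis
next
  case (scale c m)
  have "sec (c \<odot>\<^bsub>M\<^esub> \<beta> m w) - basis_elt (scale_pm c m, w) =
      (sec (c \<odot>\<^bsub>M\<^esub> \<beta> m w) - scale_pm c (sec (\<beta> m w))) +
      scale_pm c (sec (\<beta> m w) - basis_elt (m, w)) -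
      (basis_elt (scale_pm c m, w) - scale_pm c (basis_elt (m, w)))"
    by (simp add: algebra_simps scale_pm_simps)
  then show ?case
    unfolding \<beta>_scale_left[OF w scale(1)]
    using N_minus[OF N_add[OF sec_scale[OF \<beta>_closed[OF w scale(1)]] N_scale[OF scale(2)]]
        N_scale_left[OF scale(1) w]] by metis
qed

lemma sec_\<Phi>:
  assumes F: "Poly_Mapping.keys F \<subseteq> P"
  shows "sec (\<Phi> F) - F \<in> N"
  using F
proof (induction rule: poly_mapping_linear_induct)
  case zero
  have "\<Phi> 0 = \<zero>\<^bsub>M\<^esub>" using module_hom_zero[OF vectorspace_free_space vectorspace_M \<Phi>_hom] by simp
  then show ?case using N_minus[OF sec_zero N_zero] by simp
next
  case (basis p)
  then obtain m w where p: "p = (m, w)" "m \<in> carrier L" "w \<in> carrier W" by auto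
  show ?case unfolding p(1) \<Phi>_basis[OF p(2,3)] by (rule sec_\<beta>[OF p(2,3)])
next
  case (add F F')
  have "sec (\<Phi> F \<oplus>\<^bsub>M\<^esub> \<Phi> F') - (F + F') = (sec (\<Phi> F \<oplus>\<^bsub>M\<^esub> \<Phi> F') - sec (\<Phi> F) - sec (\<Phi> F')) +
      (sec (\<Phi> F) - F) + (sec (\<Phi> F') - F')"
    by (simp add: algebra_simps)
  then show ?case
    unfolding \<Phi>_add[OF add(1,2)]
    using N_add[OF N_add[OF sec_add[OF \<Phi>_closed[OF add(1)] \<Phi>_closed[OF add(2)]] add(3)] add(4)] by metis
next
  case (scale c F)
  have "sec (c \<odot>\<^bsub>M\<^esub> \<Phi> F) - scale_pm c F = (sec (c \<odot>\<^bsub>M\<^esub> \<Phi> F) - scale_pm c (sec (\<Phi> F))) +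
      scale_pm c (sec (\<Phi> F) - F)"
    by (simp add: algebra_simps scale_pm_simps)
  then show ?case
    unfolding \<Phi>_scale[OF scale(1)]
    using N_add[OF sec_scale[OF \<Phi>_closed[OF scale(1)]] N_scale[OF scale(2)]] by metis
qed

text \<open>If \<Phi> F vanishes, then \<open>sec_\<Phi>\<close> makes F congruent to
  \<open>sec\<close> of the zero function, which lies in N.\<close>

lemma N_eq: "N = {F \<in> carrier (free_space P). \<Phi> F = \<zero>\<^bsub>M\<^esub>}"
proof (intro equalityI subsetI)
  fix F assume "F \<in> N"
  then show "F \<in> {F \<in> carrier (free_space P). \<Phi> F = \<zero>\<^bsub>M\<^esub>}" using N_kernel by simp
next
  fix F assume "F \<in> {F \<in> carrier (free_space P). \<Phi> F = \<zero>\<^bsub>M\<^esub>}"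
  then have "sec \<zero>\<^bsub>M\<^esub> - F \<in> N" using sec_\<Phi>[of F] by simp
  then show "F \<in> N" using N_minus[OF sec_zero, of "sec \<zero>\<^bsub>M\<^esub> - F"] by simp
qed

lemma \<Phi>_surj: "\<Phi> ` carrier (free_space P) = carrier M"
proof (rule \<delta>_span)
  interpret \<Phi>: linear_map complex_field "free_space P" M \<Phi>
    by (rule linear_mapI[OF vectorspace_free_space vectorspace_M \<Phi>_hom])
  show "VectorSpace.subspace complex_field (\<Phi> ` carrier (free_space P)) M"
    using \<Phi>.imT_is_subspace by (simp only: \<Phi>.im_def)
  fix x w assume x: "x \<in> D" and w: "w \<in> carrier W"
  have "\<delta> x w = \<Phi> (basis_elt (b x, w))"
    unfolding \<Phi>_basis[OF L_basis[OF x] w] \<beta>_basis[OF w x] ..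
  moreover have "basis_elt (b x, w) \<in> carrier (free_space P)" using L_basis[OF x] w by simp
  ultimately show "\<delta> x w \<in> \<Phi> ` carrier (free_space P)" by (rule image_eqI)
qed

sublocale tensor: quotient_by_kernel "free_space P" M \<Phi> N
  by (intro quotient_by_kernel.intro vectorspace_free_space fd_vector_space_M \<Phi>_hom \<Phi>_surj N_eq)

section \<open>The partial action on the tensor product\<close>

abbreviation "I \<equiv> Ind_space G H A W \<rho>"
abbreviation "\<iota> \<equiv> Ind_action G H A W \<rho>"

lemma Ind_space_eq: "I = quotient_space (free_space P) N"
  by (simp add: Ind_space_def tensor_space_def)

text \<open>Of the sum defining \<open>mu_p\<close> only the summand with source x A composes with
  (A,x). It is present iff g^-1 lies in x A, that is iff (g x)^-1 lies in A.\<close>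

lemma mu_p_basis:
  assumes g: "g \<in> carrier G" and x: "x \<in> D"
  shows "mu_p G H g \<star> b x = (if g \<otimes> x \<in> D then b (g \<otimes> x) else 0)"
proof -
  note xG = D_closed[OF x]
  let ?S = "{B \<in> coset_unions G H. inv g \<in> B}"
  have "coset_unions G H \<subseteq> Pow (carrier G)" using coset_unionsD(2)[OF subgroup] by blast
  then have fin: "finite ?S" using finite_carrier by (simp add: finite_subset)
  have "mu_p G H g \<star> b x = (\<Sum>B\<in>?S. if B = x <# A then b (g \<otimes> x) else 0)"
    by (simp only: mu_p_def gmul_linear(7) gmul_basis)
  also have "\<dots> = (if x <# A \<in> ?S then b (g \<otimes> x) else 0)"
    using fin by (simp add: sum.delta)
  also have "x <# A \<in> ?S \<longleftrightarrow> g \<otimes> x \<in> D"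
    using l_coset_in_coset_unions[OF subgroup object xG] x g xG
    by (simp add: mem_l_coset_iff[OF A_subset xG] D_iff inv_mult_group)
  finally show ?thesis .
qed

context
  fixes g assumes g: "g \<in> carrier G"
begin

lemma mu_p_closed: "m \<in> carrier L \<Longrightarrow> mu_p G H g \<star> m \<in> carrier L"
  by (induction rule: L_induct)
    (simp_all add: mu_p_basis[OF g] gmul_linear L_zero L_add L_scale L_basis)

lemma \<beta>_mu_p:
  assumes w: "w \<in> carrier W" and m: "m \<in> carrier L"
  shows "\<beta> (mu_p G H g \<star> m) w = \<tau> g (\<beta> m w)"
  using m
proof (induction rule: L_induct)
  case zero
  have "\<tau> g \<zero>\<^bsub>M\<^esub> = \<zero>\<^bsub>M\<^esub>" by (rule module_hom_zero[OF vectorspace_M vectorspace_M \<tau>_hom[OF g]])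
  then show ?case by (simp only: gmul_linear \<beta>_zero_left[OF w])
next
  case (basis x)
  have "\<beta> (mu_p G H g \<star> b x) w = (if g \<otimes> x \<in> D then \<delta> (g \<otimes> x) w else \<zero>\<^bsub>M\<^esub>)"
    unfolding mu_p_basis[OF g basis] using \<beta>_basis[OF w, of "g \<otimes> x"] \<beta>_zero_left[OF w] by simp
  then show ?case unfolding \<beta>_basis[OF w basis] \<tau>_\<delta>[OF g basis w] .
next
  case (add m m')
  show ?case
    unfolding gmul_linear \<beta>_add_left[OF w mu_p_closed[OF add(1)] mu_p_closed[OF add(2)]]
      \<beta>_add_left[OF w add(1,2)] module_homD(2)[OF \<tau>_hom[OF g] \<beta>_closed[OF w add(1)] \<beta>_closed[OF w add(2)]]
      add(3,4) ..
next
  case (scale c m)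
  show ?case
    unfolding gmul_linear \<beta>_scale_left[OF w mu_p_closed[OF scale(1)]] \<beta>_scale_left[OF w scale(1)]
      module_homD(3)[OF \<tau>_hom[OF g] \<beta>_closed[OF w scale(1)]] scale(2) ..
qed

text \<open>The action lifted to the free space: the map that \<open>tensor_map_left\<close> applies
  to representatives.\<close>

definition \<Lambda> where "\<Lambda> = lin_ext (\<lambda>(m, w :: 'w). basis_elt (mu_p G H g \<star> m, w))"

lemma \<Lambda>_closed: "Poly_Mapping.keys F \<subseteq> P \<Longrightarrow> Poly_Mapping.keys (\<Lambda> F) \<subseteq> P"
  unfolding \<Lambda>_def using mu_p_closed by (intro keys_lin_ext) auto

lemma \<Phi>_\<Lambda>:
  assumes F: "Poly_Mapping.keys F \<subseteq> P"
  shows "\<Phi> (\<Lambda> F) = \<tau> g (\<Phi> F)"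
proof (rule free_space_hom_eqI[OF vectorspace_M _ _ _ F])
  have "\<Lambda> \<in> LinearCombinations.module_hom complex_field (free_space P) (free_space P)"
    by (intro module_homI) (simp_all add: \<Lambda>_closed, simp_all add: \<Lambda>_def lin_ext_add lin_ext_scale)
  then show "(\<lambda>F. \<Phi> (\<Lambda> F)) \<in> LinearCombinations.module_hom complex_field (free_space P) M"
    by (rule module_hom_comp[OF _ \<Phi>_hom])
  show "(\<lambda>F. \<tau> g (\<Phi> F)) \<in> LinearCombinations.module_hom complex_field (free_space P) M"
    by (rule module_hom_comp[OF \<Phi>_hom \<tau>_hom[OF g]])
  fix p assume "p \<in> P"
  then obtain m w where p: "p = (m, w)" "m \<in> carrier L" "w \<in> carrier W" by auto
  have "\<Lambda> (basis_elt (m, w)) = basis_elt (mu_p G H g \<star> m, w)" by (simp add: \<Lambda>_def)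
  then show "\<Phi> (\<Lambda> (basis_elt p)) = \<tau> g (\<Phi> (basis_elt p))"
    unfolding p(1) using \<Phi>_basis[OF mu_p_closed[OF p(2)] p(3)] \<beta>_mu_p[OF p(3,2)] \<Phi>_basis[OF p(2,3)]
    by (simp only:)
qed

text \<open>By \<open>\<Phi>_\<Lambda>\<close> the lift maps fibres of \<Phi> into fibres, so all
  terms of the union over representatives are one and the same coset.\<close>

lemma Ind_action_coset:
  assumes F: "F \<in> carrier (free_space P)"
  shows "\<iota> g (N +>\<^bsub>free_space P\<^esub> F) = N +>\<^bsub>free_space P\<^esub> \<Lambda> F"
proof -
  have "N +>\<^bsub>free_space P\<^esub> \<Lambda> F' = N +>\<^bsub>free_space P\<^esub> \<Lambda> F" if "F' \<in> N +>\<^bsub>free_space P\<^esub> F" for F'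
  proof -
    have F': "F' \<in> carrier (free_space P)" "\<Phi> F' = \<Phi> F"
      using that unfolding tensor.coset_eq[OF F] by simp_all
    then have "\<Phi> (\<Lambda> F') = \<Phi> (\<Lambda> F)" using \<Phi>_\<Lambda> F by simp
    then show ?thesis using \<Lambda>_closed F F'(1) by (subst tensor.coset_eq_iff) simp_all
  qed
  then have "(\<Union>F'\<in>N +>\<^bsub>free_space P\<^esub> F. N +>\<^bsub>free_space P\<^esub> \<Lambda> F') =
      (\<Union>F'\<in>N +>\<^bsub>free_space P\<^esub> F. N +>\<^bsub>free_space P\<^esub> \<Lambda> F)"
    by (rule SUP_cong[OF refl])
  moreover have "F \<in> N +>\<^bsub>free_space P\<^esub> F" unfolding tensor.coset_eq[OF F] using F by simp
  ultimately show ?thesis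
    unfolding Ind_action_def Ind_module_action_def tensor_map_left_def \<Lambda>_def by (simp only:) blast
qed

lemma Ind_action_equivariant:
  assumes X: "X \<in> carrier I"
  shows "\<iota> g X \<in> carrier I" "tensor.induced_map (\<iota> g X) = \<tau> g (tensor.induced_map X)"
proof -
  obtain F where F: "F \<in> carrier (free_space P)" "X = N +>\<^bsub>free_space P\<^esub> F"
    using X unfolding Ind_space_eq tensor.Q_carrier by blast
  have \<Lambda>F: "\<Lambda> F \<in> carrier (free_space P)" using F(1) \<Lambda>_closed by simp
  show "\<iota> g X \<in> carrier I"
    unfolding Ind_space_eq tensor.Q_carrier F(2) Ind_action_coset[OF F(1)] using \<Lambda>F by blast
  show "tensor.induced_map (\<iota> g X) = \<tau> g (tensor.induced_map X)"
    unfolding F(2) Ind_action_coset[OF F(1)] tensor.induced_map_coset[OF F(1)]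
      tensor.induced_map_coset[OF \<Lambda>F]
    using F(1) \<Phi>_\<Lambda> by simp
qed

end

sublocale Ind: transport I M tensor.induced_map
  unfolding Ind_space_eq by (rule tensor.transport_induced_map)

lemma Ind_isomorphic_M: "isomorphic_actions G I \<iota> M \<tau>"
  by (rule Ind.isomorphic) (simp_all only: Ind_action_equivariant)

lemma M_isomorphic_Ind: "isomorphic_actions G M \<tau> I \<iota>"
  by (rule isomorphic_actions_sym[OF Ind.vectorspace Ind_action_equivariant(1) Ind_isomorphic_M])

lemma irreducible_Ind:
  assumes "irreducible_action (stabilizer_group G A) W \<rho>"
  shows "irreducible_global_partial_rep G H I \<iota>"
  unfolding irreducible_global_partial_rep_def
proof
  show "global_partial_rep G H I \<iota>"
    by (rule Ind.global_partial_rep_transport[where \<pi> = \<tau>])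
      (simp_all only: Ind_action_equivariant group_axioms subgroup.subset[OF subgroup] global_partial_rep_M)
  show "irreducible_action G I \<iota>"
    by (rule Ind.irreducible_action_transport[where \<pi> = \<tau>])
      (simp_all only: Ind_action_equivariant irreducible_M[OF assms])
qed

end

section \<open>The classification\<close>

lemma stabilizer_repI:
  assumes "Group.group G" "finite (carrier G)" "subgroup H G" "A \<in> coset_unions G H"
    and "irreducible_rep (stabilizer_group G A) W \<rho>"
  shows "stabilizer_rep G H A W \<rho>"
  using assms by (intro stabilizer_rep.intro stabilizer_rep_axioms.intro) (simp_all add: irreducible_rep_def)

text \<open>H has all of V as its fixed space, so there is an object of maximal size with nonzero
  fixed space. It is moved along an arrow to the representative of its component; the size does not
  drop and the fixed space stays nonzero.\<close>

lemma maximal_object_exists: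
  fixes G (structure)
  assumes G: "Group.group G" and fin: "finite (carrier G)" and H: "subgroup H G"
    and V: "irreducible_global_partial_rep G H V \<pi>"
    and cover: "\<And>B. B \<in> coset_unions G H \<Longrightarrow> \<exists>A\<in>S. (B, A) \<in> gpd_connected G H"
  shows "\<exists>A\<in>S. maximal_object G V \<pi> H A"
proof -
  interpret G: Group.group G by (rule G)
  interpret V: global_partial_representation G V \<pi> H
    using V H G unfolding irreducible_global_partial_rep_def
    by (intro global_partial_representation.intro partial_representation.intro
        partial_representation_axioms.intro global_partial_representation_axioms.intro)
      (simp_all add: global_partial_rep_def)
  have irr: "irreducible_action G V \<pi>" using V by (simp add: irreducible_global_partial_rep_def)
  let ?C = "{B \<in> coset_unions G H. fix_space G V \<pi> B \<noteq> {\<zero>\<^bsub>V\<^esub>}}"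
  have "H \<in> coset_unions G H"
    using subgroup.subset[OF H] subgroup.m_closed[OF H] by (simp add: G.coset_unions_iff[OF H])
  moreover have "fix_space G V \<pi> H = carrier V" using V.eps_H by (auto simp: V.fix_space_eps)
  ultimately have "H \<in> ?C" using irr by (simp add: irreducible_action_def)
  moreover have finC: "finite ?C"
    using finite_subset[of ?C "Pow (carrier G)"] G.coset_unionsD(2)[OF H] fin by blast
  ultimately have "Max (card ` ?C) \<in> card ` ?C" by (intro Max_in) auto
  then obtain B where B: "B \<in> ?C" "card B = Max (card ` ?C)" by force
  have Bmax: "card B' \<le> card B" if "B' \<in> ?C" for B'
    unfolding B(2) using finC that by (intro Max_ge) auto
  have Bcu: "B \<in> coset_unions G H" using B(1) by simp
  obtain A where A: "A \<in> S" "(B, A) \<in> gpd_connected G H" using cover[OF Bcu] by blast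
  then obtain g where g: "g \<in> carrier G" "inv g \<in> B" "A = g <# B" by (auto simp: G.gpd_connected_iff)
  note BG = G.coset_unionsD(2)[OF H Bcu]
  have Acu: "A \<in> coset_unions G H" unfolding g(3) by (rule G.l_coset_in_coset_unions[OF H Bcu g(1,2)])
  \<comment> \<open>Translating back shows that A is at least as large as B, so it inherits
    maximality.\<close>
  have "B = (\<otimes>) (inv g) ` A" using G.l_coset_inv_cancel[OF BG g(1)] g(3) by (auto simp: l_coset_def)
  moreover have "finite A" using G.coset_unionsD(2)[OF H Acu] fin finite_subset by blast
  ultimately have card: "card B \<le> card A" using card_image_le by metis
  have "\<zero>\<^bsub>V\<^esub> \<in> fix_space G V \<pi> B" by (rule subspaceD(2)[OF V.subspace_fix_space[OF BG]])
  then obtain v where v: "v \<in> fix_space G V \<pi> B" "v \<noteq> \<zero>\<^bsub>V\<^esub>" using B(1) by blast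
  \<comment> \<open>The arrow condition puts \<open>inv g\<close> into B, so the idempotent at
    \<open>inv g\<close> fixes v and \<pi> g cannot kill it.\<close>
  have "\<pi> (inv g) (\<pi> g v) = v" using v(1) g(1,2) by (auto simp: fix_space_def)
  then have "\<pi> g v \<noteq> \<zero>\<^bsub>V\<^esub>" using V.hom_zero[of "inv g"] g(1) v(2) by auto
  moreover have "\<pi> g v \<in> fix_space G V \<pi> A" unfolding g(3) by (rule V.hom_fix_space[OF BG v(1) g(1)])
  ultimately have "fix_space G V \<pi> A \<noteq> {\<zero>\<^bsub>V\<^esub>}" by blast
  then have "maximal_object G V \<pi> H A"
    using fin irr Acu Bmax card
    by (intro maximal_object.intro maximal_object_axioms.intro V.global_partial_representation_axioms)
      (auto intro: order_trans)
  then show ?thesis using A(1) by blast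
qed

theorem theorem3p19:
  fixes G :: "('g, 'b) monoid_scheme"
    and H :: "'g set"
    and c :: "nat \<Rightarrow> nat"
    and \<Gamma> :: "nat \<Rightarrow> nat \<Rightarrow> ('g set \<times> 'g) set"
    and A :: "nat \<Rightarrow> nat \<Rightarrow> 'g set"
  assumes "group G" and "finite (carrier G)" and "subgroup H G"
    and decomposition: "bij_betw (\<lambda>(i, j). \<Gamma> i j) (component_indices G H c) (gpd_components G H)"
    and cardinality: "\<And>i j B. (i, j) \<in> component_indices G H c \<Longrightarrow>
      B \<in> gpd_source ` \<Gamma> i j \<Longrightarrow> card B = i * card H"
    and objects: "\<And>i j. (i, j) \<in> component_indices G H c \<Longrightarrow> A i j \<in> gpd_source ` \<Gamma> i j"
  shows
    "(\<forall>(i, j)\<in>component_indices G H c. \<forall>(W :: (complex, 'w) module) \<rho>.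
        irreducible_rep (stabilizer_group G (A i j)) W \<rho> \<longrightarrow>
        irreducible_global_partial_rep G H
          (Ind_space G H (A i j) W \<rho>) (Ind_action G H (A i j) W \<rho>))
     \<and>
     (\<forall>(i, j)\<in>component_indices G H c. \<forall>(i', j')\<in>component_indices G H c.
        \<forall>(W :: (complex, 'w) module) \<rho> (W' :: (complex, 'w') module) \<rho>'.
        irreducible_rep (stabilizer_group G (A i j)) W \<rho> \<longrightarrow> irreducible_rep (stabilizer_group G (A i' j')) W' \<rho>' \<longrightarrow>
        (isomorphic_actions G
           (Ind_space G H (A i j) W \<rho>) (Ind_action G H (A i j) W \<rho>)
           (Ind_space G H (A i' j') W' \<rho>') (Ind_action G H (A i' j') W' \<rho>')
         \<longleftrightarrow> (i, j) = (i', j') \<and> isomorphic_actions (stabilizer_group G (A i j)) W \<rho> W' \<rho>'))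
     \<and>
     (\<forall>(V :: (complex, 'v) module) \<pi>.
        irreducible_global_partial_rep G H V \<pi> \<longrightarrow>
        (\<exists>(i, j)\<in>component_indices G H c. \<exists>(W :: (complex, 'v) module) \<rho>.
           irreducible_rep (stabilizer_group G (A i j)) W \<rho> \<and>
           isomorphic_actions G V \<pi>
             (Ind_space G H (A i j) W \<rho>) (Ind_action G H (A i j) W \<rho>)))"
proof -
  interpret G: Group.group G by fact
  have object: "A i j \<in> coset_unions G H" if "(i, j) \<in> component_indices G H c" for i j
    by (rule G.component_eq(1)[OF assms(3) decomposition _ that]) (rule objects)
  note rep = stabilizer_repI[OF assms(1-3)]
  have part1: "irreducible_global_partial_rep G H
      (Ind_space G H (A i j) W \<rho>) (Ind_action G H (A i j) W \<rho>)"
    if ij: "(i, j) \<in> component_indices G H c"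
      and W: "irreducible_rep (stabilizer_group G (A i j)) W \<rho>"
    for i j and W :: "(complex, 'w) module" and \<rho>
    using stabilizer_rep.irreducible_Ind[OF rep[OF object[OF ij] W]] W
    by (simp add: irreducible_rep_def)
  have part2: "isomorphic_actions G
        (Ind_space G H (A i j) W \<rho>) (Ind_action G H (A i j) W \<rho>)
        (Ind_space G H (A i' j') W' \<rho>') (Ind_action G H (A i' j') W' \<rho>') \<longleftrightarrow>
      (i, j) = (i', j') \<and> isomorphic_actions (stabilizer_group G (A i j)) W \<rho> W' \<rho>'"
    (is "?iso \<longleftrightarrow> ?iso'")
    if ij: "(i, j) \<in> component_indices G H c" and ij': "(i', j') \<in> component_indices G H c"
      and W: "irreducible_rep (stabilizer_group G (A i j)) W \<rho>"
      and W': "irreducible_rep (stabilizer_group G (A i' j')) W' \<rho>'"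
    for i j i' j' and W :: "(complex, 'w) module" and \<rho> and W' :: "(complex, 'w') module" and \<rho>'
  proof -
    note R = rep[OF object[OF ij] W] and R' = rep[OF object[OF ij'] W']
    have nz: "carrier W \<noteq> {\<zero>\<^bsub>W\<^esub>}" "carrier W' \<noteq> {\<zero>\<^bsub>W'\<^esub>}"
      using W W' by (auto simp: irreducible_rep_def irreducible_action_def)
    let ?model_iso = "isomorphic_actions G
        (coind_space G (A i j) W \<rho>) (coind_action G (A i j) W)
        (coind_space G (A i' j') W' \<rho>') (coind_action G (A i' j') W')"
    \<comment> \<open>Both induced representations are replaced by their models, so the comparison
      takes place between function spaces.\<close>
    have "?iso \<longleftrightarrow> ?model_iso"
      using isomorphic_actions_trans stabilizer_rep.Ind_isomorphic_M[OF R]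
        stabilizer_rep.M_isomorphic_Ind[OF R] stabilizer_rep.Ind_isomorphic_M[OF R']
        stabilizer_rep.M_isomorphic_Ind[OF R'] by metis
    also have "?model_iso \<longleftrightarrow> ?iso'"
    proof
      assume iso: ?model_iso
      \<comment> \<open>An isomorphism of models joins the two chosen objects by an arrow, and each
        component has only one chosen object.\<close>
      have "(i', j') = (i, j)"
        by (rule G.component_unique[OF assms(3) decomposition _ ij' ij])
          (rule objects, assumption, rule isomorphic_coind_connected[OF R R' nz iso])
      then have eq: "i' = i" "j' = j" by auto
      show ?iso' using isomorphic_coindD[OF R R'[unfolded eq] iso[unfolded eq]] eq by simp
    next
      assume iso: ?iso'
      then have eq: "i' = i" "j' = j" by auto
      show ?model_iso unfolding eq using isomorphic_coindI[OF R R'[unfolded eq]] iso by simp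
    qed
    finally show ?thesis .
  qed
  have part3: "\<exists>(i, j)\<in>component_indices G H c. \<exists>(W :: (complex, 'v) module) \<rho>.
           irreducible_rep (stabilizer_group G (A i j)) W \<rho> \<and>
           isomorphic_actions G V \<pi>
             (Ind_space G H (A i j) W \<rho>) (Ind_action G H (A i j) W \<rho>)"
    if V: "irreducible_global_partial_rep G H V \<pi>" for V :: "(complex, 'v) module" and \<pi>
  proof -
    have "\<exists>B'\<in>(\<lambda>(i, j). A i j) ` component_indices G H c. (B, B') \<in> gpd_connected G H"
      if "B \<in> coset_unions G H" for B
    proof -
      have "\<exists>(i, j)\<in>component_indices G H c. (B, A i j) \<in> gpd_connected G H"
        by (rule G.component_exists[OF assms(3) decomposition _ that]) (rule objects)
      then show ?thesis by (metis (no_types, lifting) case_prodE case_prod_conv imageI)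
    qed
    then obtain B where "B \<in> (\<lambda>(i, j). A i j) ` component_indices G H c" and B: "maximal_object G V \<pi> H B"
      using maximal_object_exists[OF assms(1-3) V] by blast
    then obtain i j where ij: "(i, j) \<in> component_indices G H c" "maximal_object G V \<pi> H (A i j)"
      by auto
    interpret O: maximal_object G V \<pi> H "A i j" by (rule ij(2))
    \<comment> \<open>The inducing representation is the fixed space at A i j with \<pi> as its
      action, a space of the same type as V.\<close>
    have "irreducible_rep (stabilizer_group G (A i j)) O.W \<pi> \<and>
        isomorphic_actions G V \<pi> (Ind_space G H (A i j) O.W \<pi>) (Ind_action G H (A i j) O.W \<pi>)"
      using O.irreducible_W isomorphic_actions_trans[OF O.isomorphic_coind O.S.M_isomorphic_Ind] by simp
    then show ?thesis using ij(1) by blast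
  qed
  show ?thesis using part1 part2 part3 by blast
qed

end
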